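(* Let $\beta_\star\in\mathbf R^d\setminus\{0\}$, $M_\star=\beta_\star\beta_\star^\top$, $\Sigma\in\mathbf S^d_+$, and $y=\langle x,\beta_\star\rangle^2+\varepsilon$, where $x\sim\mathsf D_x=\mathsf N(0,\Sigma)$ and $\varepsilon$ is independent of $x$ with zero mean and finite variance; let $\mathsf D$ be the joint law of $(x,y)$. Consider the two phase retrieval problems $$\text{(a)}\quad \min_{M\in\mathbf S^d_+:\ \mathrm{rank}(M)=1}\ \mathbb E_{(x,y)\sim\mathsf D}\tfrac12\big(x^\top Mx-y\big)^2,\qquad \text{(b)}\quad \min_{\beta\in\mathbf R^d\setminus\{0\}}\ \mathbb E_{(x,y)\sim\mathsf D}\tfrac18\big(\langle x,\beta\rangle^2-y\big)^2.$$ For each of them, $$\sqrt{(1-\tfrac2\pi)\lambda_{\min}(\Sigma)}\ \le\ \mathrm{RSE}(\mathsf D)\ \le\ \sqrt{\lambda_{\min}(\Sigma)}.$$ Moreover, if $\mathsf N(0,\Sigma)\notin\mathcal E$, then $$c_{\rm lb}\cdot\frac{1-\frac2\pi}{3\langle\Sigma\beta_\star,\beta_\star\rangle}\ \le\ \mathrm{RSE}(\mathsf D)^2\cdot\mathrm{REG}(\mathsf D)\ \le\ c_{\rm ub}\cdot\frac1{\langle\Sigma\beta_\star,\beta_\star\rangle},$$ where $(c_{\rm lb},c_{\rm ub})=(\tfrac12\|\beta_\star\|_2^2,\|\beta_\star\|_2^2)$ for problem (a) and $(c_{\rm lb},c_{\rm ub})=(1,1)$ for problem (b).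
   Context: $\mathcal P_4(\mathbf R^d)$ is the set of Borel probability measures on $\mathbf R^d$ with finite fourth moment; $\mathbf S^d_+$ is the cone of PSD matrices in the space $\mathbf S^d$ of symmetric matrices with trace inner product. $W_2(\mu,\nu)=\min_{\pi\in\Pi(\mu,\nu)}(\mathbb E_{(x,y)\sim\pi}\|x-y\|_2^2)^{1/2}$ over couplings, $W_2(\mu,\mathcal E)=\inf_{\nu\in\mathcal E}W_2(\mu,\nu)$. Tilt-stability and REG: for a $C^2$ embedded submanifold $\mathcal M$ of a Euclidean space and $C^2$-smooth $f$ on $\mathcal M$, a minimizer $\theta_\star$ of $f$ over $\mathcal M$ is tilt-stable if for some $\epsilon>0$ the map $\sigma(v)=\operatorname{argmin}_{\theta\in\mathcal M\cap B_\epsilon(\theta_\star)}\{f(\theta)-\langle v,\theta\rangle\}$ satisfies $\sigma(0)=\theta_\star$ and is single-valued and $C^1$-smooth on a neighborhood of the origin; then $\mathrm{REG}=\|\nabla\sigma(0)\|_{\rm op}$; otherwise $\mathrm{REG}=+\infty$. $\mathrm{REG}(\mathsf D)$ is this quantity for the problem at hand at its true parameter ($M_\star$ in (a), $\beta_\star$ in (b)). RSE (supervised, permissible feature distributions $\mathcal P_4(\mathbf R^d)$): $\mathcal E$ is the set of $\mu\in\mathcal P_4(\mathbf R^d)$ for which the true parameter is not a tilt-stable minimizer of the problem in which $x\sim\mu$ and the conditional law of $y$ given $x$ is unchanged; $\mathrm{RSE}(\mathsf D)=W_2(\mathsf D_x,\mathcal E)$. *)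

theory Defs
  imports "HOL-Probability.Probability"
begin

section \<open>Matrices\<close>

text \<open>The inner product and norm of \<^typ>\<open>real^'d^'d\<close> are the trace inner product and the
  Frobenius norm, so \<open>sym_mats\<close> is the space of symmetric matrices as a Euclidean subspace.\<close>

definition sym_mats :: "(real^'d^'d) set" where
  "sym_mats = {A. transpose A = A}"

definition psd_mats :: "(real^'d^'d) set" where
  "psd_mats = {A \<in> sym_mats. \<forall>u. 0 \<le> u \<bullet> (A *v u)}"

definition rank_one_psd :: "(real^'d^'d) set" where
  "rank_one_psd = {A \<in> psd_mats. rank A = 1}"

definition outer :: "real^'d \<Rightarrow> real^'d^'d" where
  "outer b = (\<chi> i j. b $ i * b $ j)"

definition lambda_min :: "real^'d^'d \<Rightarrow> real" where
  "lambda_min A = (LEAST l. \<exists>u. u \<noteq> 0 \<and> A *v u = l *\<^sub>R u)"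

section \<open>Gaussian laws\<close>

definition std_gaussian :: "(real^'d) measure" where
  "std_gaussian = density lborel (\<lambda>x. ennreal (\<Prod>i\<in>UNIV. std_normal_density (x $ i)))"

text \<open>The possibly degenerate law \<open>N(0, S)\<close>: the law of \<open>A z\<close> with \<open>z\<close> standard Gaussian and
  \<open>A A\<^sup>T = S\<close>. It does not depend on the choice of \<open>A\<close>, and an \<open>A\<close> exists
  for every positive semidefinite \<open>S\<close>.\<close>

definition centered_gaussian :: "real^'d^'d \<Rightarrow> (real^'d) measure \<Rightarrow> bool" where
  "centered_gaussian S \<mu> \<longleftrightarrow>
     (\<exists>A :: real^'d^'d. A ** transpose A = S \<and> \<mu> = distr std_gaussian borel (\<lambda>z. A *v z))"

section \<open>Wasserstein distance\<close>

definition P4 :: "(real^'d) measure set" where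
  "P4 = {\<mu>. prob_space \<mu> \<and> sets \<mu> = sets borel \<and> integrable \<mu> (\<lambda>x. norm x ^ 4)}"

definition couplings ::
    "(real^'d) measure \<Rightarrow> (real^'d) measure \<Rightarrow> ((real^'d) \<times> (real^'d)) measure set" where
  "couplings \<mu> \<nu> = {\<pi>. prob_space \<pi> \<and> sets \<pi> = sets borel \<and>
                       distr \<pi> borel fst = \<mu> \<and> distr \<pi> borel snd = \<nu>}"

text \<open>Intended for marginals with finite second moments (in particular in \<open>P4\<close>): then the cost is
  integrable for every coupling and the infimum is attained.\<close>

definition W2 :: "(real^'d) measure \<Rightarrow> (real^'d) measure \<Rightarrow> real" where
  "W2 \<mu> \<nu> = (INF \<pi>\<in>couplings \<mu> \<nu>. sqrt (LINT z|\<pi>. (norm (fst z - snd z))\<^sup>2))"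

definition W2_set :: "(real^'d) measure \<Rightarrow> (real^'d) measure set \<Rightarrow> ereal" where
  "W2_set \<mu> \<E> = (INF \<nu>\<in>\<E>. ereal (W2 \<mu> \<nu>))"

section \<open>Tilt-stability and REG\<close>

text \<open>The ambient Euclidean space is a linear subspace \<open>E\<close> of a type; tilts range over \<open>E\<close>, and
  derivatives and operator norms of the solution map are taken along \<open>E\<close>. The definitions are meant
  for a \<open>C\<^sup>2\<close> embedded submanifold \<open>M\<close> of \<open>E\<close> and a function \<open>f\<close> that is \<open>C\<^sup>2\<close> on \<open>M\<close>.\<close>

definition tilt_argmin ::
    "'a::euclidean_space set \<Rightarrow> ('a \<Rightarrow> real) \<Rightarrow> 'a \<Rightarrow> real \<Rightarrow> 'a \<Rightarrow> 'a set" where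
  "tilt_argmin M f \<theta>\<^sub>0 \<epsilon> v =
     {\<theta>. is_arg_min (\<lambda>\<theta>. f \<theta> - v \<bullet> \<theta>) (\<lambda>\<theta>. \<theta> \<in> M \<inter> ball \<theta>\<^sub>0 \<epsilon>) \<theta>}"

text \<open>On a neighbourhood of the origin in \<open>E\<close>, the argmin is the single point \<open>\<sigma> v\<close>, and \<open>\<sigma>\<close> is
  \<open>C\<^sup>1\<close> with derivative \<open>\<sigma>'\<close>. Only the restriction of \<open>\<sigma>' v\<close> to \<open>E\<close> is determined.\<close>

definition tilt_solution ::
    "'a::euclidean_space set \<Rightarrow> 'a set \<Rightarrow> ('a \<Rightarrow> real) \<Rightarrow> 'a \<Rightarrow> real \<Rightarrow>
     ('a \<Rightarrow> 'a) \<Rightarrow> ('a \<Rightarrow> 'a \<Rightarrow>\<^sub>L 'a) \<Rightarrow> bool" where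
  "tilt_solution E M f \<theta>\<^sub>0 \<epsilon> \<sigma> \<sigma>' \<longleftrightarrow>
     \<epsilon> > 0 \<and> \<sigma> 0 = \<theta>\<^sub>0 \<and>
     (\<exists>r>0. (\<forall>v\<in>E \<inter> ball 0 r. tilt_argmin M f \<theta>\<^sub>0 \<epsilon> v = {\<sigma> v}) \<and>
            (\<forall>v\<in>E \<inter> ball 0 r. (\<sigma> has_derivative blinfun_apply (\<sigma>' v)) (at v within E)) \<and>
            continuous_on (E \<inter> ball 0 r) \<sigma>')"

definition tilt_stable ::
    "'a::euclidean_space set \<Rightarrow> 'a set \<Rightarrow> ('a \<Rightarrow> real) \<Rightarrow> 'a \<Rightarrow> bool" where
  "tilt_stable E M f \<theta>\<^sub>0 \<longleftrightarrow>
     is_arg_min f (\<lambda>\<theta>. \<theta> \<in> M) \<theta>\<^sub>0 \<and> (\<exists>\<epsilon> \<sigma> \<sigma>'. tilt_solution E M f \<theta>\<^sub>0 \<epsilon> \<sigma> \<sigma>')"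

definition onorm_on :: "'a::euclidean_space set \<Rightarrow> ('a \<Rightarrow>\<^sub>L 'a) \<Rightarrow> real" where
  "onorm_on E L = (SUP v\<in>E \<inter> cball 0 1. norm (blinfun_apply L v))"

text \<open>The value described by \<open>THE\<close> is unique: solution maps for different radii \<open>\<epsilon>\<close> agree near the
  origin.\<close>

definition REG ::
    "'a::euclidean_space set \<Rightarrow> 'a set \<Rightarrow> ('a \<Rightarrow> real) \<Rightarrow> 'a \<Rightarrow> ereal" where
  "REG E M f \<theta>\<^sub>0 =
     (if tilt_stable E M f \<theta>\<^sub>0
      then ereal (THE r. \<exists>\<epsilon> \<sigma> \<sigma>'. tilt_solution E M f \<theta>\<^sub>0 \<epsilon> \<sigma> \<sigma>' \<and> r = onorm_on E (\<sigma>' 0))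
      else \<infinity>)"

section \<open>RSE for supervised problems\<close>

definition risk ::
    "('p \<Rightarrow> (real^'d) \<times> real \<Rightarrow> real) \<Rightarrow> ((real^'d) \<times> real) measure \<Rightarrow> 'p \<Rightarrow> real" where
  "risk l D \<theta> = (LINT z|D. l \<theta> z)"

text \<open>The joint law of \<open>(x, y)\<close> when \<open>x\<close> has law \<open>\<mu>\<close> and the conditional law of \<open>y\<close> given \<open>x\<close> is
  \<open>K x\<close>.\<close>

definition joint_law ::
    "(real^'d) measure \<Rightarrow> (real^'d \<Rightarrow> real measure) \<Rightarrow> ((real^'d) \<times> real) measure" where
  "joint_law \<mu> K = \<mu> \<bind> (\<lambda>x. distr (K x) borel (\<lambda>y. (x, y)))"

definition exceptional_set ::
    "'p::euclidean_space set \<Rightarrow> 'p set \<Rightarrow> ('p \<Rightarrow> (real^'d) \<times> real \<Rightarrow> real) \<Rightarrow> 'p \<Rightarrow>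
     (real^'d \<Rightarrow> real measure) \<Rightarrow> (real^'d) measure set" where
  "exceptional_set E M l \<theta>\<^sub>0 K =
     {\<mu> \<in> P4. \<not> tilt_stable E M (risk l (joint_law \<mu> K)) \<theta>\<^sub>0}"

text \<open>The conditional law \<open>K\<close> is an explicit argument because a joint law \<open>D\<close> determines it only up
  to null sets of its first marginal, whereas the competing feature laws may be singular to that
  marginal.\<close>

definition RSE ::
    "'p::euclidean_space set \<Rightarrow> 'p set \<Rightarrow> ('p \<Rightarrow> (real^'d) \<times> real \<Rightarrow> real) \<Rightarrow> 'p \<Rightarrow>
     (real^'d \<Rightarrow> real measure) \<Rightarrow> ((real^'d) \<times> real) measure \<Rightarrow> ereal" where
  "RSE E M l \<theta>\<^sub>0 K D = W2_set (distr D borel fst) (exceptional_set E M l \<theta>\<^sub>0 K)"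

section \<open>The two phase retrieval problems\<close>

text \<open>The conditional law of \<open>y = \<langle>x, b\<rangle>\<^sup>2 + e\<close> given \<open>x\<close>, for noise \<open>e\<close> with law \<open>\<nu>\<close> independent of
  \<open>x\<close>.\<close>

definition pr_response :: "real^'d \<Rightarrow> real measure \<Rightarrow> real^'d \<Rightarrow> real measure" where
  "pr_response b \<nu> x = distr \<nu> borel (\<lambda>e. (x \<bullet> b)\<^sup>2 + e)"

definition lossA :: "real^'d^'d \<Rightarrow> (real^'d) \<times> real \<Rightarrow> real" where
  "lossA M = (\<lambda>(x, y). 1/2 * (x \<bullet> (M *v x) - y)\<^sup>2)"

definition lossB :: "real^'d \<Rightarrow> (real^'d) \<times> real \<Rightarrow> real" where
  "lossB b = (\<lambda>(x, y). 1/8 * ((x \<bullet> b)\<^sup>2 - y)\<^sup>2)"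

definition excA :: "real^'d \<Rightarrow> (real^'d \<Rightarrow> real measure) \<Rightarrow> (real^'d) measure set" where
  "excA b K = exceptional_set sym_mats rank_one_psd lossA (outer b) K"

definition RSE_A ::
    "real^'d \<Rightarrow> (real^'d \<Rightarrow> real measure) \<Rightarrow> ((real^'d) \<times> real) measure \<Rightarrow> ereal" where
  "RSE_A b K D = RSE sym_mats rank_one_psd lossA (outer b) K D"

definition REG_A :: "real^'d \<Rightarrow> ((real^'d) \<times> real) measure \<Rightarrow> ereal" where
  "REG_A b D = REG sym_mats rank_one_psd (risk lossA D) (outer b)"

definition excB :: "real^'d \<Rightarrow> (real^'d \<Rightarrow> real measure) \<Rightarrow> (real^'d) measure set" where
  "excB b K = exceptional_set UNIV (- {0}) lossB b K"

definition RSE_B ::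
    "real^'d \<Rightarrow> (real^'d \<Rightarrow> real measure) \<Rightarrow> ((real^'d) \<times> real) measure \<Rightarrow> ereal" where
  "RSE_B b K D = RSE UNIV (- {0}) lossB b K D"

definition REG_B :: "real^'d \<Rightarrow> ((real^'d) \<times> real) measure \<Rightarrow> ereal" where
  "REG_B b D = REG UNIV (- {0}) (risk lossB D) b"

end

theory Submission
  imports Defs
begin

text \<open>
  Near the true parameter both feasible sets are parametrized by vectors \<open>b\<close> (by \<open>b \<mapsto> b b\<^sup>T\<close> in
  problem (a), by the identity in (b)), and a tilted minimizer is a zero of the gradient \<open>G (v, b)\<close> of the
  tilted objective in \<open>b\<close>. If the Hessian at the true parameter is positive definite, the implicit function
  theorem and local strong convexity give tilt-stability; conversely, differentiating
  \<open>G (v, b v) = 0\<close> shows that a \<open>C\<^sup>1\<close> solution map forces the Hessian to be positive definite,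
  and it identifies REG with the maximum of \<open>\<parallel>\<Psi>' h\<parallel>\<^sup>2 / H(h, h)\<close>, where \<open>\<Psi>'\<close> is the derivative of the
  parametrization and \<open>H\<close> the Hessian.

  In both problems \<open>H(u, u)\<close> is a multiple of \<open>Q u = E \<langle>x, \<beta>\<rangle>\<^sup>2 \<langle>x, u\<rangle>\<^sup>2\<close>, so both have the same
  exceptional set: the laws that live on the union of \<open>\<beta>\<^sup>\<bottom>\<close> and another hyperplane \<open>u\<^sup>\<bottom>\<close>.
  Projecting the Gaussian along a lowest eigenvector of \<open>\<Sigma>\<close> gives the upper bound on RSE. The cost of
  moving to the union of two hyperplanes is at least \<open>E min (\<langle>x, a\<rangle>\<^sup>2) (\<langle>x, b\<rangle>\<^sup>2)\<close> with unit normals \<open>a\<close>, \<open>b\<close>,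
  and for standard normals \<open>g, h\<close> with correlation \<open>\<rho>\<close> one has
  \<open>E min (g\<^sup>2) (h\<^sup>2) = 1 - E \<bar>(g - h) (g + h)\<bar> / 2 = 1 - (2 / \<pi>) sqrt (1 - \<rho>\<^sup>2)\<close>.
  Finally, \<open>Q u = \<langle>\<Sigma> \<beta>, \<beta>\<rangle> \<langle>\<Sigma> u, u\<rangle> + 2 \<langle>\<Sigma> \<beta>, u\<rangle>\<^sup>2\<close> for the Gaussian.
\<close>

section \<open>Tilt-stability in a chart\<close>

lemma psd_form_cauchy_schwarz:
  fixes B :: "'b::real_vector \<Rightarrow> 'b \<Rightarrow> real"
  assumes lin: "\<And>x. linear (B x)" and sym: "\<And>x y. B x y = B y x" and psd: "\<And>x. 0 \<le> B x x"
  shows "(B x y)\<^sup>2 \<le> B x x * B y y"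
proof -
  \<comment> \<open>The discriminant argument for a quadratic polynomial in \<open>t\<close> that is
    never negative. The form may have a kernel, so \<open>B y y = 0\<close> is treated
    separately.\<close>
  have expand: "B (x + t *\<^sub>R y) (x + t *\<^sub>R y) = B x x + 2 * t * B x y + t\<^sup>2 * B y y" for t
  proof -
    have "B (x + t *\<^sub>R y) (x + t *\<^sub>R y) = B (x + t *\<^sub>R y) x + t * B (x + t *\<^sub>R y) y"
      by (simp add: linear_add[OF lin] linear_scale[OF lin])
    also have "\<dots> = B x (x + t *\<^sub>R y) + t * B y (x + t *\<^sub>R y)"
      by (simp only: sym)
    also have "\<dots> = B x x + t * B x y + t * (B x y + t * B y y)"
      by (simp add: linear_add[OF lin] linear_scale[OF lin] sym[of y x])
    finally show ?thesis by (simp add: algebra_simps power2_eq_square)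
  qed
  have nonneg: "0 \<le> B x x + 2 * t * B x y + t\<^sup>2 * B y y" for t
    using psd[of "x + t *\<^sub>R y"] unfolding expand .
  show ?thesis
  proof (cases "B y y = 0")
    case True
    have "B x y = 0"
    proof (rule ccontr)
      assume "B x y \<noteq> 0"
      \<comment> \<open>This \<open>t\<close> solves \<open>2 * t * B x y = - (B x x + 1)\<close>,
        so the polynomial, affine because \<open>B y y = 0\<close>, takes the value -1.\<close>
      then show False
        using nonneg[of "- (B x x + 1) / (2 * B x y)"] True by (simp add: field_simps)
    qed
    then show ?thesis using True by simp
  next
    case False
    then have "B y y > 0" using psd[of y] by simp
    \<comment> \<open>The minimiser of the polynomial.\<close>
    then show ?thesis
      using nonneg[of "- B x y / B y y"] by (simp add: field_simps power2_eq_square)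
  qed
qed

text \<open>The inverse function theorem asks for a left inverse of the derivative as a bounded
  linear map; in finite dimension injectivity supplies one.\<close>

lemma linear_inj_imp_left_inverse_blinfun:
  fixes L :: "'a::euclidean_space \<Rightarrow>\<^sub>L 'a"
  assumes "\<And>x. L x = 0 \<Longrightarrow> x = 0"
  obtains K :: "'a \<Rightarrow>\<^sub>L 'a" where "K o\<^sub>L L = id_blinfun"
proof -
  have lin: "linear (blinfun_apply L)"
    by (simp add: blinfun.bounded_linear_right bounded_linear.linear)
  then have "inj (blinfun_apply L)"
    using assms linear_injective_0 by blast
  then obtain g where g: "linear g" "g \<circ> blinfun_apply L = id"
    using linear_injective_left_inverse[OF lin] by blast
  show ?thesis
  proof (rule that[of "Blinfun g"])
    have "bounded_linear g" using g(1) by (simp add: linear_conv_bounded_linear)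
    then show "Blinfun g o\<^sub>L L = id_blinfun"
      using g(2) by (intro blinfun_eqI) (simp add: bounded_linear_Blinfun_apply pointfree_idE)
  qed
qed

text \<open>One abstract setting for both problems. \<open>\<Psi>\<close> parametrises
  \<open>M\<close> near \<open>\<theta>0\<close>, and \<open>chart\<close> is a right inverse of
  \<open>\<Psi>\<close> on the part of \<open>M\<close> close to \<open>\<theta>0\<close>,
  differentiable at that point. \<open>G\<close> is the gradient in \<open>b\<close> of the tilted
  objective, taken as a function of tilt and parameter jointly, and \<open>DG\<close> is its total
  derivative. Continuity of derivatives is stated for each fixed direction, which in finite
  dimension yields continuity in operator norm.\<close>

locale tilt_chart =
  fixes E M :: "'a::euclidean_space set" and f :: "'a \<Rightarrow> real" and \<theta>0 :: 'a
    and U :: "'b::euclidean_space set" and \<Psi> :: "'b \<Rightarrow> 'a" and \<Psi>' :: "'b \<Rightarrow> 'b \<Rightarrow> 'a"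
    and chart :: "'a \<Rightarrow> 'b" and \<beta> :: 'b
    and G :: "'a \<times> 'b \<Rightarrow> 'b" and DG :: "'a \<times> 'b \<Rightarrow> 'a \<times> 'b \<Rightarrow> 'b"
  assumes subspE: "subspace E"
    and openU: "open U" and \<beta>U: "\<beta> \<in> U" and \<Psi>U: "\<Psi> ` U \<subseteq> M" and \<Psi>\<beta>: "\<Psi> \<beta> = \<theta>0"
    and der\<Psi>: "\<And>b. b \<in> U \<Longrightarrow> (\<Psi> has_derivative \<Psi>' b) (at b)"
    and cont\<Psi>': "\<And>h. continuous_on U (\<lambda>b. \<Psi>' b h)"
    and \<Psi>'E: "\<And>h. \<Psi>' \<beta> h \<in> E" and inj\<Psi>': "\<And>h. \<Psi>' \<beta> h = 0 \<Longrightarrow> h = 0"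
    and chart_diff: "chart differentiable (at \<theta>0)" and chart_\<theta>0: "chart \<theta>0 = \<beta>"
    and chart_inv: "\<exists>\<delta>>0. \<forall>\<theta>\<in>M \<inter> ball \<theta>0 \<delta>. \<Psi> (chart \<theta>) = \<theta>"
    and grad: "\<And>v b. b \<in> U \<Longrightarrow>
      ((\<lambda>b. f (\<Psi> b) - v \<bullet> \<Psi> b) has_derivative (\<lambda>h. G (v, b) \<bullet> h)) (at b)"
    and derG: "\<And>v b. b \<in> U \<Longrightarrow> (G has_derivative DG (v, b)) (at (v, b))"
    and contDG: "\<And>k. continuous_on (UNIV \<times> U) (\<lambda>z. DG z k)"
    and G0: "G (0, \<beta>) = 0"
    and DGv: "\<And>v k. DG (0, \<beta>) (v, 0) \<bullet> k = - (v \<bullet> \<Psi>' \<beta> k)"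
    and DGsym: "\<And>h k. DG (0, \<beta>) (0, h) \<bullet> k = DG (0, \<beta>) (0, k) \<bullet> h"
    and DGpsd: "\<And>h. 0 \<le> DG (0, \<beta>) (0, h) \<bullet> h"
    and minimal: "\<And>\<theta>. \<theta> \<in> M \<Longrightarrow> f \<theta>0 \<le> f \<theta>"
begin

section \<open>The Hessian form at the true parameter\<close>

definition hess :: "'b \<Rightarrow> 'b \<Rightarrow> real" where
  "hess h k = DG (0, \<beta>) (0, h) \<bullet> k"

lemma bl_DG: "b \<in> U \<Longrightarrow> bounded_linear (DG (v, b))"
  using derG has_derivative_bounded_linear by blast

lemma bl_\<Psi>': "b \<in> U \<Longrightarrow> bounded_linear (\<Psi>' b)"
  using der\<Psi> has_derivative_bounded_linear by blast

lemma DG_split: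
  assumes "b \<in> U" shows "DG (v, b) (w, h) = DG (v, b) (w, 0) + DG (v, b) (0, h)"
  using linear_add[OF bounded_linear.linear[OF bl_DG[OF assms, of v]], of "(w,0)" "(0,h)"] by simp

lemma linear_hess: "linear (hess h)"
  unfolding hess_def by (intro bounded_linear.linear bounded_linear_inner_right)

lemma hess_sym: "hess h k = hess k h"
  unfolding hess_def by (rule DGsym)

lemma hess_nonneg: "0 \<le> hess h h"
  unfolding hess_def by (rule DGpsd)

lemma hess_cauchy_schwarz: "(hess h k)\<^sup>2 \<le> hess h h * hess k k"
  by (rule psd_form_cauchy_schwarz[OF linear_hess hess_sym hess_nonneg])

lemma chart_cont: "isCont chart \<theta>0"
  using chart_diff differentiable_imp_continuous_within by blast

lemma \<Psi>_cont: "b \<in> U \<Longrightarrow> isCont \<Psi> b"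
  using der\<Psi> has_derivative_continuous by blast

section \<open>Necessity: stationarity and the derivative of a solution map\<close>

lemma local_param:
  assumes "\<rho> > 0"
  obtains \<epsilon> where "\<epsilon> > 0" "\<And>\<theta>. \<theta> \<in> M \<inter> ball \<theta>0 \<epsilon> \<Longrightarrow> \<Psi> (chart \<theta>) = \<theta> \<and> chart \<theta> \<in> ball \<beta> \<rho>"
proof -
  obtain \<delta> where \<delta>: "\<delta> > 0" "\<forall>\<theta>\<in>M \<inter> ball \<theta>0 \<delta>. \<Psi> (chart \<theta>) = \<theta>"
    using chart_inv by blast
  obtain \<delta>' where \<delta>': "\<delta>' > 0" "\<forall>\<theta>. dist \<theta> \<theta>0 < \<delta>' \<longrightarrow> dist (chart \<theta>) (chart \<theta>0) < \<rho>"
    using chart_cont assms unfolding continuous_at_eps_delta by blast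
  show ?thesis
    by (rule that[of "min \<delta> \<delta>'"]) (use \<delta> \<delta>' in \<open>auto simp: chart_\<theta>0 dist_commute\<close>)
qed

text \<open>\<open>U\<close> is open and \<open>\<Psi>\<close> is continuous, so all parameters near
  \<open>b\<close> give competitors in the ball: \<open>b\<close> is an unconstrained local
  minimiser, and Fermat's rule applies.\<close>

lemma stationary:
  assumes b: "b \<in> U" and \<theta>: "\<Psi> b \<in> ball \<theta>0 \<epsilon>" and min: "\<Psi> b \<in> tilt_argmin M f \<theta>0 \<epsilon> v"
  shows "G (v, b) = 0"
proof -
  have "\<forall>\<^sub>F b' in at b. b' \<in> U"
    using b openU eventually_at_in_open' by blast
  moreover have "\<forall>\<^sub>F b' in at b. \<Psi> b' \<in> ball \<theta>0 \<epsilon>"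
    using \<Psi>_cont[OF b] \<theta> unfolding isCont_def by (intro topological_tendstoD) auto
  ultimately have "\<forall>\<^sub>F b' in at b. f (\<Psi> b) - v \<bullet> \<Psi> b \<le> f (\<Psi> b') - v \<bullet> \<Psi> b'"
  proof eventually_elim
    case (elim b')
    then have "\<Psi> b' \<in> M \<inter> ball \<theta>0 \<epsilon>" using \<Psi>U by auto
    then show ?case using min unfolding tilt_argmin_def is_arg_min_def by force
  qed
  then have "(\<lambda>h. G (v, b) \<bullet> h) = (\<lambda>h. 0)"
    using grad[OF b, of v] has_derivative_local_min by blast
  then show ?thesis by (metis inner_eq_zero_iff)
qed

text \<open>In chart coordinates the solution is \<open>b v = chart (\<sigma> v)\<close>, and
  \<open>h\<close> is the derivative of \<open>b\<close> at 0. Differentiating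
  \<open>G (v, b v) = 0\<close> gives the linear equation for \<open>h v\<close>, from which
  positivity of the Hessian, uniqueness of \<open>\<sigma>' 0\<close> on \<open>E\<close> and the
  value of REG are all read off.\<close>

lemma solution_derivative:
  assumes sol: "tilt_solution E M f \<theta>0 \<epsilon> \<sigma> \<sigma>'"
  obtains h where "\<And>v. v \<in> E \<Longrightarrow> \<sigma>' 0 v = \<Psi>' \<beta> (h v)"
    and "\<And>v k. v \<in> E \<Longrightarrow> hess (h v) k = v \<bullet> \<Psi>' \<beta> k"
proof -
  obtain r where r: "r > 0" "\<And>v. v \<in> E \<inter> ball 0 r \<Longrightarrow> tilt_argmin M f \<theta>0 \<epsilon> v = {\<sigma> v}"
    "\<And>v. v \<in> E \<inter> ball 0 r \<Longrightarrow> (\<sigma> has_derivative blinfun_apply (\<sigma>' v)) (at v within E)"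
    and \<epsilon>: "\<epsilon> > 0" and \<sigma>0: "\<sigma> 0 = \<theta>0"
    using sol unfolding tilt_solution_def by blast
  have E0: "0 \<in> E" using subspE by (rule subspace_0)
  have d\<sigma>: "(\<sigma> has_derivative blinfun_apply (\<sigma>' 0)) (at 0 within E)"
    using r E0 by auto
  obtain c' where c': "(chart has_derivative c') (at \<theta>0)"
    using chart_diff unfolding differentiable_def by blast
  define b where "b v = chart (\<sigma> v)" for v
  define b' where "b' = c' \<circ> blinfun_apply (\<sigma>' 0)"
  have db: "(b has_derivative b') (at 0 within E)"
    unfolding b_def b'_def o_def
    using has_derivative_compose[OF d\<sigma>, of chart c'] c' by (simp add: \<sigma>0)
  have b0: "b 0 = \<beta>" by (simp add: b_def \<sigma>0 chart_\<theta>0)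
  obtain \<rho> where \<rho>: "\<rho> > 0" "ball \<beta> \<rho> \<subseteq> U" using openU \<beta>U open_contains_ball by blast
  obtain \<epsilon>' where \<epsilon>': "\<epsilon>' > 0" "\<And>\<theta>. \<theta> \<in> M \<inter> ball \<theta>0 \<epsilon>' \<Longrightarrow> \<Psi> (chart \<theta>) = \<theta> \<and> chart \<theta> \<in> ball \<beta> \<rho>"
    using local_param[OF \<rho>(1)] by blast
  have "(\<sigma> \<longlongrightarrow> \<theta>0) (at 0 within E)"
    using has_derivative_continuous[OF d\<sigma>] unfolding continuous_within \<sigma>0 .
  \<comment> \<open>\<open>\<epsilon>\<close> makes \<open>stationary\<close> applicable,
    \<open>\<epsilon>'\<close> makes the chart invert \<open>\<Psi>\<close>.\<close>
  then have "\<forall>\<^sub>F v in at 0 within E. \<sigma> v \<in> ball \<theta>0 (min \<epsilon> \<epsilon>')"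
    using \<epsilon> \<epsilon>'(1) by (intro topological_tendstoD) auto
  then obtain s where s: "s > 0" "\<And>v. v \<in> E \<Longrightarrow> v \<noteq> 0 \<Longrightarrow> dist v 0 < s \<Longrightarrow> \<sigma> v \<in> ball \<theta>0 (min \<epsilon> \<epsilon>')"
    unfolding eventually_at by blast
  define t where "t = min r s"
  have t: "t > 0" using r s by (simp add: t_def)
  have near: "b v \<in> U \<and> \<Psi> (b v) = \<sigma> v \<and> G (v, b v) = 0" if v: "v \<in> E" "dist v 0 < t" for v
  proof -
    have am: "\<sigma> v \<in> tilt_argmin M f \<theta>0 \<epsilon> v"
      using r(2)[of v] v by (auto simp: t_def)
    then have "\<sigma> v \<in> M" unfolding tilt_argmin_def is_arg_min_def by auto
    moreover have ball: "\<sigma> v \<in> ball \<theta>0 (min \<epsilon> \<epsilon>')"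
    proof (cases "v = 0")
      case True then show ?thesis using \<epsilon> \<epsilon>' \<sigma>0 by simp
    next
      case False then show ?thesis using s(2)[of v] v by (simp add: t_def)
    qed
    ultimately have 1: "\<Psi> (b v) = \<sigma> v" "b v \<in> ball \<beta> \<rho>"
      using \<epsilon>'(2)[of "\<sigma> v"] by (auto simp: b_def)
    moreover have bU: "b v \<in> U" using 1 \<rho> by blast
    moreover have "G (v, b v) = 0"
      by (rule stationary[OF bU, of \<epsilon>]) (use 1 am ball in auto)
    ultimately show ?thesis by blast
  qed
  \<comment> \<open>A map that is constant on \<open>E\<close> near the origin has a derivative within \<open>E\<close> that vanishes on \<open>E\<close>,
    although that derivative is not determined off \<open>E\<close>.\<close>
  have within_E_zero: "w = 0" if w: "\<And>v. v \<in> E \<Longrightarrow> dist v 0 < t \<Longrightarrow> F v = F 0"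
      "(F has_derivative L) (at 0 within E)" "u \<in> E" "w = L u" for F :: "'a \<Rightarrow> 'c::real_normed_vector" and L u w
  proof -
    have line: "((\<lambda>x. x *\<^sub>R u) has_derivative (\<lambda>x. x *\<^sub>R u)) (at 0)" for u :: 'a
      by (auto intro!: derivative_eq_intros)
    \<comment> \<open>\<open>E\<close> may have empty interior, so uniqueness of derivatives is used
      on the line spanned by \<open>u\<close>, which lies in \<open>E\<close>.\<close>
    have "(F has_derivative L) (at ((0::real) *\<^sub>R u) within range (\<lambda>x. x *\<^sub>R u))"
      using w(2,3) subspE
      by (auto intro!: has_derivative_subset[of F L 0 E] simp: subspace_scale)
    then have "((\<lambda>x. F (x *\<^sub>R u)) has_derivative (\<lambda>x. L (x *\<^sub>R u))) (at 0)"
      by (rule has_derivative_in_compose[OF line])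
    moreover have "((\<lambda>x::real. F (x *\<^sub>R u)) has_derivative (\<lambda>x. 0)) (at 0)"
    proof (rule has_derivative_transform_within_open[OF has_derivative_const])
      \<comment> \<open>The summand 1 covers \<open>u = 0\<close>.\<close>
      show "open (ball (0::real) (t / (norm u + 1)))" by simp
      show "0 \<in> ball (0::real) (t / (norm u + 1))"
        using t by (simp add: add_nonneg_pos)
      fix x :: real assume "x \<in> ball 0 (t / (norm u + 1))"
      then have "\<bar>x\<bar> < t / (norm u + 1)" by simp
      then have "\<bar>x\<bar> * (norm u + 1) < t"
        by (subst (asm) pos_less_divide_eq) (auto simp: add_nonneg_pos)
      moreover have "\<bar>x\<bar> * norm u \<le> \<bar>x\<bar> * (norm u + 1)" by (simp add: mult_left_mono)
      ultimately have "dist (x *\<^sub>R u) 0 < t" by simp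
      then show "F 0 = F (x *\<^sub>R u)"
        using w(1)[of "x *\<^sub>R u"] w(3) subspE by (simp add: subspace_scale)
    qed
    ultimately have "(\<lambda>x. L (x *\<^sub>R u)) = (\<lambda>x. 0)"
      using has_derivative_unique by blast
    then have "L (1 *\<^sub>R u) = 0" by meson
    then show ?thesis using w(4) by simp
  qed
  \<comment> \<open>Differentiates \<open>\<Psi> (b v) = \<sigma> v\<close>.\<close>
  have 1: "\<sigma>' 0 v = \<Psi>' \<beta> (b' v)" if "v \<in> E" for v
  proof -
    have "((\<lambda>v. \<Psi> (b v) - \<sigma> v) has_derivative (\<lambda>v. \<Psi>' \<beta> (b' v) - \<sigma>' 0 v)) (at 0 within E)"
      using has_derivative_compose[OF db, of \<Psi> "\<Psi>' \<beta>"] der\<Psi>[OF \<beta>U] d\<sigma>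
      by (intro has_derivative_diff) (simp_all add: b0)
    from within_E_zero[OF _ this that refl] show ?thesis using near E0 t by simp
  qed
  \<comment> \<open>Differentiates \<open>G (v, b v) = 0\<close>.\<close>
  have 2: "DG (0, \<beta>) (v, b' v) = 0" if "v \<in> E" for v
  proof -
    have "((\<lambda>v. (v, b v)) has_derivative (\<lambda>v. (v, b' v))) (at 0 within E)"
      using db by (intro has_derivative_Pair) auto
    from has_derivative_compose[OF this, of G "DG (0, \<beta>)"]
    have "((\<lambda>v. G (v, b v)) has_derivative (\<lambda>v. DG (0, \<beta>) (v, b' v))) (at 0 within E)"
      using derG[OF \<beta>U] by (simp add: b0)
    from within_E_zero[OF _ this that refl] show ?thesis using near E0 t by simp
  qed
  show ?thesis
  proof (rule that[of b', OF 1])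
    fix v k assume "v \<in> E"
    then have "DG (0, \<beta>) (v, 0) \<bullet> k + hess (b' v) k = 0"
      using 2[of v] DG_split[OF \<beta>U, of 0 v "b' v"] unfolding hess_def
      by (metis inner_add_left inner_zero_left)
    then show "hess (b' v) k = v \<bullet> \<Psi>' \<beta> k" by (simp add: DGv)
  qed
qed

text \<open>Test the equation of \<open>solution_derivative\<close> with the tilt
  \<open>\<Psi>' \<beta> h\<close>, which lies in \<open>E\<close>: at \<open>k = h\<close> its
  right side is the squared norm of \<open>\<Psi>' \<beta> h\<close>. If
  \<open>hess h h = 0\<close>, Cauchy-Schwarz makes the left side 0, against injectivity of
  \<open>\<Psi>' \<beta>\<close>.\<close>

lemma tilt_stable_imp_pos:
  assumes "tilt_stable E M f \<theta>0" and "h \<noteq> 0"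
  shows "0 < hess h h"
proof -
  obtain \<epsilon> \<sigma> \<sigma>' where "tilt_solution E M f \<theta>0 \<epsilon> \<sigma> \<sigma>'"
    using assms unfolding tilt_stable_def by blast
  then obtain g where g: "\<And>v k. v \<in> E \<Longrightarrow> hess (g v) k = v \<bullet> \<Psi>' \<beta> k"
    by (rule solution_derivative) blast
  have "hess h h \<noteq> 0"
  proof
    assume "hess h h = 0"
    then have "(hess (g (\<Psi>' \<beta> h)) h)\<^sup>2 \<le> 0"
      using hess_cauchy_schwarz[of "g (\<Psi>' \<beta> h)" h] by simp
    then have "\<Psi>' \<beta> h = 0"
      using g[OF \<Psi>'E, of h h] by simp
    then show False using inj\<Psi>' assms(2) by blast
  qed
  then show ?thesis using hess_nonneg[of h] by simp
qed

section \<open>Sufficiency: uniform convexity, the implicit function theorem and local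
  minimality\<close>

lemma hess_coercive:
  assumes pos: "\<And>h. h \<noteq> 0 \<Longrightarrow> 0 < hess h h"
  obtains c where "c > 0" "\<And>h. c * (norm h)\<^sup>2 \<le> hess h h"
proof -
  have bl: "bounded_linear (\<lambda>h. DG (0, \<beta>) (0, h))"
    using bounded_linear_compose[OF bl_DG[OF \<beta>U, of 0] bounded_linear_Pair[OF bounded_linear_zero bounded_linear_ident]] .
  have cont: "continuous_on (sphere 0 1) (\<lambda>h. hess h h)"
    unfolding hess_def by (intro continuous_intros linear_continuous_on[OF bl])
  obtain x :: 'b where "x \<in> sphere 0 1"
    by (metis dist_0_norm mem_sphere vector_choose_size zero_le_one)
  then obtain h0 where h0: "h0 \<in> sphere 0 1" "\<And>h. h \<in> sphere 0 1 \<Longrightarrow> hess h0 h0 \<le> hess h h"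
    using continuous_attains_inf[OF compact_sphere _ cont] by blast
  show ?thesis
  proof (rule that[of "hess h0 h0"])
    have "h0 \<noteq> 0" using h0(1) by auto
    then show "0 < hess h0 h0" by (rule pos)
    fix h
    show "hess h0 h0 * (norm h)\<^sup>2 \<le> hess h h"
    proof (cases "h = 0")
      case True then show ?thesis using hess_nonneg[of h] by simp
    next
      case False
      have "hess (c *\<^sub>R x) (c *\<^sub>R x) = c\<^sup>2 * hess x x" for c x
        by (simp add: linear_scale[OF linear_hess] hess_sym[of "_ *\<^sub>R _"] power2_eq_square)
      from this[of "norm h" "h /\<^sub>R norm h"]
      have "hess h h = (norm h)\<^sup>2 * hess (h /\<^sub>R norm h) (h /\<^sub>R norm h)"
        using False by simp
      moreover have "hess h0 h0 \<le> hess (h /\<^sub>R norm h) (h /\<^sub>R norm h)"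
        using False by (intro h0(2)) simp
      ultimately show ?thesis by (metis mult.commute mult_right_mono zero_le_power2)
    qed
  qed
qed

text \<open>Positivity at the centre survives for all nearby tilts and parameters at once; the tilt
  matters because for nonlinear \<open>\<Psi>\<close> the term \<open>v \<bullet> \<Psi> b\<close>
  contributes to the Hessian. The derivative is continuous in operator norm, so nearby the quadratic
  form loses at most half of the coercivity constant.\<close>

lemma hess_pos_imp_uniform:
  assumes pos: "\<And>h. h \<noteq> 0 \<Longrightarrow> 0 < hess h h"
  obtains \<rho> c where "\<rho> > 0" "c > 0" "ball \<beta> \<rho> \<subseteq> U"
    "\<And>v b h. v \<in> ball 0 \<rho> \<Longrightarrow> b \<in> ball \<beta> \<rho> \<Longrightarrow> c * (norm h)\<^sup>2 \<le> DG (v, b) (0, h) \<bullet> h"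
proof -
  obtain c where c: "c > 0" "\<And>h. c * (norm h)\<^sup>2 \<le> hess h h"
    using hess_coercive[OF pos] by blast
  define DGb where "DGb z = Blinfun (DG z)" for z
  have app: "blinfun_apply (DGb z) = DG z" if "snd z \<in> U" for z
    using bl_DG[of "snd z" "fst z"] that by (simp add: DGb_def bounded_linear_Blinfun_apply)
  have "continuous_on (UNIV \<times> U) DGb"
    by (rule continuous_on_blinfun_componentwise)
       (rule continuous_on_eq[OF contDG], auto simp: app)
  then have "isCont DGb (0, \<beta>)"
    using \<beta>U openU by (subst (asm) continuous_on_eq_continuous_at) (auto intro: open_Times)
  then obtain d where d: "d > 0" "\<And>z. dist z (0, \<beta>) < d \<Longrightarrow> dist (DGb z) (DGb (0, \<beta>)) < c / 2"
    using c(1) unfolding continuous_at_eps_delta by (metis half_gt_zero)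
  obtain \<rho> where \<rho>: "\<rho> > 0" "ball \<beta> \<rho> \<subseteq> U" using openU \<beta>U open_contains_ball by blast
  \<comment> \<open>Tilt and parameter may each deviate by \<open>d / 2\<close>, so the pair
    deviates by less than \<open>d\<close>.\<close>
  show ?thesis
  proof (rule that[of "min \<rho> (d / 2)" "c / 2"])
    show "0 < min \<rho> (d / 2)" "0 < c / 2" "ball \<beta> (min \<rho> (d / 2)) \<subseteq> U"
      using \<rho> d(1) c(1) by auto
    fix v :: 'a and b h :: 'b assume v: "v \<in> ball 0 (min \<rho> (d / 2))" and b: "b \<in> ball \<beta> (min \<rho> (d / 2))"
    have bU: "b \<in> U" using b \<rho> by auto
    have "dist (v, b) (0, \<beta>) \<le> dist v 0 + dist b \<beta>"
      unfolding dist_Pair_Pair by (rule sqrt_sum_squares_le_sum) auto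
    also have "\<dots> < d" using v b by (simp add: dist_commute)
    finally have "norm (DGb (v, b) - DGb (0, \<beta>)) < c / 2"
      using d(2) by (simp add: dist_norm)
    then have "norm (DGb (v, b) - DGb (0, \<beta>)) * norm h \<le> c / 2 * norm h"
      by (intro mult_right_mono) auto
    then have "norm ((DGb (v, b) - DGb (0, \<beta>)) (0, h)) \<le> c / 2 * norm h"
      using norm_blinfun[of "DGb (v, b) - DGb (0, \<beta>)" "(0, h)"] by simp
    then have "\<bar>(DG (v, b) (0, h) - DG (0, \<beta>) (0, h)) \<bullet> h\<bar> \<le> c / 2 * norm h * norm h"
      by (intro order_trans[OF Cauchy_Schwarz_ineq2] mult_right_mono)
        (simp_all add: blinfun.diff_left app bU \<beta>U)
    then have "hess h h - c / 2 * (norm h)\<^sup>2 \<le> DG (v, b) (0, h) \<bullet> h"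
      by (simp add: hess_def inner_diff_left power2_eq_square mult.assoc abs_if split: if_splits)
    then show "c / 2 * (norm h)\<^sup>2 \<le> DG (v, b) (0, h) \<bullet> h"
      using c(2)[of h] by simp
  qed
qed

text \<open>Twice the mean value theorem on the segment from \<open>b0\<close> to \<open>b\<close>:
  the slope \<open>q\<close> vanishes at 0 and its derivative is the Hessian form, at least
  \<open>c * (norm (b - b0))\<^sup>2 > 0\<close>, so \<open>q\<close> is positive inside and
  \<open>p\<close> grows. Convexity of the ball keeps the segment in range.\<close>

lemma stationary_imp_strict_min:
  assumes conv: "\<And>b h. b \<in> ball \<beta> \<rho> \<Longrightarrow> c * (norm h)\<^sup>2 \<le> DG (v, b) (0, h) \<bullet> h"
    and c: "c > 0" and \<rho>: "ball \<beta> \<rho> \<subseteq> U"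
    and b0: "b0 \<in> ball \<beta> \<rho>" and b: "b \<in> ball \<beta> \<rho>" "b \<noteq> b0" and G: "G (v, b0) = 0"
  shows "f (\<Psi> b0) - v \<bullet> \<Psi> b0 < f (\<Psi> b) - v \<bullet> \<Psi> b"
proof -
  define l where "l t = b0 + t *\<^sub>R (b - b0)" for t :: real
  have l_in: "l t \<in> ball \<beta> \<rho>" if "0 \<le> t" "t \<le> 1" for t
  proof -
    have "l t = (1 - t) *\<^sub>R b0 + t *\<^sub>R b" by (simp add: l_def algebra_simps)
    then show ?thesis
      using convexD_alt[OF convex_ball b0 b(1) that] by simp
  qed
  have dl: "(l has_derivative (\<lambda>t. t *\<^sub>R (b - b0))) (at t)" for t
    unfolding l_def by (auto intro!: derivative_eq_intros)
  define p where "p t = f (\<Psi> (l t)) - v \<bullet> \<Psi> (l t)" for t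
  define q where "q t = G (v, l t) \<bullet> (b - b0)" for t
  have dp: "(p has_real_derivative q t) (at t)" if t: "0 \<le> t" "t \<le> 1" for t
  proof -
    have "l t \<in> U" using l_in t \<rho> by blast
    from has_derivative_compose[OF dl grad[OF this, of v], folded p_def]
    have "(p has_derivative (\<lambda>s. s * q t)) (at t)" by (simp add: q_def)
    then show ?thesis by (simp add: has_field_derivative_def mult_commute_abs)
  qed
  have dq: "(q has_real_derivative DG (v, l t) (0, b - b0) \<bullet> (b - b0)) (at t)"
    if t: "0 \<le> t" "t \<le> 1" for t
  proof -
    have lU: "l t \<in> U" using l_in t \<rho> by blast
    have "((\<lambda>t. (v, l t)) has_derivative (\<lambda>t. (0, t *\<^sub>R (b - b0)))) (at t)"
      by (intro has_derivative_Pair dl has_derivative_const)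
    from has_derivative_compose[OF this derG[OF lU, of v]]
    have 1: "((\<lambda>t. G (v, l t)) has_derivative (\<lambda>s. DG (v, l t) (0, s *\<^sub>R (b - b0)))) (at t)" .
    have 2: "DG (v, l t) (0, s *\<^sub>R (b - b0)) = s *\<^sub>R DG (v, l t) (0, b - b0)" for s
      using linear_scale[OF bounded_linear.linear[OF bl_DG[OF lU, of v]], of s "(0, b - b0)"] by simp
    have "(q has_derivative (\<lambda>s. DG (v, l t) (0, s *\<^sub>R (b - b0)) \<bullet> (b - b0))) (at t)"
      unfolding q_def by (intro has_derivative_inner_left 1)
    then show ?thesis by (simp add: has_field_derivative_def 2 mult_commute_abs)
  qed
  obtain \<xi> where \<xi>: "0 < \<xi>" "\<xi> < 1" "p 1 - p 0 = (1 - 0) * q \<xi>"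
    using MVT2[of 0 1 p q] dp by auto
  obtain \<eta> where \<eta>: "0 < \<eta>" "\<eta> < \<xi>"
    "q \<xi> - q 0 = (\<xi> - 0) * (DG (v, l \<eta>) (0, b - b0) \<bullet> (b - b0))"
    using MVT2[of 0 \<xi> q "\<lambda>t. DG (v, l t) (0, b - b0) \<bullet> (b - b0)"] dq \<xi> by auto
  have "0 < c * (norm (b - b0))\<^sup>2" using c b by simp
  also have "\<dots> \<le> DG (v, l \<eta>) (0, b - b0) \<bullet> (b - b0)"
    using \<eta> \<xi> by (intro conv l_in) auto
  finally have "0 < q \<xi> - q 0" using \<eta>(3) \<xi>(1) by simp
  moreover have "q 0 = 0" using G by (simp add: q_def l_def)
  ultimately have "p 0 < p 1" using \<xi>(3) by simp
  then show ?thesis by (simp add: p_def l_def)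
qed

text \<open>The implicit function theorem, from the inverse function theorem for
  \<open>F (v, b) = (v, G (v, b))\<close>. The derivative \<open>b'\<close> is described by the
  linearised equation instead of a formula with an inverse; its continuity is derived from that
  equation later.\<close>

lemma implicit_solution:
  assumes pos: "\<And>h. h \<noteq> 0 \<Longrightarrow> 0 < hess h h"
  obtains r b b' where "r > 0" "b 0 = \<beta>"
    "\<And>v. v \<in> ball 0 r \<Longrightarrow> b v \<in> U \<and> G (v, b v) = 0"
    "\<And>v. v \<in> ball 0 r \<Longrightarrow> (b has_derivative b' v) (at v)"
    "\<And>v w. v \<in> ball 0 r \<Longrightarrow> DG (v, b v) (w, b' v w) = 0"
proof -
  define F where "F z = (fst z, G z)" for z
  define DF where "DF z = Blinfun (\<lambda>w. (fst w, DG z w))" for z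
  have app: "blinfun_apply (DF z) = (\<lambda>w. (fst w, DG z w))" if "z \<in> UNIV \<times> U" for z
    unfolding DF_def using that bl_DG[of "snd z" "fst z"]
    by (intro bounded_linear_Blinfun_apply bounded_linear_Pair bounded_linear_fst) auto
  have o: "open (UNIV \<times> U)" by (intro open_Times openU open_UNIV)
  have dF: "(F has_derivative blinfun_apply (DF z)) (at z)" if "z \<in> UNIV \<times> U" for z
    unfolding F_def app[OF that] using that derG[of "snd z" "fst z"]
    by (intro has_derivative_Pair has_derivative_fst has_derivative_ident) auto
  have cont: "continuous_on (UNIV \<times> U) DF"
    by (rule continuous_on_blinfun_componentwise, rule continuous_on_eq[of _ "\<lambda>z. (fst i, DG z i)" for i])
       (auto simp: app intro!: continuous_intros contDG)
  have z0: "(0, \<beta>) \<in> UNIV \<times> U" using \<beta>U by simp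
  \<comment> \<open>Injectivity of the derivative of \<open>F\<close>: the first component gives
    \<open>w = 0\<close>, and then \<open>hess h h = 0\<close>.\<close>
  have "z = 0" if "DF (0, \<beta>) z = 0" for z
  proof -
    obtain w h where z: "z = (w, h)" by (cases z)
    have "w = 0" "DG (0, \<beta>) (0, h) = 0"
      using that unfolding app[OF z0] z by (auto simp: zero_prod_def)
    then show ?thesis using pos[of h] by (auto simp: hess_def z zero_prod_def)
  qed
  then obtain K where K: "K o\<^sub>L DF (0, \<beta>) = id_blinfun"
    by (rule linear_inj_imp_left_inverse_blinfun)
  obtain U' V g g' where U': "open U'" "U' \<subseteq> UNIV \<times> U" "(0, \<beta>) \<in> U'" and V: "open V" "F (0, \<beta>) \<in> V"
    and hom: "homeomorphism U' V F g" and dg: "\<And>y. y \<in> V \<Longrightarrow> (g has_derivative g' y) (at y)"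
    and g': "\<And>y. y \<in> V \<Longrightarrow> g' y = inv (blinfun_apply (DF (g y)))"
    and bij: "\<And>y. y \<in> V \<Longrightarrow> bij (blinfun_apply (DF (g y)))"
    using inverse_function_theorem[OF o dF cont z0 K] by (metis (no_types, lifting))
  have F0: "F (0, \<beta>) = (0, 0)" by (simp add: F_def G0)
  have Fg: "F (g y) = y" "g y \<in> UNIV \<times> U" if "y \<in> V" for y
    using hom that U'(2) unfolding homeomorphism_def by (blast, blast)
  have gF: "g (0, 0) = (0, \<beta>)"
    using hom U'(3) F0 unfolding homeomorphism_def by metis
  obtain r where r: "r > 0" "ball (0, 0) r \<subseteq> V"
    using V F0 open_contains_ball by metis
  \<comment> \<open>On the slice \<open>y = (v, 0)\<close> the inverse of \<open>F\<close> returns a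
    zero of \<open>G\<close> for the tilt \<open>v\<close>.\<close>
  have inV: "(v, 0) \<in> V" if "v \<in> ball 0 r" for v
    using that r(2) by (intro set_mp[OF r(2)]) (simp add: dist_Pair_Pair)
  have gv: "g (v, 0) = (v, snd (g (v, 0)))" "G (v, snd (g (v, 0))) = 0" if "v \<in> ball 0 r" for v
    using Fg(1)[OF inV[OF that]] unfolding F_def by (metis prod.collapse fst_conv snd_conv)+
  show ?thesis
  proof (rule that[of r "\<lambda>v. snd (g (v, 0))" "\<lambda>v w. snd (g' (v, 0) (w, 0))"])
    show "r > 0" "snd (g (0, 0)) = \<beta>" using r gF by auto
    fix v :: 'a assume v: "v \<in> ball 0 r"
    show "snd (g (v, 0)) \<in> U \<and> G (v, snd (g (v, 0))) = 0"
      using Fg(2)[OF inV[OF v]] gv[OF v] by auto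
    have "((\<lambda>v. (v, 0)) has_derivative (\<lambda>w. (w, 0))) (at v)"
      by (intro has_derivative_Pair has_derivative_ident has_derivative_const)
    from has_derivative_compose[OF this dg[OF inV[OF v]]]
    show "((\<lambda>v. snd (g (v, 0))) has_derivative (\<lambda>w. snd (g' (v, 0) (w, 0)))) (at v)"
      by (rule has_derivative_snd)
    fix w
    have "DF (g (v, 0)) (g' (v, 0) (w, 0)) = (w, 0)"
      using bij[OF inV[OF v]] g'[OF inV[OF v]] by (simp add: bij_is_surj surj_f_inv_f)
    then have "fst (g' (v, 0) (w, 0)) = w" "DG (g (v, 0)) (g' (v, 0) (w, 0)) = 0"
      using Fg(2)[OF inV[OF v]] by (simp_all add: app)
    then show "DG (v, snd (g (v, 0))) (w, snd (g' (v, 0) (w, 0))) = 0"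
      using gv(1)[OF v] by (metis prod.collapse)
  qed
qed

text \<open>For small tilts the zero \<open>b v\<close> of \<open>G\<close> lies in the ball of
  uniform convexity. \<open>\<epsilon>\<close> is chosen so that every competitor in the ball around
  \<open>\<theta>0\<close> has its parameter in that same ball, so \<open>\<Psi> (b v)\<close> beats
  all others strictly.\<close>

lemma pos_imp_tilt_stable:
  assumes pos: "\<And>h. h \<noteq> 0 \<Longrightarrow> 0 < hess h h"
  shows "tilt_stable E M f \<theta>0"
proof -
  obtain \<rho> c where \<rho>: "\<rho> > 0" "ball \<beta> \<rho> \<subseteq> U" and c: "c > 0"
    and conv: "\<And>v b h. v \<in> ball 0 \<rho> \<Longrightarrow> b \<in> ball \<beta> \<rho> \<Longrightarrow> c * (norm h)\<^sup>2 \<le> DG (v, b) (0, h) \<bullet> h"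
    using hess_pos_imp_uniform[OF pos] by metis
  obtain r b b' where r: "r > 0" and b0: "b 0 = \<beta>"
    and b: "\<And>v. v \<in> ball 0 r \<Longrightarrow> b v \<in> U \<and> G (v, b v) = 0"
    and db: "\<And>v. v \<in> ball 0 r \<Longrightarrow> (b has_derivative b' v) (at v)"
    and DGb: "\<And>v w. v \<in> ball 0 r \<Longrightarrow> DG (v, b v) (w, b' v w) = 0"
    using implicit_solution[OF pos] by metis
  obtain \<epsilon> where \<epsilon>: "\<epsilon> > 0"
    "\<And>\<theta>. \<theta> \<in> M \<inter> ball \<theta>0 \<epsilon> \<Longrightarrow> \<Psi> (chart \<theta>) = \<theta> \<and> chart \<theta> \<in> ball \<beta> \<rho>"
    using local_param[OF \<rho>(1)] by blast
  have b_lim: "(b \<longlongrightarrow> \<beta>) (at 0)"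
    using has_derivative_continuous[OF db[of 0]] r unfolding isCont_def b0 by simp
  have "\<forall>\<^sub>F v in at 0. b v \<in> ball \<beta> \<rho>"
    using b_lim \<rho> by (intro topological_tendstoD) auto
  moreover have "\<forall>\<^sub>F v in at 0. \<Psi> (b v) \<in> ball \<theta>0 \<epsilon>"
    using isCont_tendsto_compose[OF \<Psi>_cont[OF \<beta>U] b_lim] \<epsilon>(1)
    by (intro topological_tendstoD) (auto simp: \<Psi>\<beta>)
  ultimately have "\<forall>\<^sub>F v in at 0. b v \<in> ball \<beta> \<rho> \<and> \<Psi> (b v) \<in> ball \<theta>0 \<epsilon>"
    by (rule eventually_conj)
  then obtain s where s: "s > 0"
    "\<And>v. v \<noteq> 0 \<Longrightarrow> dist v 0 < s \<Longrightarrow> b v \<in> ball \<beta> \<rho> \<and> \<Psi> (b v) \<in> ball \<theta>0 \<epsilon>"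
    unfolding eventually_at by auto
  \<comment> \<open>\<open>t \<le> \<rho>\<close> keeps the tilt itself in the range of uniform
    convexity.\<close>
  define t where "t = min (min r s) \<rho>"
  have t: "t > 0" using r s \<rho> by (simp add: t_def)
  have near: "v \<in> ball 0 r" "v \<in> ball 0 \<rho>" "b v \<in> ball \<beta> \<rho>" "\<Psi> (b v) \<in> ball \<theta>0 \<epsilon>" if "v \<in> ball 0 t" for v
    using that s(2)[of v] \<rho>(1) \<epsilon>(1) by (cases "v = 0"; auto simp: t_def b0 \<Psi>\<beta>)+
  have bU: "b v \<in> U" "G (v, b v) = 0" if "v \<in> ball 0 t" for v
    using b near(1)[OF that] by auto
  define \<sigma> where "\<sigma> v = \<Psi> (b v)" for v
  define \<sigma>' where "\<sigma>' v = Blinfun (\<lambda>w. \<Psi>' (b v) (b' v w))" for v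
  have cb: "continuous_on (ball 0 t) b"
    using db near(1) by (meson has_derivative_continuous continuous_at_imp_continuous_on)
  have d\<sigma>: "(\<sigma> has_derivative (\<lambda>w. \<Psi>' (b v) (b' v w))) (at v)" if "v \<in> ball 0 t" for v
    unfolding \<sigma>_def by (rule has_derivative_compose[OF db[OF near(1)[OF that]] der\<Psi>[OF bU(1)[OF that]]])
  have app: "blinfun_apply (\<sigma>' v) = (\<lambda>w. \<Psi>' (b v) (b' v w))" if "v \<in> ball 0 t" for v
    unfolding \<sigma>'_def by (intro bounded_linear_Blinfun_apply has_derivative_bounded_linear[OF d\<sigma>[OF that]])
  \<comment> \<open>Continuity of \<open>b'\<close> without a formula: inserting the old direction
    \<open>b' v0 w\<close> into the linearised equation at \<open>v\<close> leaves a residual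
    \<open>R v\<close> that is continuous and vanishes at \<open>v0\<close>, and coercivity bounds
    the change of \<open>b'\<close> by \<open>norm (R v) / c\<close>.\<close>
  have cb': "continuous_on (ball 0 t) (\<lambda>v. b' v w)" for w
    unfolding continuous_on_def
  proof
    fix v0 :: 'a assume v0: "v0 \<in> ball 0 t"
    define R where "R v = DG (v, b v) (w, b' v0 w)" for v
    have "continuous_on (ball 0 t) R"
      unfolding R_def
      by (rule continuous_on_compose2[OF contDG]) (auto intro!: continuous_intros cb bU(1))
    then have R: "(R \<longlongrightarrow> 0) (at v0 within ball 0 t)"
      using v0 DGb[OF near(1)[OF v0], of w] unfolding continuous_on_def R_def by force
    have "dist (b' v w) (b' v0 w) \<le> norm (R v) / c" if v: "v \<in> ball 0 t" for v
    proof -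
      let ?\<Delta> = "b' v w - b' v0 w"
      have "linear (DG (v, b v))" using bl_DG[OF bU(1)[OF v]] by (rule bounded_linear.linear)
      from linear_diff[OF this, of "(w, b' v w)" "(w, b' v0 w)"]
      have "DG (v, b v) (0, ?\<Delta>) = - R v" using DGb[OF near(1)[OF v], of w] by (simp add: R_def)
      then have "c * (norm ?\<Delta>)\<^sup>2 \<le> - R v \<bullet> ?\<Delta>"
        using conv[OF near(2,3)[OF v], of ?\<Delta>] by simp
      also have "\<dots> \<le> norm (R v) * norm ?\<Delta>"
        using Cauchy_Schwarz_ineq2[of "- R v" ?\<Delta>] by simp
      finally have "c * norm ?\<Delta> \<le> norm (R v)"
        by (cases "?\<Delta> = 0") (auto simp: power2_eq_square mult.assoc[symmetric])
      then show ?thesis using c by (simp add: dist_norm field_simps)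
    qed
    then have "\<forall>\<^sub>F v in at v0 within ball 0 t. dist (b' v w) (b' v0 w) \<le> norm (R v) / c"
      by (auto simp: eventually_at_filter)
    moreover have "((\<lambda>v. norm (R v) / c) \<longlongrightarrow> 0) (at v0 within ball 0 t)"
      using tendsto_divide[OF tendsto_norm_zero[OF R] tendsto_const[of c]] c by simp
    ultimately have "((\<lambda>v. dist (b' v w) (b' v0 w)) \<longlongrightarrow> 0) (at v0 within ball 0 t)"
      by (intro Lim_null_comparison[where f = "\<lambda>v. dist (b' v w) (b' v0 w)"]) auto
    then show "((\<lambda>v. b' v w) \<longlongrightarrow> b' v0 w) (at v0 within ball 0 t)"
      by (subst tendsto_dist_iff)
  qed
  have c\<sigma>': "continuous_on (ball 0 t) \<sigma>'"
  proof (rule continuous_on_blinfun_componentwise)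
    fix i :: 'a
    \<comment> \<open>As a bounded linear map \<open>\<Psi>'\<close> is continuous in operator norm,
      so it may be applied to a direction that itself varies with \<open>v\<close>.\<close>
    define \<Psi>b where "\<Psi>b x = Blinfun (\<Psi>' x)" for x
    have \<Psi>b: "blinfun_apply (\<Psi>b x) = \<Psi>' x" if "x \<in> U" for x
      unfolding \<Psi>b_def using bl_\<Psi>'[OF that] by (rule bounded_linear_Blinfun_apply)
    have "continuous_on U \<Psi>b"
      by (rule continuous_on_blinfun_componentwise, rule continuous_on_eq[OF cont\<Psi>']) (auto simp: \<Psi>b)
    then have "continuous_on (ball 0 t) (\<lambda>v. \<Psi>b (b v))"
      by (rule continuous_on_compose2[OF _ cb]) (use bU in auto)
    then have "continuous_on (ball 0 t) (\<lambda>v. blinfun_apply (\<Psi>b (b v)) (b' v i))"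
      by (intro blinfun.continuous_on cb')
    then show "continuous_on (ball 0 t) (\<lambda>v. blinfun_apply (\<sigma>' v) i)"
      by (rule continuous_on_eq) (simp add: app \<Psi>b bU)
  qed
  have argmin: "tilt_argmin M f \<theta>0 \<epsilon> v = {\<sigma> v}" if v: "v \<in> ball 0 t" for v
  proof -
    have \<sigma>v: "\<sigma> v \<in> M \<inter> ball \<theta>0 \<epsilon>"
      using near(4)[OF v] bU(1)[OF v] \<Psi>U by (auto simp: \<sigma>_def)
    have less: "f (\<sigma> v) - v \<bullet> \<sigma> v < f \<theta> - v \<bullet> \<theta>" if \<theta>: "\<theta> \<in> M \<inter> ball \<theta>0 \<epsilon>" "\<theta> \<noteq> \<sigma> v" for \<theta>
    proof -
      have 1: "\<Psi> (chart \<theta>) = \<theta>" "chart \<theta> \<in> ball \<beta> \<rho>" using \<epsilon>(2)[OF \<theta>(1)] by auto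
      then have "chart \<theta> \<noteq> b v" using \<theta>(2) by (auto simp: \<sigma>_def)
      from stationary_imp_strict_min[OF conv[OF near(2)[OF v]] c \<rho>(2) near(3)[OF v] 1(2) this bU(2)[OF v]]
      show ?thesis by (simp add: 1 \<sigma>_def)
    qed
    show ?thesis
    proof (intro set_eqI iffI)
      fix \<theta> assume "\<theta> \<in> tilt_argmin M f \<theta>0 \<epsilon> v"
      then show "\<theta> \<in> {\<sigma> v}"
        using less[of \<theta>] \<sigma>v unfolding tilt_argmin_def is_arg_min_def by auto
    next
      fix \<theta> assume "\<theta> \<in> {\<sigma> v}"
      then show "\<theta> \<in> tilt_argmin M f \<theta>0 \<epsilon> v"
        using less \<sigma>v unfolding tilt_argmin_def is_arg_min_def by (auto, smt (verit))
    qed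
  qed
  have "tilt_solution E M f \<theta>0 \<epsilon> \<sigma> \<sigma>'"
    unfolding tilt_solution_def
  proof (intro conjI exI[of _ t] ballI)
    show "\<epsilon> > 0" "\<sigma> 0 = \<theta>0" "t > 0" using \<epsilon> t by (auto simp: \<sigma>_def b0 \<Psi>\<beta>)
    show "continuous_on (E \<inter> ball 0 t) \<sigma>'" using c\<sigma>' by (rule continuous_on_subset) auto
    fix v assume "v \<in> E \<inter> ball 0 t"
    then have v: "v \<in> ball 0 t" by auto
    show "tilt_argmin M f \<theta>0 \<epsilon> v = {\<sigma> v}" by (rule argmin[OF v])
    show "(\<sigma> has_derivative blinfun_apply (\<sigma>' v)) (at v within E)"
      unfolding app[OF v] by (rule has_derivative_at_withinI[OF d\<sigma>[OF v]])
  qed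
  moreover have "is_arg_min f (\<lambda>\<theta>. \<theta> \<in> M) \<theta>0"
    using minimal \<Psi>U \<Psi>\<beta> \<beta>U unfolding is_arg_min_def by (auto simp: not_less)
  ultimately show ?thesis unfolding tilt_stable_def by blast
qed

section \<open>The criterion for tilt-stability and the value of REG\<close>

theorem tilt_stable_iff_pos: "tilt_stable E M f \<theta>0 \<longleftrightarrow> (\<forall>h. h \<noteq> 0 \<longrightarrow> 0 < hess h h)"
  using tilt_stable_imp_pos pos_imp_tilt_stable by blast

text \<open>The equation \<open>hess (h v) k = v \<bullet> \<Psi>' \<beta> k\<close> mentions
  neither the radius nor the solution map, and for a positive definite form it has at most one
  solution. This makes the \<open>THE\<close> in \<open>REG\<close> meaningful.\<close>

lemma onorm_on_unique:
  assumes s: "tilt_solution E M f \<theta>0 \<epsilon> \<sigma> \<sigma>'" and t: "tilt_solution E M f \<theta>0 \<delta> \<tau> \<tau>'"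
    and pos: "\<And>h. h \<noteq> 0 \<Longrightarrow> 0 < hess h h"
  shows "onorm_on E (\<sigma>' 0) = onorm_on E (\<tau>' 0)"
proof -
  obtain h where h: "\<And>v. v \<in> E \<Longrightarrow> \<sigma>' 0 v = \<Psi>' \<beta> (h v)"
    "\<And>v k. v \<in> E \<Longrightarrow> hess (h v) k = v \<bullet> \<Psi>' \<beta> k"
    by (rule solution_derivative[OF s]) blast
  obtain g where g: "\<And>v. v \<in> E \<Longrightarrow> \<tau>' 0 v = \<Psi>' \<beta> (g v)"
    "\<And>v k. v \<in> E \<Longrightarrow> hess (g v) k = v \<bullet> \<Psi>' \<beta> k"
    by (rule solution_derivative[OF t]) blast
  have "h v = g v" if v: "v \<in> E" for v
  proof -
    let ?d = "h v - g v"
    have "hess ?d ?d = hess ?d (h v) - hess ?d (g v)"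
      by (simp add: linear_diff[OF linear_hess])
    also have "\<dots> = 0"
      by (simp add: hess_sym[of ?d] linear_diff[OF linear_hess])
        (metis h(2)[OF v] g(2)[OF v] hess_sym cancel_comm_monoid_add_class.diff_cancel)
    finally show ?thesis using pos[of ?d] by fastforce
  qed
  then have "blinfun_apply (\<sigma>' 0) v = blinfun_apply (\<tau>' 0) v" if "v \<in> E" for v
    using that h(1) g(1) by simp
  then show ?thesis unfolding onorm_on_def by (intro SUP_cong) auto
qed

text \<open>REG is the largest value of the squared norm of \<open>\<Psi>' \<beta> h\<close> divided
  by \<open>hess h h\<close>: an upper bound must hold in all directions, a lower bound needs a
  single witness \<open>u\<close>.\<close>

theorem REG_bounds:
  assumes pos: "\<And>h. h \<noteq> 0 \<Longrightarrow> 0 < hess h h"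
    and ub: "\<And>h. (norm (\<Psi>' \<beta> h))\<^sup>2 \<le> \<kappa> * hess h h"
    and lb: "u \<noteq> 0" "\<kappa>' * hess u u \<le> (norm (\<Psi>' \<beta> u))\<^sup>2"
  obtains g where "REG E M f \<theta>0 = ereal g" "\<kappa>' \<le> g" "g \<le> \<kappa>"
proof -
  have stable: "tilt_stable E M f \<theta>0" using pos tilt_stable_iff_pos by blast
  then obtain \<epsilon> \<sigma> \<sigma>' where sol: "tilt_solution E M f \<theta>0 \<epsilon> \<sigma> \<sigma>'"
    unfolding tilt_stable_def by blast
  define g where "g = onorm_on E (\<sigma>' 0)"
  have "(THE r. \<exists>\<epsilon> \<sigma> \<sigma>'. tilt_solution E M f \<theta>0 \<epsilon> \<sigma> \<sigma>' \<and> r = onorm_on E (\<sigma>' 0)) = g"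
  proof (rule the_equality)
    show "\<exists>\<epsilon> \<sigma> \<sigma>'. tilt_solution E M f \<theta>0 \<epsilon> \<sigma> \<sigma>' \<and> g = onorm_on E (\<sigma>' 0)"
      using sol g_def by blast
  next
    fix r assume "\<exists>\<epsilon> \<sigma> \<sigma>'. tilt_solution E M f \<theta>0 \<epsilon> \<sigma> \<sigma>' \<and> r = onorm_on E (\<sigma>' 0)"
    then show "r = g" using onorm_on_unique[OF sol _ pos] unfolding g_def by metis
  qed
  then have REG: "REG E M f \<theta>0 = ereal g" using stable by (simp add: REG_def)
  obtain h where h: "\<And>v. v \<in> E \<Longrightarrow> \<sigma>' 0 v = \<Psi>' \<beta> (h v)"
    "\<And>v k. v \<in> E \<Longrightarrow> hess (h v) k = v \<bullet> \<Psi>' \<beta> k"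
    by (rule solution_derivative[OF sol]) blast
  \<comment> \<open>The equation at \<open>k = h v\<close>, with \<open>norm v \<le> 1\<close>.
    Inserted into \<open>ub\<close> it turns a bound on the square of
    \<open>norm (\<Psi>' \<beta> (h v))\<close> into one on the norm.\<close>
  have hh: "hess (h v) (h v) \<le> norm (\<Psi>' \<beta> (h v))" if v: "v \<in> E \<inter> cball 0 1" for v
  proof -
    have "hess (h v) (h v) = v \<bullet> \<Psi>' \<beta> (h v)" using h(2) v by blast
    also have "\<dots> \<le> norm v * norm (\<Psi>' \<beta> (h v))" by (rule norm_cauchy_schwarz)
    also have "\<dots> \<le> 1 * norm (\<Psi>' \<beta> (h v))" using v by (intro mult_right_mono) auto
    finally show ?thesis by simp
  qed
  have \<kappa>: "0 < \<kappa>"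
    using ub[of u] pos[OF lb(1)] inj\<Psi>'[of u] lb(1)
    by (smt (verit) mult_nonpos_nonneg norm_eq_zero zero_less_power2)
  have le: "norm (\<sigma>' 0 v) \<le> \<kappa>" if v: "v \<in> E \<inter> cball 0 1" for v
  proof -
    have "(norm (\<Psi>' \<beta> (h v)))\<^sup>2 \<le> \<kappa> * norm (\<Psi>' \<beta> (h v))"
      using ub[of "h v"] hh[OF v] \<kappa> by (meson mult_left_mono less_imp_le order_trans)
    then have "norm (\<Psi>' \<beta> (h v)) \<le> \<kappa>"
      using \<kappa> by (cases "norm (\<Psi>' \<beta> (h v)) = 0") (auto simp: power2_eq_square)
    then show ?thesis using h(1) v by simp
  qed
  have "g \<le> \<kappa>" unfolding g_def onorm_on_def
    using le subspace_0[OF subspE] by (intro cSUP_least) auto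
  moreover have "\<kappa>' \<le> g"
  proof -
    define n where "n = norm (\<Psi>' \<beta> u)"
    have n: "n > 0" using inj\<Psi>'[of u] lb(1) by (auto simp: n_def)
    \<comment> \<open>The unit tilt in direction \<open>\<Psi>' \<beta> u\<close>: now
      \<open>hess (h v) u = n\<close>, and Cauchy-Schwarz compares its square with
      \<open>hess (h v) (h v) * hess u u\<close>, hence with
      \<open>norm (\<sigma>' 0 v) * hess u u\<close>.\<close>
    define v where "v = \<Psi>' \<beta> u /\<^sub>R n"
    have v: "v \<in> E \<inter> cball 0 1"
      using \<Psi>'E[of u] subspE n by (simp add: v_def subspace_scale n_def)
    have "n\<^sup>2 = (hess (h v) u)\<^sup>2"
      using h(2)[of v u] v n
      by (simp add: v_def power2_norm_eq_inner[symmetric] n_def[symmetric])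
        (simp add: power2_eq_square field_simps)
    also have "\<dots> \<le> hess (h v) (h v) * hess u u" by (rule hess_cauchy_schwarz)
    also have "\<dots> \<le> norm (\<sigma>' 0 v) * hess u u"
      using hh[OF v] h(1)[of v] v pos[OF lb(1)] by (simp add: mult_right_mono)
    finally have "\<kappa>' * hess u u \<le> norm (\<sigma>' 0 v) * hess u u"
      using lb(2) by (simp add: n_def)
    then have "\<kappa>' \<le> norm (\<sigma>' 0 v)" using pos[OF lb(1)] by simp
    also have "\<dots> \<le> g" unfolding g_def onorm_on_def
      by (intro cSUP_upper bdd_aboveI2[of _ _ \<kappa>] v le)
    finally show ?thesis .
  qed
  ultimately show ?thesis using REG that by blast
qed

end

section \<open>Gaussian moments\<close>

definition reflection :: "'a::real_inner \<Rightarrow> 'a \<Rightarrow> 'a" where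
  "reflection w x = x - (2 * (x \<bullet> w) / (w \<bullet> w)) *\<^sub>R w"

lemma orthogonal_transformation_reflection: "orthogonal_transformation (reflection w)"
  unfolding orthogonal_transformation_def
proof (intro conjI allI linearI)
  fix x y c
  show "reflection w (x + y) = reflection w x + reflection w y"
    by (simp add: reflection_def inner_add_left algebra_simps add_divide_distrib)
  show "reflection w (c *\<^sub>R x) = c *\<^sub>R reflection w x"
    by (simp add: reflection_def algebra_simps)
  show "reflection w x \<bullet> reflection w y = x \<bullet> y"
    by (cases "w = 0") (simp_all add: reflection_def inner_diff_left inner_diff_right inner_commute)
qed

text \<open>For equal norms the correction term is exactly \<open>a - b\<close>. For
  \<open>a = b\<close> the reflection is the identity, so no case is lost.\<close>

lemma reflection_swap:
  assumes "norm a = norm b"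
  shows "reflection (a - b) a = b"
proof (cases "a = b")
  case False
  have "a \<bullet> a = b \<bullet> b" using assms by (simp add: norm_eq)
  then have "(a - b) \<bullet> (a - b) = 2 * (a \<bullet> (a - b))"
    by (simp add: inner_diff_left inner_diff_right inner_commute)
  moreover have "(a - b) \<bullet> (a - b) \<noteq> 0" using False by simp
  ultimately show ?thesis by (simp add: reflection_def)
qed (simp add: reflection_def)

lemma reflection_fixes: "x \<bullet> w = 0 \<Longrightarrow> reflection w x = x"
  by (simp add: reflection_def)

text \<open>The first reflection takes \<open>p\<close> to \<open>e1\<close> and \<open>q\<close> to
  a vector orthogonal to \<open>e1\<close>. Since \<open>e2\<close> is orthogonal to
  \<open>e1\<close> too, the second reflection, along \<open>T1 q - e2\<close>, leaves
  \<open>e1\<close> alone.\<close>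

lemma orthogonal_transformation_pair:
  fixes p q e1 e2 :: "'a::real_inner"
  assumes n: "norm p = norm e1" "norm q = norm e2" and o: "p \<bullet> q = 0" "e1 \<bullet> e2 = 0"
  obtains T where "orthogonal_transformation T" "T p = e1" "T q = e2"
proof -
  define T1 where "T1 = reflection (p - e1)"
  define T2 where "T2 = reflection (T1 q - e2)"
  have T1: "orthogonal_transformation T1" "T1 p = e1"
    unfolding T1_def using orthogonal_transformation_reflection reflection_swap[OF n(1)] by auto
  have T2: "orthogonal_transformation T2"
    unfolding T2_def by (rule orthogonal_transformation_reflection)
  have "e1 \<bullet> T1 q = 0"
    using T1 o unfolding orthogonal_transformation_def by metis
  then have "T2 e1 = e1"
    unfolding T2_def using o by (intro reflection_fixes) (simp add: inner_diff_right)
  moreover have "T2 (T1 q) = e2"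
    unfolding T2_def using n T1 by (intro reflection_swap) (simp add: orthogonal_transformation_norm)
  ultimately show ?thesis
    using that[of "T2 \<circ> T1"] orthogonal_transformation_compose[OF T2 T1(1)] T1 by simp
qed

lemma borel_measurable_orthogonal_transformation:
  fixes T :: "'a::euclidean_space \<Rightarrow> 'a"
  assumes "orthogonal_transformation T"
  shows "T \<in> borel_measurable borel"
  using assms by (intro borel_measurable_continuous_onI linear_continuous_on)
    (simp add: orthogonal_transformation_linear linear_linear)

text \<open>The library's change of variables needs a well-ordered index type. Instead, uniqueness of
  the Haar measure is proved by Fubini: both measures are translation and reflection invariant and
  agree on the unit ball.\<close>

lemma distr_lborel_orthogonal_transformation:
  fixes T :: "'a::euclidean_space \<Rightarrow> 'a"
  assumes T: "orthogonal_transformation T"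
  shows "distr lborel borel T = lborel"
proof (rule measure_eqI)
  define M where "M = distr lborel borel T"
  have lin: "linear T" using T by (rule orthogonal_transformation_linear)
  have Tm [measurable]: "T \<in> borel_measurable borel"
    using T by (rule borel_measurable_orthogonal_transformation)
  have sets_M [measurable_cong, simp]: "sets M = sets borel" by (simp add: M_def)
  have M_ball: "emeasure M (ball 0 r) = emeasure lborel (ball (0::'a) r)" for r
  proof -
    have "T -` ball 0 r = ball 0 r" using orthogonal_transformation_norm[OF T] by auto
    then show ?thesis by (simp add: M_def emeasure_distr)
  qed
  interpret M: sigma_finite_measure M
  proof
    show "\<exists>A. countable A \<and> A \<subseteq> sets M \<and> \<Union> A = space M \<and> (\<forall>a\<in>A. emeasure M a \<noteq> \<infinity>)"
    proof (intro exI[of _ "range (\<lambda>n::nat. ball 0 (real n))"] conjI ballI)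
      show "(\<Union>n::nat. ball (0::'a) (real n)) = space M"
        using reals_Archimedean2 by (auto simp: M_def)
      fix a assume "a \<in> range (\<lambda>n::nat. ball (0::'a) (real n))"
      then obtain n :: nat where "a = ball 0 (real n)" by blast
      then show "emeasure M a \<noteq> \<infinity>"
        using emeasure_bounded_finite[OF bounded_ball[of "0::'a" "real n"]] by (simp add: M_ball)
    qed auto
  qed
  interpret P: pair_sigma_finite lborel M ..
  \<comment> \<open>A translation by \<open>c\<close> after \<open>T\<close> is a translation by the
    preimage of \<open>c\<close> before \<open>T\<close>.\<close>
  have trans: "(\<integral>\<^sup>+y. f (c + y) \<partial>M) = (\<integral>\<^sup>+y. f y \<partial>M)"
    if [measurable]: "f \<in> borel_measurable borel" for f c
  proof -
    have "T (inv T c + x) = c + T x" for x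
      using orthogonal_transformation_surj[OF T] by (simp add: linear_add[OF lin] surj_f_inv_f)
    then have "(\<integral>\<^sup>+y. f (c + y) \<partial>M) = (\<integral>\<^sup>+x. f (T (inv T c + x)) \<partial>lborel)"
      by (simp add: M_def nn_integral_distr)
    also have "\<dots> = (\<integral>\<^sup>+x. f (T x) \<partial>distr lborel borel ((+) (inv T c)))"
      by (subst nn_integral_distr) auto
    also have "\<dots> = (\<integral>\<^sup>+y. f y \<partial>M)"
      by (simp add: lborel_distr_plus M_def nn_integral_distr)
    finally show ?thesis .
  qed
  have refl: "(\<integral>\<^sup>+y. f (- y) \<partial>M) = (\<integral>\<^sup>+y. f y \<partial>M)"
    if [measurable]: "f \<in> borel_measurable borel" for f
  proof -
    have "(\<integral>\<^sup>+y. f (- y) \<partial>M) = (\<integral>\<^sup>+x. f (T (- x)) \<partial>lborel)"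
      by (simp add: M_def nn_integral_distr linear_neg[OF lin])
    also have "\<dots> = (\<integral>\<^sup>+x. f (T x) \<partial>distr lborel borel uminus)"
      by (subst nn_integral_distr) auto
    also have "\<dots> = (\<integral>\<^sup>+y. f y \<partial>M)"
      using lborel_affine[of "-1" "0::'a"] by (simp add: density_1 M_def nn_integral_distr)
    finally show ?thesis .
  qed
  fix A :: "'a set" assume "A \<in> sets (distr lborel borel T)"
  then have A [measurable]: "A \<in> sets borel" by simp
  define B :: "'a set" where "B = ball 0 1"
  have [measurable]: "B \<in> sets borel" by (simp add: B_def)
  \<comment> \<open>The double integral of \<open>indicator A x * indicator B y\<close>: shift
    \<open>y\<close> by \<open>x\<close> under \<open>M\<close>, exchange, shift \<open>x\<close> by
    \<open>- y\<close> under Lebesgue measure and exchange back. This interchanges the roles of the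
    two measures.\<close>
  have "emeasure lborel A * emeasure M B
      = (\<integral>\<^sup>+x. (\<integral>\<^sup>+y. indicator A x * indicator B y \<partial>M) \<partial>lborel)"
    by (simp add: nn_integral_cmult nn_integral_multc)
  also have "\<dots> = (\<integral>\<^sup>+x. (\<integral>\<^sup>+y. indicator A x * indicator B (x + y) \<partial>M) \<partial>lborel)"
    by (intro nn_integral_cong trans[symmetric]) auto
  also have "\<dots> = (\<integral>\<^sup>+y. (\<integral>\<^sup>+x. indicator A x * indicator B (x + y) \<partial>lborel) \<partial>M)"
    by (rule P.Fubini'[symmetric]) measurable
  also have "\<dots> = (\<integral>\<^sup>+y. (\<integral>\<^sup>+x. indicator A (x - y) * indicator B x \<partial>lborel) \<partial>M)"
  proof (rule nn_integral_cong)
    fix y :: 'a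
    have "(\<integral>\<^sup>+x. indicator A x * indicator B (x + y) \<partial>lborel)
        = (\<integral>\<^sup>+x. indicator A x * indicator B (x + y) \<partial>distr lborel borel ((+) (- y)) :: ennreal)"
      by (simp add: lborel_distr_plus)
    also have "\<dots> = (\<integral>\<^sup>+x. indicator A (x - y) * indicator B x \<partial>lborel)"
      by (subst nn_integral_distr) auto
    finally show "(\<integral>\<^sup>+x. indicator A x * indicator B (x + y) \<partial>lborel)
        = (\<integral>\<^sup>+x. indicator A (x - y) * indicator B x \<partial>lborel :: ennreal)" .
  qed
  also have "\<dots> = (\<integral>\<^sup>+x. (\<integral>\<^sup>+y. indicator A (x - y) * indicator B x \<partial>M) \<partial>lborel)"
    by (rule P.Fubini') measurable
  also have "\<dots> = (\<integral>\<^sup>+x. emeasure M A * indicator B x \<partial>lborel)"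
  proof (intro nn_integral_cong)
    fix x :: 'a
    have "(\<integral>\<^sup>+y. indicator A (x - y) \<partial>M) = (\<integral>\<^sup>+y. indicator A (x + y) \<partial>M :: ennreal)"
      using refl[of "\<lambda>y. indicator A (x + y)"] by simp
    also have "\<dots> = emeasure M A" by (subst trans) auto
    finally show "(\<integral>\<^sup>+y. indicator A (x - y) * indicator B x \<partial>M) = emeasure M A * indicator B x"
      by (subst nn_integral_multc) auto
  qed
  also have "\<dots> = emeasure M A * emeasure lborel B" by (simp add: nn_integral_cmult_indicator)
  finally have "emeasure lborel A * emeasure lborel B = emeasure M A * emeasure lborel B"
    by (simp add: B_def M_ball)
  \<comment> \<open>As \<open>M\<close> and Lebesgue measure agree on the ball, only its positive
    finite volume has to be cancelled.\<close>
  moreover have "emeasure lborel B \<noteq> 0" "emeasure lborel B \<noteq> \<infinity>"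
    using emeasure_bounded_finite[OF bounded_ball[of "0::'a" 1]]
      open_not_negligible[of "ball (0::'a) 1"]
    by (auto simp: B_def negligible_iff_emeasure0)
  ultimately show "emeasure (distr lborel borel T) A = emeasure lborel A"
    unfolding M_def[symmetric]
    by (simp add: mult.commute[of _ "emeasure lborel B"] ennreal_mult_cancel_left)
qed simp

section \<open>The standard Gaussian: radial density and product structure\<close>

definition gauss_density :: "real^'d \<Rightarrow> real" where
  "gauss_density x = (\<Prod>i\<in>UNIV. std_normal_density (x $ i))"

lemma gauss_density_Basis: "gauss_density x = (\<Prod>b\<in>Basis. std_normal_density (x \<bullet> b))"
proof -
  have "(\<Prod>b\<in>Basis. std_normal_density (x \<bullet> b))
      = (\<Prod>b\<in>range (\<lambda>i. axis i 1). std_normal_density (x \<bullet> b))"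
    by (rule prod.cong) (auto simp: Basis_vec_def)
  also have "\<dots> = gauss_density x"
    unfolding gauss_density_def
    by (subst prod.reindex) (auto simp: inj_on_def axis_eq_axis inner_axis)
  finally show ?thesis by simp
qed

lemma gauss_density_norm:
  "gauss_density (x :: real^'d) = (1 / sqrt (2 * pi)) ^ CARD('d) * exp (- (norm x)\<^sup>2 / 2)"
proof -
  have "(norm x)\<^sup>2 = (\<Sum>i\<in>UNIV. (x $ i)\<^sup>2)"
    unfolding power2_norm_eq_inner inner_vec_def by (simp add: power2_eq_square)
  then show ?thesis
    unfolding gauss_density_def std_normal_density_def prod.distrib
    by (simp add: exp_sum[symmetric] sum_negf sum_divide_distrib[symmetric])
qed

lemma gauss_density_nonneg [simp]: "0 \<le> gauss_density x"
  unfolding gauss_density_def by (intro prod_nonneg) auto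

lemma gauss_density_measurable [measurable]: "gauss_density \<in> borel_measurable borel"
  unfolding gauss_density_norm[abs_def] by measurable

lemma std_gaussian_eq: "std_gaussian = density lborel (\<lambda>x. ennreal (gauss_density x))"
  by (simp add: std_gaussian_def gauss_density_def)

lemma sets_std_gaussian [simp, measurable_cong]: "sets std_gaussian = sets borel"
  by (simp add: std_gaussian_def)

lemma space_std_gaussian [simp]: "space std_gaussian = UNIV"
  by (simp add: std_gaussian_def)

text \<open>The density depends on \<open>norm x\<close> only, and Lebesgue measure is
  invariant.\<close>

lemma distr_std_gaussian_orthogonal_transformation:
  fixes T :: "real^'d \<Rightarrow> real^'d"
  assumes T: "orthogonal_transformation T"
  shows "distr std_gaussian borel T = std_gaussian"
proof -
  have [measurable]: "T \<in> borel_measurable borel"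
    using T by (rule borel_measurable_orthogonal_transformation)
  have "gauss_density (T x) = gauss_density x" for x
    by (simp add: gauss_density_norm orthogonal_transformation_norm[OF T])
  then have "distr std_gaussian borel T
      = distr (density lborel (\<lambda>x. ennreal (gauss_density (T x)))) borel T"
    by (simp add: std_gaussian_eq)
  also have "\<dots> = density (distr lborel borel T) (\<lambda>x. ennreal (gauss_density x))"
    by (rule density_distr[symmetric]) auto
  also have "\<dots> = std_gaussian"
    by (simp add: distr_lborel_orthogonal_transformation[OF T] std_gaussian_eq)
  finally show ?thesis .
qed

text \<open>Independence of the coordinates in the form needed for moments. Nonnegative integrals
  avoid any joint integrability question; the one-dimensional factors are Bochner integrals, so that
  the known normal moments fit.\<close>

lemma nn_integral_std_gaussian_prod:
  fixes f :: "real^'d \<Rightarrow> real \<Rightarrow> real"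
  assumes [measurable]: "\<And>b. b \<in> Basis \<Longrightarrow> f b \<in> borel_measurable borel"
    and nn: "\<And>b t. b \<in> Basis \<Longrightarrow> 0 \<le> f b t"
    and c: "\<And>b. b \<in> Basis \<Longrightarrow> has_bochner_integral lborel (\<lambda>t. std_normal_density t * f b t) (c b)"
  shows "(\<integral>\<^sup>+x. ennreal (\<Prod>b\<in>Basis. f b (x \<bullet> b)) \<partial>std_gaussian) = ennreal (\<Prod>b\<in>Basis. c b)"
proof -
  have int: "(\<integral>\<^sup>+t. ennreal (std_normal_density t * f b t) \<partial>lborel) = ennreal (c b)" "0 \<le> c b"
    if b: "b \<in> Basis" for b
  proof -
    show "(\<integral>\<^sup>+t. ennreal (std_normal_density t * f b t) \<partial>lborel) = ennreal (c b)"
      using c[OF b] nn[OF b] by (auto simp: has_bochner_integral_iff nn_integral_eq_integral)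
    have "0 \<le> (LINT t|lborel. std_normal_density t * f b t)"
      by (intro Bochner_Integration.integral_nonneg mult_nonneg_nonneg nn b) auto
    then show "0 \<le> c b" using c[OF b] by (simp add: has_bochner_integral_iff)
  qed
  have "(\<integral>\<^sup>+x. ennreal (\<Prod>b\<in>Basis. f b (x \<bullet> b)) \<partial>std_gaussian)
      = (\<integral>\<^sup>+x. ennreal (gauss_density x) * ennreal (\<Prod>b\<in>Basis. f b (x \<bullet> b)) \<partial>lborel)"
    unfolding std_gaussian_eq by (rule nn_integral_density) measurable
  also have "\<dots> = (\<integral>\<^sup>+x. (\<Prod>b\<in>Basis. ennreal (std_normal_density (x \<bullet> b) * f b (x \<bullet> b))) \<partial>lborel)"
  proof (intro nn_integral_cong)
    fix x :: "real^'d"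
    have "ennreal (gauss_density x) * ennreal (\<Prod>b\<in>Basis. f b (x \<bullet> b))
        = ennreal (\<Prod>b\<in>Basis. std_normal_density (x \<bullet> b) * f b (x \<bullet> b))"
      unfolding gauss_density_Basis
      by (subst ennreal_mult[symmetric]) (auto intro!: prod_nonneg nn simp: prod.distrib)
    also have "\<dots> = (\<Prod>b\<in>Basis. ennreal (std_normal_density (x \<bullet> b) * f b (x \<bullet> b)))"
      by (rule prod_ennreal[symmetric]) (auto intro!: nn mult_nonneg_nonneg)
    finally show "ennreal (gauss_density x) * ennreal (\<Prod>b\<in>Basis. f b (x \<bullet> b)) = \<dots>" .
  qed
  also have "\<dots> = (\<Prod>b\<in>Basis. (\<integral>\<^sup>+t. ennreal (std_normal_density t * f b t) \<partial>lborel))"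
    by (rule nn_integral_lborel_prod) auto
  also have "\<dots> = (\<Prod>b\<in>Basis. ennreal (c b))" using int by (intro prod.cong) auto
  also have "\<dots> = ennreal (\<Prod>b\<in>Basis. c b)" using int by (intro prod_ennreal) auto
  finally show ?thesis .
qed

lemma std_normal_has_bochner_integral_1: "has_bochner_integral lborel std_normal_density 1"
  using std_normal_moment_even[of 0] by simp

lemma prob_space_std_gaussian: "prob_space (std_gaussian :: (real^'d) measure)"
proof
  have "(\<integral>\<^sup>+x. ennreal (\<Prod>b\<in>Basis. 1) \<partial>(std_gaussian :: (real^'d) measure))
      = ennreal (\<Prod>b\<in>(Basis :: (real^'d) set). 1)"
    using nn_integral_std_gaussian_prod[of "\<lambda>(_ :: real^'d) _. 1" "\<lambda>_. 1"]
    by (simp add: std_normal_has_bochner_integral_1)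
  then show "emeasure (std_gaussian :: (real^'d) measure) (space std_gaussian) = 1" by simp
qed

lemma std_gaussian_coord:
  fixes e :: "real^'d" and g :: "real \<Rightarrow> real"
  assumes e: "e \<in> Basis" and [measurable]: "g \<in> borel_measurable borel" and nn: "\<And>t. 0 \<le> g t"
    and c: "has_bochner_integral lborel (\<lambda>t. std_normal_density t * g t) c"
  shows "has_bochner_integral std_gaussian (\<lambda>x. g (x \<bullet> e)) c"
proof (rule has_bochner_integral_nn_integral)
  have "0 \<le> (LINT t|lborel. std_normal_density t * g t)"
    by (intro Bochner_Integration.integral_nonneg mult_nonneg_nonneg nn) auto
  then show "0 \<le> c" using c by (simp add: has_bochner_integral_iff)
  define f where "f b t = (if b = e then g t else 1)" for b :: "real^'d" and t
  define c' where "c' b = (if b = e then c else 1)" for b :: "real^'d"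
  have "(\<integral>\<^sup>+x. ennreal (\<Prod>b\<in>Basis. f b (x \<bullet> b)) \<partial>std_gaussian) = ennreal (\<Prod>b\<in>Basis. c' b)"
    by (rule nn_integral_std_gaussian_prod)
       (auto simp: f_def c'_def nn c std_normal_has_bochner_integral_1)
  moreover have "(\<Prod>b\<in>Basis. f b (x \<bullet> b)) = g (x \<bullet> e)" for x
    unfolding f_def using e by (simp add: prod.delta)
  moreover have "(\<Prod>b\<in>Basis. c' b) = c"
    unfolding c'_def using e by (simp add: prod.delta)
  ultimately show "(\<integral>\<^sup>+x. ennreal (g (x \<bullet> e)) \<partial>std_gaussian) = ennreal c" by simp
qed (auto simp: nn)

lemma std_gaussian_coord_abs_pair:
  fixes e1 e2 :: "real^'d"
  assumes e: "e1 \<in> Basis" "e2 \<in> Basis" "e1 \<noteq> e2"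
  shows "has_bochner_integral std_gaussian (\<lambda>x. \<bar>(x \<bullet> e1) * (x \<bullet> e2)\<bar>) (2 / pi)"
proof (rule has_bochner_integral_nn_integral)
  \<comment> \<open>\<open>s\<close> is the mean absolute value of a standard normal variable; its
    square is \<open>2 / pi\<close>.\<close>
  define s where "s = sqrt (2 / pi)"
  \<comment> \<open>Two separate conditionals, so that the product over the basis splits into one
    factor for \<open>e1\<close> and one for \<open>e2\<close>.\<close>
  define f where "f b t = (if b = e1 then \<bar>t\<bar> else 1) * (if b = e2 then \<bar>t\<bar> else 1)" for b :: "real^'d" and t :: real
  define c where "c b = (if b = e1 then s else 1) * (if b = e2 then s else 1)" for b :: "real^'d"
  have s: "has_bochner_integral lborel (\<lambda>t. std_normal_density t * \<bar>t\<bar>) s"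
    using std_normal_moment_abs_odd[of 0] by (simp add: s_def)
  have "(\<integral>\<^sup>+x. ennreal (\<Prod>b\<in>Basis. f b (x \<bullet> b)) \<partial>std_gaussian) = ennreal (\<Prod>b\<in>Basis. c b)"
    by (rule nn_integral_std_gaussian_prod)
       (use e s in \<open>auto simp: f_def c_def std_normal_has_bochner_integral_1\<close>)
  moreover have "(\<Prod>b\<in>Basis. f b (x \<bullet> b)) = \<bar>(x \<bullet> e1) * (x \<bullet> e2)\<bar>" for x
    unfolding f_def prod.distrib using e by (simp add: prod.delta abs_mult)
  moreover have "(\<Prod>b\<in>Basis. c b) = 2 / pi"
    unfolding c_def prod.distrib using e by (simp add: prod.delta s_def)
  ultimately show "(\<integral>\<^sup>+x. ennreal \<bar>(x \<bullet> e1) * (x \<bullet> e2)\<bar> \<partial>std_gaussian) = ennreal (2 / pi)" by simp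
qed auto

section \<open>Moments of linear functionals of a standard Gaussian\<close>

lemma std_gaussian_orthogonal_transfer:
  fixes g :: "real^'d \<Rightarrow> real" and T :: "real^'d \<Rightarrow> real^'d"
  assumes T: "orthogonal_transformation T" and [measurable]: "g \<in> borel_measurable borel"
    and c: "has_bochner_integral std_gaussian g c"
  shows "has_bochner_integral std_gaussian (\<lambda>x. g (T x)) c"
proof -
  have [measurable]: "T \<in> borel_measurable borel"
    using T by (rule borel_measurable_orthogonal_transformation)
  have "has_bochner_integral (distr std_gaussian borel T) g c"
    using c by (simp add: distr_std_gaussian_orthogonal_transformation[OF T])
  then show ?thesis
    by (simp add: has_bochner_integral_iff integrable_distr_eq integral_distr)
qed

text \<open>By rotation invariance \<open>a\<close> may be replaced by \<open>norm a\<close> times a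
  basis vector, which leaves the moments of one standard normal variable.\<close>

lemma std_gaussian_inner_power_even:
  fixes a :: "real^'d"
  shows "has_bochner_integral std_gaussian (\<lambda>x. (x \<bullet> a) ^ (2 * k))
    (fact (2 * k) / (2 ^ k * fact k) * norm a ^ (2 * k))"
proof -
  obtain e :: "real^'d" where e: "e \<in> Basis" using nonempty_Basis by blast
  define T where "T = reflection (a - norm a *\<^sub>R e)"
  have T: "orthogonal_transformation T" "T a = norm a *\<^sub>R e"
    unfolding T_def using orthogonal_transformation_reflection e by (auto intro!: reflection_swap)
  have "has_bochner_integral std_gaussian (\<lambda>x. (x \<bullet> e) ^ (2 * k)) (fact (2 * k) / (2 ^ k * fact k))"
    by (rule std_gaussian_coord[OF e]) (auto intro: std_normal_moment_even simp: zero_le_even_power)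
  then have "has_bochner_integral std_gaussian (\<lambda>x. (T x \<bullet> e) ^ (2 * k)) (fact (2 * k) / (2 ^ k * fact k))"
    by (rule std_gaussian_orthogonal_transfer[OF T(1), rotated]) auto
  then have "has_bochner_integral std_gaussian (\<lambda>x. norm a ^ (2 * k) * (T x \<bullet> e) ^ (2 * k))
    (norm a ^ (2 * k) * (fact (2 * k) / (2 ^ k * fact k)))"
    by (rule has_bochner_integral_mult_right)
  moreover have "norm a ^ (2 * k) * (T x \<bullet> e) ^ (2 * k) = (x \<bullet> a) ^ (2 * k)" for x
  proof -
    have "x \<bullet> a = T x \<bullet> T a" using T(1) unfolding orthogonal_transformation_def by simp
    then show ?thesis by (simp add: T(2) power_mult_distrib)
  qed
  ultimately show ?thesis by (simp add: mult.commute)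
qed

lemma std_gaussian_inner_2:
  "has_bochner_integral std_gaussian (\<lambda>x. (x \<bullet> a)\<^sup>2) ((norm a)\<^sup>2)"
  using std_gaussian_inner_power_even[of a 1] by simp

lemma std_gaussian_inner_4:
  "has_bochner_integral std_gaussian (\<lambda>x. (x \<bullet> a) ^ 4) (3 * norm a ^ 4)"
  using std_gaussian_inner_power_even[of a 2] by (simp add: fact_numeral)

text \<open>Polarisation from pure fourth moments: \<open>(p + q) ^ 4 + (p - q) ^ 4 - 2 * p ^ 4 - 2
  * q ^ 4 = 12 * p\<^sup>2 * q\<^sup>2\<close> with \<open>p = x \<bullet> a\<close> and
  \<open>q = x \<bullet> b\<close>.\<close>

lemma std_gaussian_inner_22:
  fixes a b :: "real^'d"
  shows "has_bochner_integral std_gaussian (\<lambda>x. (x \<bullet> a)\<^sup>2 * (x \<bullet> b)\<^sup>2)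
     ((norm a)\<^sup>2 * (norm b)\<^sup>2 + 2 * (a \<bullet> b)\<^sup>2)"
proof -
  note h = std_gaussian_inner_4
  have "has_bochner_integral std_gaussian
      (\<lambda>x. (1/12) * ((x \<bullet> (a + b)) ^ 4 + (x \<bullet> (a - b)) ^ 4 - 2 * (x \<bullet> a) ^ 4 - 2 * (x \<bullet> b) ^ 4))
      ((1/12) * (3 * norm (a + b) ^ 4 + 3 * norm (a - b) ^ 4 - 2 * (3 * norm a ^ 4) - 2 * (3 * norm b ^ 4)))"
    by (intro has_bochner_integral_mult_right has_bochner_integral_add has_bochner_integral_diff h)
  moreover have "(1/12) * ((x \<bullet> (a + b)) ^ 4 + (x \<bullet> (a - b)) ^ 4 - 2 * (x \<bullet> a) ^ 4 - 2 * (x \<bullet> b) ^ 4)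
      = (x \<bullet> a)\<^sup>2 * (x \<bullet> b)\<^sup>2" for x
    unfolding inner_add_right inner_diff_right by (simp add: field_simps) algebra
  moreover have "(1/12) * (3 * norm (a + b) ^ 4 + 3 * norm (a - b) ^ 4 - 2 * (3 * norm a ^ 4) - 2 * (3 * norm b ^ 4))
      = (norm a)\<^sup>2 * (norm b)\<^sup>2 + 2 * (a \<bullet> b)\<^sup>2"
  proof -
    have 4: "norm c ^ 4 = (c \<bullet> c)\<^sup>2" for c :: "real^'d"
      by (simp add: power2_norm_eq_inner[symmetric])
    show ?thesis
      unfolding 4 power2_norm_eq_inner inner_add_left inner_add_right inner_diff_left inner_diff_right
        inner_commute[of b a]
      by (simp add: field_simps) algebra
  qed
  ultimately show ?thesis by (simp only:)
qed

text \<open>Orthogonal \<open>p\<close> and \<open>q\<close> give independent normal variables, so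
  the mean is a product of two absolute moments. Rotation to multiples of two distinct basis vectors
  makes this explicit.\<close>

lemma std_gaussian_abs_pair:
  fixes p q :: "real^'d"
  assumes o: "p \<bullet> q = 0"
  shows "has_bochner_integral std_gaussian (\<lambda>x. \<bar>(x \<bullet> p) * (x \<bullet> q)\<bar>) (2 / pi * (norm p * norm q))"
proof (cases "p = 0 \<or> q = 0")
  case True
  then show ?thesis by (auto simp: has_bochner_integral_iff)
next
  case False
  \<comment> \<open>Two nonzero orthogonal vectors force dimension at least 2, which provides the
    two basis vectors.\<close>
  have "DIM(real^'d) \<noteq> 1"
  proof
    assume "DIM(real^'d) = 1"
    moreover have "independent {p, q}"
      using False o by (intro pairwise_orthogonal_independent) (auto simp: pairwise_def orthogonal_def inner_commute)
    moreover have "p \<noteq> q" using False o by auto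
    ultimately show False using independent_card_le[of "{p, q}"] by simp
  qed
  then have ge: "DIM(real^'d) \<ge> 2" using DIM_positive[where 'a = "real^'d"] by linarith
  obtain B where B: "B \<subseteq> (Basis :: (real^'d) set)" "card B = 2"
    by (rule obtain_subset_with_card_n[OF ge]) (rule that)
  then obtain e1 e2 where "B = {e1, e2}" "e1 \<noteq> e2" using card_2_iff[of B] by auto
  with B(1) have e: "e1 \<in> Basis" "e2 \<in> Basis" "e1 \<noteq> e2" by auto
  obtain T where T: "orthogonal_transformation T" "T p = norm p *\<^sub>R e1" "T q = norm q *\<^sub>R e2"
    by (rule orthogonal_transformation_pair[of p "norm p *\<^sub>R e1" q "norm q *\<^sub>R e2"])
       (use e o in \<open>auto simp: inner_Basis\<close>)
  have "has_bochner_integral std_gaussian (\<lambda>x. \<bar>(T x \<bullet> e1) * (T x \<bullet> e2)\<bar>) (2 / pi)"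
    by (rule std_gaussian_orthogonal_transfer[OF T(1) _ std_gaussian_coord_abs_pair[OF e]]) measurable
  then have "has_bochner_integral std_gaussian
     (\<lambda>x. (norm p * norm q) * \<bar>(T x \<bullet> e1) * (T x \<bullet> e2)\<bar>) ((norm p * norm q) * (2 / pi))"
    by (rule has_bochner_integral_mult_right)
  moreover have "(norm p * norm q) * \<bar>(T x \<bullet> e1) * (T x \<bullet> e2)\<bar> = \<bar>(x \<bullet> p) * (x \<bullet> q)\<bar>" for x
  proof -
    have "x \<bullet> p = T x \<bullet> T p" "x \<bullet> q = T x \<bullet> T q"
      using T(1) unfolding orthogonal_transformation_def by simp_all
    then show ?thesis by (simp add: T(2,3) abs_mult)
  qed
  ultimately show ?thesis by (simp add: mult.commute)
qed

text \<open>\<open>min s t = (s + t - \<bar>s - t\<bar>) / 2\<close>, and the difference of squares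
  factors as \<open>(x \<bullet> (a - b)) * (x \<bullet> (a + b))\<close>, with \<open>a - b\<close>
  orthogonal to \<open>a + b\<close> for unit vectors. The mean is thus
  \<open>1 - norm (a - b) * norm (a + b) / pi\<close>; by the parallelogram law and the inequality
  of means the product of norms is at most 2.\<close>

lemma std_gaussian_min_inner_unit:
  fixes a b :: "real^'d"
  assumes n: "norm a = 1" "norm b = 1"
  shows "integrable std_gaussian (\<lambda>x. min ((x \<bullet> a)\<^sup>2) ((x \<bullet> b)\<^sup>2))"
    and "1 - 2 / pi \<le> (LINT x|std_gaussian. min ((x \<bullet> a)\<^sup>2) ((x \<bullet> b)\<^sup>2))"
proof -
  have o: "(a - b) \<bullet> (a + b) = 0"
    using n by (simp add: inner_diff_left inner_add_right inner_commute[of b a] norm_eq_1)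
  have "has_bochner_integral std_gaussian
      (\<lambda>x. (1/2) * ((x \<bullet> a)\<^sup>2 + (x \<bullet> b)\<^sup>2 - \<bar>(x \<bullet> (a - b)) * (x \<bullet> (a + b))\<bar>))
      ((1/2) * ((norm a)\<^sup>2 + (norm b)\<^sup>2 - 2 / pi * (norm (a - b) * norm (a + b))))"
    by (intro has_bochner_integral_mult_right has_bochner_integral_add has_bochner_integral_diff
          std_gaussian_inner_2 std_gaussian_abs_pair o)
  moreover have "(1/2) * ((x \<bullet> a)\<^sup>2 + (x \<bullet> b)\<^sup>2 - \<bar>(x \<bullet> (a - b)) * (x \<bullet> (a + b))\<bar>)
      = min ((x \<bullet> a)\<^sup>2) ((x \<bullet> b)\<^sup>2)" for x
  proof -
    have "(x \<bullet> (a - b)) * (x \<bullet> (a + b)) = (x \<bullet> a)\<^sup>2 - (x \<bullet> b)\<^sup>2"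
      by (simp add: inner_diff_right inner_add_right algebra_simps power2_eq_square)
    then show ?thesis by (auto simp: min_def abs_if)
  qed
  ultimately have h: "has_bochner_integral std_gaussian (\<lambda>x. min ((x \<bullet> a)\<^sup>2) ((x \<bullet> b)\<^sup>2))
     ((1/2) * (2 - 2 / pi * (norm (a - b) * norm (a + b))))"
    using n by simp
  show "integrable std_gaussian (\<lambda>x. min ((x \<bullet> a)\<^sup>2) ((x \<bullet> b)\<^sup>2))"
    using h by (simp add: has_bochner_integral_iff)
  have "(norm (a - b))\<^sup>2 + (norm (a + b))\<^sup>2 = 4"
    using n unfolding power2_norm_eq_inner
    by (simp add: inner_diff_left inner_diff_right inner_add_left inner_add_right norm_eq_1)
  then have "norm (a - b) * norm (a + b) \<le> 2"
    using sum_squares_bound[of "norm (a - b)" "norm (a + b)"] by simp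
  then have "2 / pi * (norm (a - b) * norm (a + b)) \<le> 2 / pi * 2"
    by (intro mult_left_mono) auto
  then show "1 - 2 / pi \<le> (LINT x|std_gaussian. min ((x \<bullet> a)\<^sup>2) ((x \<bullet> b)\<^sup>2))"
    using h by (simp add: has_bochner_integral_iff)
qed

section \<open>General centred Gaussian laws\<close>

lemma centered_gaussian_integral:
  fixes S :: "real^'d^'d"
  assumes g: "centered_gaussian S \<mu>"
  obtains A :: "real^'d^'d" where "S = A ** transpose A" "\<mu> = distr std_gaussian borel (\<lambda>z. A *v z)"
    "(\<lambda>z. A *v z) \<in> borel_measurable borel"
    "\<And>z u. (A *v z) \<bullet> u = z \<bullet> (transpose A *v u)"
    "\<And>u w. (transpose A *v u) \<bullet> (transpose A *v w) = (S *v u) \<bullet> w"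
proof -
  obtain A :: "real^'d^'d" where A: "A ** transpose A = S" "\<mu> = distr std_gaussian borel (\<lambda>z. A *v z)"
    using g unfolding centered_gaussian_def by blast
  have 1: "(A *v z) \<bullet> u = z \<bullet> (transpose A *v u)" for z u
    by (metis dot_lmul_matrix inner_commute transpose_matrix_vector transpose_transpose)
  have "(transpose A *v u) \<bullet> (transpose A *v w) = (S *v u) \<bullet> w" for u w
    unfolding 1[symmetric] A(1)[symmetric] by (simp only: matrix_vector_mul_assoc)
  moreover have "(\<lambda>z. A *v z) \<in> borel_measurable borel"
    by (intro borel_measurable_continuous_onI continuous_intros)
  ultimately show ?thesis using that A 1 by metis
qed

text \<open>For \<open>x = A *v z\<close> one has
  \<open>x \<bullet> u = z \<bullet> (transpose A *v u)\<close>, and inner products of the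
  transformed vectors are values of the form \<open>S\<close>. The second formula is an instance of
  Isserlis' theorem.\<close>

lemma centered_gaussian_moments:
  fixes S :: "real^'d^'d"
  assumes g: "centered_gaussian S \<mu>"
  shows "has_bochner_integral \<mu> (\<lambda>x. (x \<bullet> a)\<^sup>2) ((S *v a) \<bullet> a)"
    and "has_bochner_integral \<mu> (\<lambda>x. (x \<bullet> a)\<^sup>2 * (x \<bullet> b)\<^sup>2)
      (((S *v a) \<bullet> a) * ((S *v b) \<bullet> b) + 2 * ((S *v a) \<bullet> b)\<^sup>2)"
proof -
  obtain A :: "real^'d^'d" where A: "S = A ** transpose A" "\<mu> = distr std_gaussian borel (\<lambda>z. A *v z)"
    "(\<lambda>z. A *v z) \<in> borel_measurable borel"
    "\<And>z u. (A *v z) \<bullet> u = z \<bullet> (transpose A *v u)"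
    "\<And>u w. (transpose A *v u) \<bullet> (transpose A *v w) = (S *v u) \<bullet> w"
    by (rule centered_gaussian_integral[OF g]) (rule that)
  note [measurable] = A(3)
  have n: "(norm (transpose A *v u))\<^sup>2 = (S *v u) \<bullet> u" for u
    unfolding power2_norm_eq_inner by (rule A(5))
  show "has_bochner_integral \<mu> (\<lambda>x. (x \<bullet> a)\<^sup>2) ((S *v a) \<bullet> a)"
    using std_gaussian_inner_2[of "transpose A *v a"]
    by (simp add: A(2) has_bochner_integral_iff integrable_distr_eq integral_distr A(4) n
        del: transpose_matrix_vector)
  show "has_bochner_integral \<mu> (\<lambda>x. (x \<bullet> a)\<^sup>2 * (x \<bullet> b)\<^sup>2)
      (((S *v a) \<bullet> a) * ((S *v b) \<bullet> b) + 2 * ((S *v a) \<bullet> b)\<^sup>2)"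
    using std_gaussian_inner_22[of "transpose A *v a" "transpose A *v b"]
    by (simp add: A(2) has_bochner_integral_iff integrable_distr_eq integral_distr A(4,5) n
        del: transpose_matrix_vector)
qed

lemma centered_gaussian_P4:
  assumes g: "centered_gaussian S (\<mu> :: (real^'d) measure)"
  shows "\<mu> \<in> P4"
proof -
  obtain A :: "real^'d^'d" where A: "\<mu> = distr std_gaussian borel (\<lambda>z. A *v z)"
    "(\<lambda>z. A *v z) \<in> borel_measurable borel"
    by (rule centered_gaussian_integral[OF g]) (rule that)
  have ps: "prob_space \<mu>"
    unfolding A(1) using A(2) by (intro prob_space.prob_space_distr prob_space_std_gaussian) simp
  have sets [measurable_cong]: "sets \<mu> = sets borel" by (simp add: A(1))
  \<comment> \<open>Expands the fourth power into mixed moments already known to be finite.\<close>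
  have "norm x ^ 4 = (\<Sum>b\<in>Basis. \<Sum>c\<in>Basis. (x \<bullet> b)\<^sup>2 * (x \<bullet> c)\<^sup>2)" for x :: "real^'d"
  proof -
    have "norm x ^ 4 = ((norm x)\<^sup>2)\<^sup>2" by simp
    also have "(norm x)\<^sup>2 = (\<Sum>b\<in>Basis. (x \<bullet> b)\<^sup>2)"
      unfolding power2_norm_eq_inner by (subst euclidean_inner) (simp add: power2_eq_square)
    finally show ?thesis by (simp add: power2_eq_square sum_product)
  qed
  moreover have "integrable \<mu> (\<lambda>x. \<Sum>b\<in>Basis. \<Sum>c\<in>Basis. (x \<bullet> b)\<^sup>2 * (x \<bullet> c)\<^sup>2)"
    using centered_gaussian_moments(2)[OF g]
    by (intro Bochner_Integration.integrable_sum) (auto simp: has_bochner_integral_iff)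
  ultimately have "integrable \<mu> (\<lambda>x. norm x ^ 4)" by simp
  then show ?thesis using ps sets by (simp add: P4_def)
qed

text \<open>In terms of the standard Gaussian the functionals are given by \<open>p\<close> and
  \<open>q\<close>, of squared norm at least \<open>l > 0\<close>. So
  \<open>(x \<bullet> p)\<^sup>2\<close> is at least \<open>l\<close> times its value for the
  normalised vector, and the unit case applies.\<close>

lemma centered_gaussian_min_inner:
  fixes u w :: "real^'d"
  assumes g: "centered_gaussian S \<mu>" and l: "0 < l"
    and u: "l \<le> (S *v u) \<bullet> u" and w: "l \<le> (S *v w) \<bullet> w"
  shows "(1 - 2 / pi) * l \<le> (LINT x|\<mu>. min ((x \<bullet> u)\<^sup>2) ((x \<bullet> w)\<^sup>2))"
proof -
  obtain A :: "real^'d^'d" where A: "S = A ** transpose A" "\<mu> = distr std_gaussian borel (\<lambda>z. A *v z)"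
    "(\<lambda>z. A *v z) \<in> borel_measurable borel"
    "\<And>z u. (A *v z) \<bullet> u = z \<bullet> (transpose A *v u)"
    "\<And>u w. (transpose A *v u) \<bullet> (transpose A *v w) = (S *v u) \<bullet> w"
    by (rule centered_gaussian_integral[OF g]) (rule that)
  note [measurable] = A(3)
  have [measurable_cong]: "sets \<mu> = sets borel" by (simp add: A(2))
  have "integrable \<mu> (\<lambda>x. (x \<bullet> u)\<^sup>2)"
    using centered_gaussian_moments(1)[OF g, of u] by (simp add: has_bochner_integral_iff)
  then have int: "integrable \<mu> (\<lambda>x. min ((x \<bullet> u)\<^sup>2) ((x \<bullet> w)\<^sup>2))"
    by (rule Bochner_Integration.integrable_bound) auto
  define p q where "p = transpose A *v u" and "q = transpose A *v w"
  have n: "l \<le> (norm p)\<^sup>2" "l \<le> (norm q)\<^sup>2"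
    using u w by (simp_all only: power2_norm_eq_inner p_def q_def A(5))
  then have pos: "0 < norm p" "0 < norm q" using l by auto
  let ?a = "p /\<^sub>R norm p" and ?b = "q /\<^sub>R norm q"
  have ab: "norm ?a = 1" "norm ?b = 1" using pos by auto
  have "(1 - 2 / pi) * l \<le> l * (LINT x|std_gaussian. min ((x \<bullet> ?a)\<^sup>2) ((x \<bullet> ?b)\<^sup>2))"
    using std_gaussian_min_inner_unit(2)[OF ab] l by (simp add: mult.commute)
  also have "\<dots> = (LINT x|std_gaussian. l * min ((x \<bullet> ?a)\<^sup>2) ((x \<bullet> ?b)\<^sup>2))" by simp
  also have "\<dots> \<le> (LINT x|std_gaussian. min ((x \<bullet> p)\<^sup>2) ((x \<bullet> q)\<^sup>2))"
  proof (rule integral_mono)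
    show "integrable std_gaussian (\<lambda>x. l * min ((x \<bullet> ?a)\<^sup>2) ((x \<bullet> ?b)\<^sup>2))"
      using std_gaussian_min_inner_unit(1)[OF ab] by simp
    show "integrable std_gaussian (\<lambda>x. min ((x \<bullet> p)\<^sup>2) ((x \<bullet> q)\<^sup>2))"
      using int by (simp add: A(2) integrable_distr_eq A(4) p_def q_def)
    fix x :: "real^'d"
    have "l * (x \<bullet> (r /\<^sub>R norm r))\<^sup>2 \<le> (x \<bullet> r)\<^sup>2" if "l \<le> (norm r)\<^sup>2" "0 < norm r" for r
    proof -
      have "l * (x \<bullet> (r /\<^sub>R norm r))\<^sup>2 \<le> (norm r)\<^sup>2 * (x \<bullet> (r /\<^sub>R norm r))\<^sup>2"
        using that(1) by (rule mult_right_mono) simp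
      also have "\<dots> = (norm r * (x \<bullet> (r /\<^sub>R norm r)))\<^sup>2" by (rule power_mult_distrib[symmetric])
      also have "norm r * (x \<bullet> (r /\<^sub>R norm r)) = x \<bullet> r" using that(2) by simp
      finally show ?thesis .
    qed
    from this[OF n(1) pos(1)] this[OF n(2) pos(2)]
    have "l * (x \<bullet> ?a)\<^sup>2 \<le> (x \<bullet> p)\<^sup>2" "l * (x \<bullet> ?b)\<^sup>2 \<le> (x \<bullet> q)\<^sup>2"
      by blast+
    moreover have "l * min ((x \<bullet> ?a)\<^sup>2) ((x \<bullet> ?b)\<^sup>2) \<le> l * (x \<bullet> ?a)\<^sup>2"
      "l * min ((x \<bullet> ?a)\<^sup>2) ((x \<bullet> ?b)\<^sup>2) \<le> l * (x \<bullet> ?b)\<^sup>2"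
      using l by (simp_all only: mult_left_mono min.cobounded1 min.cobounded2 less_imp_le)
    ultimately show "l * min ((x \<bullet> ?a)\<^sup>2) ((x \<bullet> ?b)\<^sup>2) \<le> min ((x \<bullet> p)\<^sup>2) ((x \<bullet> q)\<^sup>2)"
      by (meson min.boundedI order_trans)
  qed
  also have "\<dots> = (LINT x|\<mu>. min ((x \<bullet> u)\<^sup>2) ((x \<bullet> w)\<^sup>2))"
    by (simp add: A(2) integral_distr A(4) p_def q_def)
  finally show "(1 - 2 / pi) * l \<le> (LINT x|\<mu>. min ((x \<bullet> u)\<^sup>2) ((x \<bullet> w)\<^sup>2))" .
qed

section \<open>The phase retrieval problems\<close>

definition tensor :: "real^'d \<Rightarrow> real^'d \<Rightarrow> real^'d^'d" where
  "tensor a b = (\<chi> i j. a $ i * b $ j)"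

lemma outer_eq_tensor: "outer b = tensor b b"
  by (simp add: outer_def tensor_def)

lemma inner_tensor: "V \<bullet> tensor a b = a \<bullet> (V *v b)"
  by (simp add: inner_vec_def tensor_def matrix_vector_mult_def sum_distrib_left mult_ac)

lemma tensor_mult_vec: "tensor a b *v w = (b \<bullet> w) *\<^sub>R a"
  by (simp add: vec_eq_iff inner_vec_def tensor_def matrix_vector_mult_def sum_distrib_right sum_distrib_left mult_ac)

lemma transpose_tensor: "transpose (tensor a b) = tensor b a"
  by (simp add: vec_eq_iff transpose_def tensor_def mult.commute)

lemma inner_tensor_tensor: "tensor a b \<bullet> tensor c d = (a \<bullet> c) * (b \<bullet> d)"
  by (simp add: inner_tensor tensor_mult_vec inner_commute)

lemma norm_tensor: "norm (tensor a b) = norm a * norm b"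
  by (simp add: norm_eq_sqrt_inner inner_tensor_tensor real_sqrt_mult)

text \<open>\<open>tensor b h + tensor h b\<close> is the derivative of \<open>outer\<close>. Its
  squared norm lies between 2 and 4 times \<open>(norm b)\<^sup>2 * (norm h)\<^sup>2\<close>, whence
  the factor 2 between the constants of problem (a).\<close>

lemma norm_sym_tensor:
  "(norm (tensor b h + tensor h b))\<^sup>2 = 2 * (norm b)\<^sup>2 * (norm h)\<^sup>2 + 2 * (b \<bullet> h)\<^sup>2"
  unfolding power2_norm_eq_inner inner_add_left inner_add_right inner_tensor_tensor
  by (simp add: inner_commute power2_eq_square)

lemma bounded_bilinear_tensor: "bounded_bilinear (tensor :: real^'d \<Rightarrow> real^'d \<Rightarrow> real^'d^'d)"
  unfolding bilinear_conv_bounded_bilinear[symmetric] bilinear_def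
  by (auto intro!: linearI simp: tensor_def vec_eq_iff algebra_simps)

lemma bounded_bilinear_matrix_vector_mult:
  "bounded_bilinear ((*v) :: real^'d^'d \<Rightarrow> real^'d \<Rightarrow> real^'d)"
  unfolding bilinear_conv_bounded_bilinear[symmetric] bilinear_def
  by (auto intro!: linearI simp: matrix_vector_right_distrib matrix_vector_mult_add_rdistrib
      matrix_vector_mult_scaleR scaleR_matrix_vector_assoc)

lemma subspace_sym_mats: "subspace sym_mats"
  unfolding subspace_def sym_mats_def by (auto simp: transpose_def vec_eq_iff)

lemma outer_rank_one_psd:
  assumes "b \<noteq> 0" shows "outer b \<in> rank_one_psd"
proof -
  have "range (\<lambda>x. outer b *v x) = span {b}"
  proof (intro set_eqI iffI)
    fix y assume "y \<in> range (\<lambda>x. outer b *v x)"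
    then show "y \<in> span {b}" by (auto simp: outer_eq_tensor tensor_mult_vec span_singleton)
  next
    fix y assume "y \<in> span {b}"
    then obtain c where "y = c *\<^sub>R b" by (auto simp: span_singleton)
    then have "y = outer b *v ((c / (b \<bullet> b)) *\<^sub>R b)"
      using assms by (simp add: outer_eq_tensor tensor_mult_vec)
    then show "y \<in> range (\<lambda>x. outer b *v x)" by blast
  qed
  then have "rank (outer b) = 1"
    using assms by (simp add: rank_dim_range dim_span)
  moreover have "outer b \<in> psd_mats"
    by (simp add: psd_mats_def sym_mats_def outer_eq_tensor transpose_tensor tensor_mult_vec inner_commute)
  ultimately show ?thesis by (simp add: rank_one_psd_def)
qed

text \<open>A matrix of rank one sends every \<open>x\<close> to a multiple \<open>k x\<close> of a
  fixed \<open>w\<close>. Symmetry forces \<open>k x = c * (x \<bullet> w)\<close>, semidefiniteness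
  \<open>c \<ge> 0\<close>, and the scale is absorbed as \<open>sqrt c\<close>.\<close>

lemma rank_one_psd_outer:
  fixes A :: "real^'d^'d"
  assumes A: "A \<in> rank_one_psd"
  obtains b where "b \<noteq> 0" "A = outer b"
proof -
  have tr: "transpose A = A" and psd: "\<And>u. 0 \<le> u \<bullet> (A *v u)" and rk: "rank A = 1"
    using A by (auto simp: rank_one_psd_def psd_mats_def sym_mats_def)
  have sym: "(A *v x) \<bullet> z = x \<bullet> (A *v z)" for x z
    using dot_lmul_matrix[of x A z] tr by (metis inner_commute transpose_matrix_vector)
  have "dim (range (\<lambda>x. A *v x)) = 1" using rk by (simp add: rank_dim_range)
  then obtain B where B: "card B = 1" "range (\<lambda>x. A *v x) \<subseteq> span B"
    by (metis basis_exists)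
  obtain w where w: "B = {w}" using B(1) card_1_singletonE by blast
  have "\<exists>c. A *v x = c *\<^sub>R w" for x
    using B(2) unfolding w span_singleton by (auto simp: image_subset_iff)
  then obtain k where k: "\<And>x. A *v x = k x *\<^sub>R w" by metis
  have "A \<noteq> 0" using rk by auto
  then obtain y where "A *v y \<noteq> 0" by (metis matrix_eq matrix_vector_mult_0)
  then have w0: "w \<noteq> 0" "k y \<noteq> 0" using k[of y] by auto
  define c where "c = k w / (w \<bullet> w)"
  have Ax: "A *v x = (c * (x \<bullet> w)) *\<^sub>R w" for x
  proof -
    have "k x * (w \<bullet> w) = k w * (x \<bullet> w)"
      using sym[of x w] unfolding k by simp
    then have "k x = c * (x \<bullet> w)" using w0 by (simp add: c_def field_simps)
    then show ?thesis using k by simp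
  qed
  have "0 \<le> c * (w \<bullet> w)\<^sup>2" using psd[of w] unfolding Ax by (simp add: power2_eq_square)
  then have "0 \<le> c" using w0 by (simp add: zero_le_mult_iff)
  moreover have "c \<noteq> 0" using Ax[of y] k[of y] w0 by auto
  ultimately have c: "c > 0" by simp
  show ?thesis
  proof (rule that[of "sqrt c *\<^sub>R w"])
    show "sqrt c *\<^sub>R w \<noteq> 0" using c w0 by simp
    show "A = outer (sqrt c *\<^sub>R w)"
    proof (subst matrix_eq, rule allI)
      fix x
      have "outer (sqrt c *\<^sub>R w) *v x = (sqrt c * sqrt c * (x \<bullet> w)) *\<^sub>R w"
        by (simp add: outer_eq_tensor tensor_mult_vec inner_commute mult_ac)
      then show "A *v x = outer (sqrt c *\<^sub>R w) *v x" using c by (simp add: Ax)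
    qed
  qed
qed

section \<open>Fourth moments of feature laws\<close>

lemma P4_integrable:
  fixes g :: "real^'d \<Rightarrow> 'b::{banach, second_countable_topology}"
  assumes "\<mu> \<in> P4" "g \<in> borel_measurable borel" "\<And>x. norm (g x) \<le> c * norm x ^ 4"
  shows "integrable \<mu> g"
proof (rule Bochner_Integration.integrable_bound[of \<mu> "\<lambda>x. c * norm x ^ 4"])
  show "integrable \<mu> (\<lambda>x. c * norm x ^ 4)" using assms(1) by (simp add: P4_def)
  have [measurable_cong]: "sets \<mu> = sets borel" using assms(1) by (simp add: P4_def)
  show "g \<in> borel_measurable \<mu>" using assms(2) by measurable
  show "AE x in \<mu>. norm (g x) \<le> norm (c * norm x ^ 4)"
    unfolding real_norm_def by (intro always_eventually allI order_trans[OF assms(3) abs_ge_self])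
qed

lemma norm_inner_le: "\<bar>x \<bullet> a\<bar> \<le> norm a * norm x"
  using Cauchy_Schwarz_ineq2[of x a] by (simp add: mult.commute)

text \<open>The fourth-moment tensor with two slots filled, as a matrix. Being bilinear in
  \<open>a\<close> and \<open>b\<close>, it reduces the derivatives of the risk to the product rule
  for bounded bilinear maps.\<close>

definition mom4 :: "(real^'d) measure \<Rightarrow> real^'d \<Rightarrow> real^'d \<Rightarrow> real^'d^'d" where
  "mom4 \<mu> a b = (LINT x|\<mu>. ((x \<bullet> a) * (x \<bullet> b)) *\<^sub>R tensor x x)"

lemma integrable_mom4:
  assumes "\<mu> \<in> P4" shows "integrable \<mu> (\<lambda>x. ((x \<bullet> a) * (x \<bullet> b)) *\<^sub>R tensor x x)"
proof (rule P4_integrable[OF assms])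
  show "(\<lambda>x. ((x \<bullet> a) * (x \<bullet> b)) *\<^sub>R tensor x x) \<in> borel_measurable borel"
    by (intro borel_measurable_continuous_onI continuous_intros
        bounded_bilinear.continuous_on[OF bounded_bilinear_tensor])
  fix x :: "real^'a"
  have "\<bar>x \<bullet> a\<bar> * \<bar>x \<bullet> b\<bar> \<le> (norm a * norm x) * (norm b * norm x)"
    by (intro mult_mono norm_inner_le) auto
  then have "(\<bar>x \<bullet> a\<bar> * \<bar>x \<bullet> b\<bar>) * (norm x)\<^sup>2 \<le> ((norm a * norm x) * (norm b * norm x)) * (norm x)\<^sup>2"
    by (rule mult_right_mono) simp
  then show "norm (((x \<bullet> a) * (x \<bullet> b)) *\<^sub>R tensor x x) \<le> (norm a * norm b) * norm x ^ 4"
    by (simp add: norm_tensor abs_mult power2_eq_square power4_eq_xxxx mult_ac)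
qed

lemma bounded_bilinear_mom4:
  assumes "\<mu> \<in> P4" shows "bounded_bilinear (mom4 \<mu>)"
proof -
  note int = integrable_mom4[OF assms]
  have add: "mom4 \<mu> a (b + c) = mom4 \<mu> a b + mom4 \<mu> a c" for a b c
    unfolding mom4_def Bochner_Integration.integral_add[OF int int, symmetric]
    by (simp add: inner_add_right algebra_simps)
  have scale: "mom4 \<mu> a (r *\<^sub>R b) = r *\<^sub>R mom4 \<mu> a b" for a b r
    unfolding mom4_def integral_scaleR_right[symmetric] by (simp add: mult_ac)
  have comm: "mom4 \<mu> a b = mom4 \<mu> b a" for a b
    unfolding mom4_def by (simp add: mult.commute)
  show ?thesis
    unfolding bilinear_conv_bounded_bilinear[symmetric] bilinear_def
  proof (intro conjI allI)
    show "linear (mom4 \<mu> a)" for a by (rule linearI) (fact add, fact scale)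
    then show "linear (\<lambda>a. mom4 \<mu> a b)" for b by (simp only: comm[of _ b])
  qed
qed

definition m4 :: "(real^'d) measure \<Rightarrow> real^'d \<Rightarrow> real^'d \<Rightarrow> real^'d \<Rightarrow> real^'d \<Rightarrow> real" where
  "m4 \<mu> a b c d = (LINT x|\<mu>. (x \<bullet> a) * (x \<bullet> b) * (x \<bullet> c) * (x \<bullet> d))"

text \<open>Adjacent transpositions; they generate the full symmetry of the moment tensor.\<close>

lemma m4_perm: "m4 \<mu> a b c d = m4 \<mu> b a c d" "m4 \<mu> a b c d = m4 \<mu> a c b d" "m4 \<mu> a b c d = m4 \<mu> a b d c"
  by (simp_all add: m4_def mult_ac)

lemma inner_mom4:
  assumes "\<mu> \<in> P4"
  shows "c \<bullet> (mom4 \<mu> a b *v d) = m4 \<mu> a b c d"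
    and "integrable \<mu> (\<lambda>x. (x \<bullet> a) * (x \<bullet> b) * (x \<bullet> c) * (x \<bullet> d))"
proof -
  have bl: "bounded_linear (\<lambda>A. c \<bullet> (A *v d))"
    by (rule bounded_linear_compose[OF bounded_linear_inner_right
          bounded_bilinear.bounded_linear_left[OF bounded_bilinear_matrix_vector_mult]])
  have eq: "c \<bullet> ((((x \<bullet> a) * (x \<bullet> b)) *\<^sub>R tensor x x) *v d) = (x \<bullet> a) * (x \<bullet> b) * (x \<bullet> c) * (x \<bullet> d)" for x
    by (simp add: scaleR_matrix_vector_assoc[symmetric] tensor_mult_vec inner_commute mult_ac)
  show "c \<bullet> (mom4 \<mu> a b *v d) = m4 \<mu> a b c d"
    using integral_bounded_linear[OF bl integrable_mom4[OF assms, of a b]]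
    unfolding mom4_def m4_def by (simp add: eq)
  show "integrable \<mu> (\<lambda>x. (x \<bullet> a) * (x \<bullet> b) * (x \<bullet> c) * (x \<bullet> d))"
    using integrable_bounded_linear[OF bl integrable_mom4[OF assms, of a b]] by (simp add: eq)
qed

section \<open>The joint law of features and response\<close>

definition signal_law :: "(real^'d) measure \<Rightarrow> real^'d \<Rightarrow> real measure \<Rightarrow> ((real^'d) \<times> real) measure" where
  "signal_law \<mu> b \<nu> = distr (\<mu> \<Otimes>\<^sub>M \<nu>) borel (\<lambda>(x, e). (x, (x \<bullet> b)\<^sup>2 + e))"

text \<open>\<open>signal_law\<close> is an image of a product measure, the form to which Fubini
  applies. The kernel composition agrees with it on each set because it integrates the measures of
  the sections, just as the product measure does.\<close>

lemma joint_law_pr_response: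
  assumes \<mu>: "prob_space \<mu>" "sets \<mu> = sets borel" and \<nu>: "prob_space \<nu>" "sets \<nu> = sets borel"
  shows "joint_law \<mu> (pr_response b \<nu>) = signal_law \<mu> b \<nu>"
proof -
  interpret \<mu>: prob_space \<mu> by fact
  interpret \<nu>: prob_space \<nu> by fact
  interpret P: pair_prob_space \<mu> \<nu> ..
  note [measurable_cong] = \<mu>(2) \<nu>(2)
  have [measurable]: "(\<lambda>y :: real. (x, y)) \<in> borel \<rightarrow>\<^sub>M borel" for x :: "real^'a"
    unfolding borel_prod[symmetric] by measurable
  have [measurable]: "(\<lambda>(x, e). (x, (x \<bullet> b)\<^sup>2 + e)) \<in> \<mu> \<Otimes>\<^sub>M \<nu> \<rightarrow>\<^sub>M borel"
    unfolding borel_prod[symmetric] by measurable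
  have eq: "distr (pr_response b \<nu> x) borel (\<lambda>y. (x, y)) = distr \<nu> borel (\<lambda>e. (x, (x \<bullet> b)\<^sup>2 + e))" for x
    unfolding pr_response_def by (subst distr_distr) (auto simp: comp_def)
  have meas: "(\<lambda>x. distr \<nu> borel (\<lambda>e. (x, (x \<bullet> b)\<^sup>2 + e))) \<in> \<mu> \<rightarrow>\<^sub>M subprob_algebra borel"
  proof (rule measurable_distr2[where M = \<nu>])
    show "(\<lambda>(x, e). (x, (x \<bullet> b)\<^sup>2 + e)) \<in> \<mu> \<Otimes>\<^sub>M \<nu> \<rightarrow>\<^sub>M borel" by measurable
    show "(\<lambda>x. \<nu>) \<in> \<mu> \<rightarrow>\<^sub>M subprob_algebra \<nu>"
      by (intro measurable_const) (simp add: space_subprob_algebra \<nu>.subprob_space_axioms)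
  qed
  show ?thesis
    unfolding joint_law_def eq
  proof (rule measure_eqI)
    show sets: "sets (\<mu> \<bind> (\<lambda>x. distr \<nu> borel (\<lambda>e. (x, (x \<bullet> b)\<^sup>2 + e)))) = sets (signal_law \<mu> b \<nu>)"
      by (subst sets_bind[where N = borel]) (auto simp: signal_law_def \<mu>.not_empty)
    fix A assume "A \<in> sets (\<mu> \<bind> (\<lambda>x. distr \<nu> borel (\<lambda>e. (x, (x \<bullet> b)\<^sup>2 + e))))"
    then have A [measurable]: "A \<in> sets borel" by (simp add: sets signal_law_def)
    have "emeasure (\<mu> \<bind> (\<lambda>x. distr \<nu> borel (\<lambda>e. (x, (x \<bullet> b)\<^sup>2 + e)))) A
        = (\<integral>\<^sup>+x. emeasure (distr \<nu> borel (\<lambda>e. (x, (x \<bullet> b)\<^sup>2 + e))) A \<partial>\<mu>)"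
      by (rule emeasure_bind[OF \<mu>.not_empty meas A])
    also have "\<dots> = (\<integral>\<^sup>+x. emeasure \<nu> (Pair x -` ((\<lambda>(x, e). (x, (x \<bullet> b)\<^sup>2 + e)) -` A \<inter> space (\<mu> \<Otimes>\<^sub>M \<nu>))) \<partial>\<mu>)"
    proof (rule nn_integral_cong)
      fix x assume "x \<in> space \<mu>"
      have "(\<lambda>e. (x, (x \<bullet> b)\<^sup>2 + e)) \<in> \<nu> \<rightarrow>\<^sub>M borel"
        unfolding borel_prod[symmetric] by measurable
      then show "emeasure (distr \<nu> borel (\<lambda>e. (x, (x \<bullet> b)\<^sup>2 + e))) A
          = emeasure \<nu> (Pair x -` ((\<lambda>(x, e). (x, (x \<bullet> b)\<^sup>2 + e)) -` A \<inter> space (\<mu> \<Otimes>\<^sub>M \<nu>)))"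
        using A \<open>x \<in> space \<mu>\<close>
        by (subst emeasure_distr) (auto simp: space_pair_measure intro!: arg_cong[where f = "emeasure \<nu>"])
    qed
    also have "\<dots> = emeasure (\<mu> \<Otimes>\<^sub>M \<nu>) ((\<lambda>(x, e). (x, (x \<bullet> b)\<^sup>2 + e)) -` A \<inter> space (\<mu> \<Otimes>\<^sub>M \<nu>))"
      by (rule \<nu>.emeasure_pair_measure_alt[symmetric]) measurable
    also have "\<dots> = emeasure (signal_law \<mu> b \<nu>) A"
      unfolding signal_law_def by (rule emeasure_distr[symmetric]) measurable
    finally show "emeasure (\<mu> \<bind> (\<lambda>x. distr \<nu> borel (\<lambda>e. (x, (x \<bullet> b)\<^sup>2 + e)))) A
      = emeasure (signal_law \<mu> b \<nu>) A" .
  qed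
qed

text \<open>\<open>\<mu>\<close> is an arbitrary law with finite fourth moment and not just the
  Gaussian: the exceptional set is found by applying the analysis to every competing feature
  law.\<close>

locale phase_retrieval =
  fixes \<mu> :: "(real^'d) measure" and \<beta> :: "real^'d" and \<nu> :: "real measure"
  assumes \<mu>: "\<mu> \<in> P4" and \<beta>: "\<beta> \<noteq> 0"
    and \<nu>: "prob_space \<nu>" and sets_\<nu>: "sets \<nu> = sets borel"
    and int1: "integrable \<nu> (\<lambda>e. e)" and mean: "(LINT e|\<nu>. e) = 0"
    and int2: "integrable \<nu> (\<lambda>e. e\<^sup>2)"
begin

abbreviation "J \<equiv> signal_law \<mu> \<beta> \<nu>"

sublocale \<mu>: prob_space \<mu> using \<mu> by (simp add: P4_def)
sublocale \<nu>: prob_space \<nu> by (rule \<nu>)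
sublocale P: pair_prob_space \<mu> \<nu> ..

lemma sets_\<mu>: "sets \<mu> = sets borel" using \<mu> by (simp add: P4_def)

text \<open>When the square is expanded, the cross term vanishes because the noise is centred and
  independent, leaving the misfit \<open>g\<close> and the noise variance. The quadratic bound makes
  the square of \<open>g\<close> integrable.\<close>

lemma risk_formula:
  assumes [measurable]: "g \<in> borel_measurable borel" and bound: "\<And>x. \<bar>g x\<bar> \<le> c * (norm x)\<^sup>2"
  shows "(LINT (x, y)|J. k * (g x + (x \<bullet> \<beta>)\<^sup>2 - y)\<^sup>2) = k * (LINT x|\<mu>. (g x)\<^sup>2) + k * (LINT e|\<nu>. e\<^sup>2)"
proof -
  note [measurable_cong] = sets_\<mu> sets_\<nu>
  have m: "(\<lambda>(x, e). (x, (x \<bullet> \<beta>)\<^sup>2 + e)) \<in> \<mu> \<Otimes>\<^sub>M \<nu> \<rightarrow>\<^sub>M borel"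
    unfolding borel_prod[symmetric] by measurable
  have m2: "(\<lambda>(x, y). k * (g x + (x \<bullet> \<beta>)\<^sup>2 - y)\<^sup>2) \<in> borel_measurable borel"
    unfolding borel_prod[symmetric] by measurable
  have g2: "integrable \<mu> (\<lambda>x. (g x)\<^sup>2)"
  proof (rule P4_integrable[OF \<mu>])
    fix x
    have "\<bar>g x\<bar>\<^sup>2 \<le> (c * (norm x)\<^sup>2)\<^sup>2" using bound by (rule power_mono) simp
    then show "norm ((g x)\<^sup>2) \<le> c\<^sup>2 * norm x ^ 4" by (simp add: power_mult_distrib)
  qed measurable
  have sq: "(g x - e)\<^sup>2 = (g x)\<^sup>2 - 2 * g x * e + e\<^sup>2" for x e
    by (simp add: power2_eq_square algebra_simps)
  have inner_int: "integrable \<nu> (\<lambda>e. (g x - e)\<^sup>2)" for x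
    unfolding sq using int1 int2 by simp
  have inner: "(LINT e|\<nu>. (g x - e)\<^sup>2) = (g x)\<^sup>2 + (LINT e|\<nu>. e\<^sup>2)" for x
    unfolding sq using int1 int2 by (simp add: mean \<nu>.prob_space)
  have int: "integrable (\<mu> \<Otimes>\<^sub>M \<nu>) (\<lambda>(x, e). (g x - e)\<^sup>2)"
    using g2 inner_int by (intro P.Fubini_integrable) (auto simp: inner)
  have "(LINT (x, y)|J. k * (g x + (x \<bullet> \<beta>)\<^sup>2 - y)\<^sup>2) = (LINT z|(\<mu> \<Otimes>\<^sub>M \<nu>). k * (case z of (x, e) \<Rightarrow> (g x - e)\<^sup>2))"
    unfolding signal_law_def
    by (subst integral_distr[OF m m2], rule Bochner_Integration.integral_cong) auto
  also have "\<dots> = k * (LINT z|(\<mu> \<Otimes>\<^sub>M \<nu>). (case z of (x, e) \<Rightarrow> (g x - e)\<^sup>2))" by simp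
  also have "(LINT z|(\<mu> \<Otimes>\<^sub>M \<nu>). (case z of (x, e) \<Rightarrow> (g x - e)\<^sup>2)) = (LINT x|\<mu>. LINT e|\<nu>. (g x - e)\<^sup>2)"
    using P.integral_fst'[OF int] by simp
  also have "\<dots> = (LINT x|\<mu>. (g x)\<^sup>2) + (LINT e|\<nu>. e\<^sup>2)"
    unfolding inner using g2 by (simp add: \<mu>.prob_space)
  finally show ?thesis by (simp add: algebra_simps)
qed

lemma quad_diff_bound: "\<bar>x \<bullet> (M *v x) - (x \<bullet> \<beta>)\<^sup>2\<bar> \<le> (onorm ((*v) M) + (norm \<beta>)\<^sup>2) * (norm x)\<^sup>2"
proof -
  have "\<bar>x \<bullet> (M *v x)\<bar> \<le> norm x * norm (M *v x)" by (rule Cauchy_Schwarz_ineq2)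
  also have "\<dots> \<le> norm x * (onorm ((*v) M) * norm x)"
    by (intro mult_left_mono onorm) auto
  finally have 1: "\<bar>x \<bullet> (M *v x)\<bar> \<le> onorm ((*v) M) * (norm x)\<^sup>2" by (simp add: power2_eq_square mult_ac)
  have "\<bar>x \<bullet> \<beta>\<bar>\<^sup>2 \<le> (norm \<beta> * norm x)\<^sup>2" by (intro power_mono norm_inner_le) simp
  then have "\<bar>(x \<bullet> \<beta>)\<^sup>2\<bar> \<le> (norm \<beta>)\<^sup>2 * (norm x)\<^sup>2" by (simp add: power_mult_distrib)
  with 1 zero_le_power2[of "x \<bullet> \<beta>"] show ?thesis unfolding distrib_right by linarith
qed

lemma risk_lossA:
  "risk lossA J M = 1/2 * (LINT x|\<mu>. (x \<bullet> (M *v x) - (x \<bullet> \<beta>)\<^sup>2)\<^sup>2) + 1/2 * (LINT e|\<nu>. e\<^sup>2)"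
proof -
  have "(\<lambda>x. x \<bullet> (M *v x) - (x \<bullet> \<beta>)\<^sup>2) \<in> borel_measurable borel"
    by (intro borel_measurable_continuous_onI continuous_intros)
  from risk_formula[OF this quad_diff_bound, of "1/2"] show ?thesis
    unfolding risk_def lossA_def by simp
qed

section \<open>The risk along outer products and its derivatives\<close>

lemma quad_outer: "x \<bullet> (outer b *v x) = (x \<bullet> b)\<^sup>2"
  by (simp add: outer_eq_tensor tensor_mult_vec inner_commute power2_eq_square)

text \<open>The excess risk at parameter \<open>b\<close>, up to the factor 1/2 in problem (a) and
  1/8 in problem (b).\<close>

definition q4 :: "real^'d \<Rightarrow> real" where
  "q4 b = (LINT x|\<mu>. ((x \<bullet> b)\<^sup>2 - (x \<bullet> \<beta>)\<^sup>2)\<^sup>2)"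

lemma risk_lossA_outer: "risk lossA J (outer b) = 1/2 * q4 b + 1/2 * (LINT e|\<nu>. e\<^sup>2)"
  unfolding risk_lossA q4_def quad_outer ..

lemma risk_lossB: "risk lossB J b = 1/8 * q4 b + 1/8 * (LINT e|\<nu>. e\<^sup>2)"
proof -
  have 1: "(\<lambda>x. (x \<bullet> b)\<^sup>2 - (x \<bullet> \<beta>)\<^sup>2) \<in> borel_measurable borel" by measurable
  from risk_formula[OF this quad_diff_bound[of _ "outer b", unfolded quad_outer], of "1/8"] show ?thesis
    unfolding risk_def lossB_def q4_def by simp
qed

lemma q4_nonneg: "0 \<le> q4 b" and q4_\<beta>: "q4 \<beta> = 0"
  by (simp_all add: q4_def)

lemma q4_eq: "q4 b = m4 \<mu> b b b b - 2 * m4 \<mu> \<beta> \<beta> b b + m4 \<mu> \<beta> \<beta> \<beta> \<beta>"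
proof -
  have "((x \<bullet> b)\<^sup>2 - (x \<bullet> \<beta>)\<^sup>2)\<^sup>2 = (x \<bullet> b) * (x \<bullet> b) * (x \<bullet> b) * (x \<bullet> b)
      - 2 * ((x \<bullet> \<beta>) * (x \<bullet> \<beta>) * (x \<bullet> b) * (x \<bullet> b)) + (x \<bullet> \<beta>) * (x \<bullet> \<beta>) * (x \<bullet> \<beta>) * (x \<bullet> \<beta>)" for x
    by (simp add: power2_eq_square algebra_simps)
  then show ?thesis
    unfolding q4_def m4_def using inner_mom4(2)[OF \<mu>] by simp
qed

text \<open>A quarter of the gradient of \<open>q4\<close>, so in \<open>b\<close> the risks have
  gradients \<open>2 *\<^sub>R S b\<close> in problem (a) and \<open>(1/2) *\<^sub>R S b\<close> in
  problem (b).\<close>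

definition S :: "real^'d \<Rightarrow> real^'d" where
  "S b = (mom4 \<mu> b b - mom4 \<mu> \<beta> \<beta>) *v b"

definition DS :: "real^'d \<Rightarrow> real^'d \<Rightarrow> real^'d" where
  "DS b h = (mom4 \<mu> b h + mom4 \<mu> h b) *v b + (mom4 \<mu> b b - mom4 \<mu> \<beta> \<beta>) *v h"

lemmas mom4_deriv = bounded_bilinear.FDERIV[OF bounded_bilinear_mom4[OF \<mu>]]
lemmas mv_deriv = bounded_bilinear.FDERIV[OF bounded_bilinear_matrix_vector_mult]
lemmas mom4_cont = bounded_bilinear.continuous_on[OF bounded_bilinear_mom4[OF \<mu>]]
lemmas mv_cont = bounded_bilinear.continuous_on[OF bounded_bilinear_matrix_vector_mult]

lemma S_deriv: "(S has_derivative DS b) (at b)"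
  unfolding S_def[abs_def] DS_def[abs_def]
  by (auto intro!: derivative_eq_intros mv_deriv mom4_deriv simp: algebra_simps)

lemma S_\<beta>: "S \<beta> = 0" by (simp add: S_def)

lemma q4_deriv: "(q4 has_derivative (\<lambda>h. 4 * (S b \<bullet> h))) (at b)"
proof -
  have eq: "q4 = (\<lambda>b. b \<bullet> (mom4 \<mu> b b *v b) - 2 * (b \<bullet> (mom4 \<mu> \<beta> \<beta> *v b)) + m4 \<mu> \<beta> \<beta> \<beta> \<beta>)"
    by (rule ext) (simp add: q4_eq inner_mom4(1)[OF \<mu>])
  have "(q4 has_derivative (\<lambda>h. b \<bullet> (mom4 \<mu> b b *v h + (mom4 \<mu> b h + mom4 \<mu> h b) *v b) + h \<bullet> (mom4 \<mu> b b *v b)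
     - 2 * (b \<bullet> (mom4 \<mu> \<beta> \<beta> *v h) + h \<bullet> (mom4 \<mu> \<beta> \<beta> *v b)))) (at b)"
    unfolding eq by (auto intro!: derivative_eq_intros mv_deriv mom4_deriv)
  moreover have "b \<bullet> (mom4 \<mu> b b *v h + (mom4 \<mu> b h + mom4 \<mu> h b) *v b) + h \<bullet> (mom4 \<mu> b b *v b)
     - 2 * (b \<bullet> (mom4 \<mu> \<beta> \<beta> *v h) + h \<bullet> (mom4 \<mu> \<beta> \<beta> *v b)) = 4 * (S b \<bullet> h)" for h
  proof -
    have "S b \<bullet> h = m4 \<mu> b b h b - m4 \<mu> \<beta> \<beta> h b"
      by (simp add: S_def matrix_vector_mult_diff_rdistrib inner_diff_left inner_diff_right inner_commute[of _ h]
          inner_mom4(1)[OF \<mu>])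
    moreover have "m4 \<mu> b h b b = m4 \<mu> b b h b" "m4 \<mu> h b b b = m4 \<mu> b b h b" "m4 \<mu> b b b h = m4 \<mu> b b h b"
      "m4 \<mu> \<beta> \<beta> b h = m4 \<mu> \<beta> \<beta> h b"
      by (metis m4_perm)+
    ultimately show ?thesis
      by (simp add: inner_add_right matrix_vector_mult_add_rdistrib inner_mom4(1)[OF \<mu>])
  qed
  ultimately show ?thesis by simp
qed

text \<open>At \<open>\<beta>\<close> the difference of moment matrices cancels and only the
  derivative of the moment matrix survives. What remains is a Gram form, hence symmetric and
  semidefinite.\<close>

lemma DS_\<beta>: "DS \<beta> h \<bullet> k = 2 * m4 \<mu> \<beta> \<beta> h k"
proof -
  have "DS \<beta> h \<bullet> k = m4 \<mu> \<beta> h k \<beta> + m4 \<mu> h \<beta> k \<beta>"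
    by (simp add: DS_def matrix_vector_mult_add_rdistrib inner_add_left inner_add_right inner_commute[of _ k]
          inner_mom4(1)[OF \<mu>])
  moreover have "m4 \<mu> \<beta> h k \<beta> = m4 \<mu> \<beta> \<beta> h k" "m4 \<mu> h \<beta> k \<beta> = m4 \<mu> \<beta> \<beta> h k"
    by (metis m4_perm)+
  ultimately show ?thesis by simp
qed

lemma DS_lin: "DS b 0 = 0"
  using linear_0[OF bounded_linear.linear[OF has_derivative_bounded_linear[OF S_deriv]]] .

lemma DS_cont: "continuous_on UNIV (\<lambda>b. DS b h)"
  unfolding DS_def by (intro continuous_intros mv_cont mom4_cont)

section \<open>The form \<open>Q\<close> and the chart of problem (b)\<close>

definition Q :: "real^'d \<Rightarrow> real" where
  "Q u = (LINT x|\<mu>. (x \<bullet> \<beta>)\<^sup>2 * (x \<bullet> u)\<^sup>2)"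

lemma Q_eq: "Q u = m4 \<mu> \<beta> \<beta> u u"
  by (simp add: Q_def m4_def power2_eq_square mult_ac)

lemma Q_nonneg: "0 \<le> Q u"
  by (simp add: Q_def)

text \<open>Parametrisation and chart are the identity, and tilts range over the whole
  space.\<close>

sublocale B: tilt_chart UNIV "- {0}" "risk lossB J" \<beta> "- {0}" "\<lambda>b. b" "\<lambda>b h. h" "\<lambda>b. b" \<beta>
  "\<lambda>(v, b). (1/2) *\<^sub>R S b - v" "\<lambda>(v, b) (w, h). (1/2) *\<^sub>R DS b h - w"
proof
  fix v b :: "real^'d"
  have "((\<lambda>b. 1/8 * q4 b + 1/8 * (LINT e|\<nu>. e\<^sup>2) - v \<bullet> b) has_derivative (\<lambda>h. 1/8 * (4 * (S b \<bullet> h)) - v \<bullet> h)) (at b)"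
    by (auto intro!: derivative_eq_intros q4_deriv)
  then show "((\<lambda>b. risk lossB J b - v \<bullet> b) has_derivative (\<bullet>) (case (v, b) of (v, b) \<Rightarrow> (1/2) *\<^sub>R S b - v)) (at b)"
    unfolding risk_lossB by (rule has_derivative_eq_rhs) (simp add: fun_eq_iff inner_diff_left)
  have "((\<lambda>z. (1/2) *\<^sub>R S (snd z) - fst z) has_derivative (\<lambda>z. (1/2) *\<^sub>R DS b (snd z) - fst z)) (at (v, b))"
    by (intro has_derivative_diff has_derivative_scaleR_right has_derivative_fst has_derivative_ident
        has_derivative_compose[OF has_derivative_snd[OF has_derivative_ident], of S "DS b" "(v, b)", simplified] S_deriv)
  then show "((\<lambda>(v, b). (1/2) *\<^sub>R S b - v) has_derivative (case (v, b) of (v, b) \<Rightarrow> \<lambda>(w, h). (1/2) *\<^sub>R DS b h - w)) (at (v, b))"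
    by (simp add: case_prod_beta')
next
  fix k :: "(real^'d) \<times> (real^'d)"
  show "continuous_on (UNIV \<times> - {0}) (\<lambda>z. (case z of (v, b) \<Rightarrow> \<lambda>(w, h). (1/2) *\<^sub>R DS b h - w) k)"
    unfolding case_prod_beta'
    by (intro continuous_intros continuous_on_compose2[OF DS_cont]) auto
next
  show "\<exists>\<delta>>0. \<forall>\<theta>\<in>- {0} \<inter> ball \<beta> \<delta>. \<theta> = \<theta>" by (intro exI[of _ 1]) auto
  show "\<theta> \<in> - {0} \<Longrightarrow> risk lossB J \<beta> \<le> risk lossB J \<theta>" for \<theta>
    by (simp add: risk_lossB q4_\<beta> q4_nonneg)
qed (auto simp: \<beta> S_\<beta> DS_lin DS_\<beta> m4_perm(3)[of _ _ _ k h for k h] Q_eq[symmetric] Q_nonneg inner_diff_left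
      intro!: continuous_intros)

lemma hess_B: "B.hess h k = m4 \<mu> \<beta> \<beta> h k"
  by (simp add: B.hess_def DS_\<beta>)

section \<open>The chart of problem (a)\<close>

lemma tensor_deriv: "(outer has_derivative (\<lambda>h. tensor b h + tensor h b)) (at b)"
  unfolding outer_eq_tensor[abs_def]
  by (rule bounded_bilinear.FDERIV[OF bounded_bilinear_tensor]) (rule has_derivative_ident)+

text \<open>A local inverse of \<open>outer\<close>. Since \<open>outer b\<close> determines
  \<open>b\<close> only up to sign, the formula returns whichever of \<open>b\<close> and
  \<open>- b\<close> is on the side of \<open>\<beta>\<close>; it is smooth where the number under
  the root is positive, which includes \<open>outer \<beta>\<close>.\<close>

definition chartA :: "real^'d^'d \<Rightarrow> real^'d" where
  "chartA A = (1 / sqrt (\<beta> \<bullet> (A *v \<beta>))) *\<^sub>R (A *v \<beta>)"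

lemma chartA_outer:
  assumes "0 < \<beta> \<bullet> (outer b *v \<beta>)"
  shows "outer (chartA (outer b)) = outer b"
proof -
  have ne: "b \<bullet> \<beta> \<noteq> 0" using assms by (auto simp: quad_outer inner_commute)
  have "chartA (outer b) = ((b \<bullet> \<beta>) / \<bar>b \<bullet> \<beta>\<bar>) *\<^sub>R b"
    unfolding chartA_def quad_outer by (simp add: outer_eq_tensor tensor_mult_vec inner_commute)
  then show ?thesis
    using ne by (auto simp: outer_def vec_eq_iff abs_if)
qed

lemma chartA_\<beta>: "chartA (outer \<beta>) = \<beta>"
  using \<beta> by (simp add: chartA_def quad_outer) (simp add: outer_eq_tensor tensor_mult_vec)

lemma chartA_diff: "chartA differentiable (at (outer \<beta>))"
proof -
  have bl: "bounded_linear (\<lambda>A :: real^'d^'d. A *v \<beta>)"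
    by (rule bounded_bilinear.bounded_linear_left[OF bounded_bilinear_matrix_vector_mult])
  have d1: "(\<lambda>A :: real^'d^'d. A *v \<beta>) differentiable (at (outer \<beta>))"
    by (rule bounded_linear_imp_differentiable[OF bl])
  have "(\<lambda>A :: real^'d^'d. \<beta> \<bullet> (A *v \<beta>)) differentiable (at (outer \<beta>))"
    by (rule bounded_linear_imp_differentiable[OF bounded_linear_compose[OF bounded_linear_inner_right bl]])
  moreover have "(\<lambda>t. 1 / sqrt t) differentiable (at t)" if "t > 0" for t :: real
    unfolding real_differentiable_def using that
    by (intro exI) (auto intro!: derivative_eq_intros)
  then have "(\<lambda>t. 1 / sqrt t) differentiable (at (\<beta> \<bullet> (outer \<beta> *v \<beta>)))"
    using \<beta> by (simp add: quad_outer)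
  ultimately have "(\<lambda>A :: real^'d^'d. 1 / sqrt (\<beta> \<bullet> (A *v \<beta>))) differentiable (at (outer \<beta>))"
    using differentiable_chain_at by (force simp: o_def)
  then show ?thesis
    unfolding chartA_def[abs_def] by (intro differentiable_scaleR d1)
qed

text \<open>\<open>G\<close> is defined for all matrices \<open>V\<close> of the ambient type,
  symmetric or not; pairing \<open>V\<close> with the derivative of \<open>outer\<close> sees only
  \<open>V + transpose V\<close>.\<close>

sublocale A: tilt_chart sym_mats rank_one_psd "risk lossA J" "outer \<beta>" "- {0}" outer
  "\<lambda>b h. tensor b h + tensor h b" chartA \<beta>
  "\<lambda>(V, b). 2 *\<^sub>R S b - (V + transpose V) *v b"
  "\<lambda>(V, b) (W, h). 2 *\<^sub>R DS b h - ((W + transpose W) *v b + (V + transpose V) *v h)"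
proof
  show "subspace sym_mats" by (rule subspace_sym_mats)
  show "outer ` (- {0}) \<subseteq> rank_one_psd" using outer_rank_one_psd by auto
  show "(outer has_derivative (\<lambda>h. tensor b h + tensor h b)) (at b)" for b by (rule tensor_deriv)
  show "continuous_on (- {0}) (\<lambda>b. tensor b h + tensor h b)" for h
    by (intro continuous_intros bounded_bilinear.continuous_on[OF bounded_bilinear_tensor])
  show "tensor \<beta> h + tensor h \<beta> \<in> sym_mats" for h
    by (simp add: sym_mats_def transpose_def tensor_def vec_eq_iff mult.commute)
  show "h = 0" if "tensor \<beta> h + tensor h \<beta> = 0" for h
  proof -
    have "2 * (norm \<beta>)\<^sup>2 * (norm h)\<^sup>2 + 2 * (\<beta> \<bullet> h)\<^sup>2 = 0"
      using norm_sym_tensor[of \<beta> h] that by simp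
    then have "2 * (norm \<beta>)\<^sup>2 * (norm h)\<^sup>2 = 0"
      by (smt (verit) mult_nonneg_nonneg zero_le_power2)
    then show ?thesis using \<beta> by simp
  qed
  show "chartA differentiable at (outer \<beta>)" "chartA (outer \<beta>) = \<beta>"
    by (rule chartA_diff, rule chartA_\<beta>)
  show "\<exists>\<delta>>0. \<forall>\<theta>\<in>rank_one_psd \<inter> ball (outer \<beta>) \<delta>. outer (chartA \<theta>) = \<theta>"
  proof -
    \<comment> \<open>Near \<open>outer \<beta>\<close> the number under the root in
      \<open>chartA\<close> stays positive, and every feasible matrix is an outer product, so
      \<open>chartA_outer\<close> applies.\<close>
    have "open {A. 0 < \<beta> \<bullet> (A *v \<beta>)}"
      by (intro open_Collect_less continuous_intros mv_cont)
    moreover have "outer \<beta> \<in> {A. 0 < \<beta> \<bullet> (A *v \<beta>)}" using \<beta> by (simp add: quad_outer)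
    ultimately obtain \<delta> where \<delta>: "\<delta> > 0" "ball (outer \<beta>) \<delta> \<subseteq> {A. 0 < \<beta> \<bullet> (A *v \<beta>)}"
      using open_contains_ball by blast
    have "outer (chartA \<theta>) = \<theta>" if \<theta>: "\<theta> \<in> rank_one_psd \<inter> ball (outer \<beta>) \<delta>" for \<theta>
    proof -
      obtain b where b: "\<theta> = outer b" using rank_one_psd_outer[of \<theta>] \<theta> by blast
      show ?thesis unfolding b using \<delta>(2) \<theta> b by (intro chartA_outer) auto
    qed
    then show ?thesis using \<delta>(1) by blast
  qed
next
  fix V :: "real^'d^'d" and b :: "real^'d"
  have V: "V \<bullet> (tensor b h + tensor h b) = ((V + transpose V) *v b) \<bullet> h" for h
  proof -
    have "b \<bullet> (V *v h) = (transpose V *v b) \<bullet> h"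
      by (simp add: dot_lmul_matrix)
    then show ?thesis
      by (simp only: inner_add_right inner_tensor matrix_vector_mult_add_rdistrib inner_add_left
          inner_commute[of h] add.commute)
  qed
  have "((\<lambda>b. 1/2 * q4 b + 1/2 * (LINT e|\<nu>. e\<^sup>2) - V \<bullet> outer b) has_derivative
      (\<lambda>h. 1/2 * (4 * (S b \<bullet> h)) - V \<bullet> (tensor b h + tensor h b))) (at b)"
    by (rule derivative_eq_intros q4_deriv tensor_deriv refl | simp)+
  then show "((\<lambda>b. risk lossA J (outer b) - V \<bullet> outer b) has_derivative
      (\<bullet>) (case (V, b) of (V, b) \<Rightarrow> 2 *\<^sub>R S b - (V + transpose V) *v b)) (at b)"
    unfolding V risk_lossA_outer by (rule has_derivative_eq_rhs) (simp add: fun_eq_iff inner_diff_left)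
  have tr: "linear (transpose :: real^'d^'d \<Rightarrow> real^'d^'d)"
    by (rule linearI) (simp_all add: transpose_def vec_eq_iff)
  then have tb: "bounded_linear (transpose :: real^'d^'d \<Rightarrow> real^'d^'d)"
    by (simp add: linear_conv_bounded_linear)
  have "((\<lambda>z. 2 *\<^sub>R S (snd z) - (fst z + transpose (fst z)) *v snd z) has_derivative
     (\<lambda>z. 2 *\<^sub>R DS b (snd z) - ((V + transpose V) *v snd z + (fst z + transpose (fst z)) *v b))) (at (V, b))"
    using mv_deriv[OF has_derivative_add[OF has_derivative_fst[OF has_derivative_ident]
          bounded_linear.has_derivative[OF tb has_derivative_fst[OF has_derivative_ident]]]
          has_derivative_snd[OF has_derivative_ident], of "(V, b)" UNIV]
    by (intro has_derivative_diff has_derivative_scaleR_right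
        has_derivative_compose[OF has_derivative_snd[OF has_derivative_ident], of S "DS b" "(V, b)", simplified] S_deriv)
      simp
  then show "((\<lambda>(V, b). 2 *\<^sub>R S b - (V + transpose V) *v b) has_derivative
     (case (V, b) of (V, b) \<Rightarrow> \<lambda>(W, h). 2 *\<^sub>R DS b h - ((W + transpose W) *v b + (V + transpose V) *v h))) (at (V, b))"
    by (simp add: case_prod_beta' add.commute)
next
  fix k :: "(real^'d^'d) \<times> (real^'d)"
  have tr: "continuous_on UNIV (transpose :: real^'d^'d \<Rightarrow> real^'d^'d)"
    by (intro linear_continuous_on) (simp add: linear_conv_bounded_linear[symmetric] linear_iff transpose_def vec_eq_iff)
  show "continuous_on (UNIV \<times> - {0}) (\<lambda>z. (case z of (V, b) \<Rightarrow>
      \<lambda>(W, h). 2 *\<^sub>R DS b h - ((W + transpose W) *v b + (V + transpose V) *v h)) k)"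
    unfolding case_prod_beta'
    by (intro continuous_intros mv_cont continuous_on_compose2[OF DS_cont] continuous_on_compose2[OF tr]) auto
next
  fix W :: "real^'d^'d" and k :: "real^'d"
  have "\<beta> \<bullet> (W *v k) = (transpose W *v \<beta>) \<bullet> k" by (simp add: dot_lmul_matrix)
  then have "W \<bullet> (tensor \<beta> k + tensor k \<beta>) = ((W + transpose W) *v \<beta>) \<bullet> k"
    by (simp only: inner_add_right inner_tensor matrix_vector_mult_add_rdistrib inner_add_left
        inner_commute[of k] add.commute)
  then show "(case (0, \<beta>) of (V, b) \<Rightarrow> \<lambda>(W, h). 2 *\<^sub>R DS b h - ((W + transpose W) *v b + (V + transpose V) *v h)) (W, 0) \<bullet> k
     = - (W \<bullet> (tensor \<beta> k + tensor k \<beta>))"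
    by (simp add: DS_lin)
next
  \<comment> \<open>At \<open>outer \<beta>\<close> the misfit is 0 and only the noise term is
    left.\<close>
  show "\<theta> \<in> rank_one_psd \<Longrightarrow> risk lossA J (outer \<beta>) \<le> risk lossA J \<theta>" for \<theta>
    by (simp add: risk_lossA quad_outer)
next
  have t0: "transpose 0 = (0 :: real^'d^'d)" by (simp add: transpose_def vec_eq_iff)
  fix h k :: "real^'d"
  show "(case (0, \<beta>) of (V, b) \<Rightarrow> \<lambda>(W, h). 2 *\<^sub>R DS b h - ((W + transpose W) *v b + (V + transpose V) *v h)) (0, h) \<bullet> k
     = (case (0, \<beta>) of (V, b) \<Rightarrow> \<lambda>(W, h). 2 *\<^sub>R DS b h - ((W + transpose W) *v b + (V + transpose V) *v h)) (0, k) \<bullet> h"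
    by (simp add: t0 DS_\<beta> m4_perm(3)[of _ _ _ h k])
  show "0 \<le> (case (0, \<beta>) of (V, b) \<Rightarrow> \<lambda>(W, h). 2 *\<^sub>R DS b h - ((W + transpose W) *v b + (V + transpose V) *v h)) (0, h) \<bullet> h"
    by (simp add: t0 DS_\<beta> Q_eq[symmetric] Q_nonneg)
  show "(case (0, \<beta>) of (V, b) \<Rightarrow> 2 *\<^sub>R S b - (V + transpose V) *v b) = 0"
    by (simp add: t0 S_\<beta>)
qed (use \<beta> in auto)

lemma hess_A: "A.hess h k = 4 * m4 \<mu> \<beta> \<beta> h k"
proof -
  have "transpose 0 = (0 :: real^'d^'d)" by (simp add: transpose_def vec_eq_iff)
  then show ?thesis by (simp add: A.hess_def DS_\<beta>)
qed

section \<open>Tilt-stability and REG in terms of \<open>Q\<close>\<close>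

theorem tilt_stable_A_iff: "tilt_stable sym_mats rank_one_psd (risk lossA J) (outer \<beta>) \<longleftrightarrow> (\<forall>u. u \<noteq> 0 \<longrightarrow> 0 < Q u)"
  unfolding A.tilt_stable_iff_pos hess_A Q_eq by simp

theorem tilt_stable_B_iff: "tilt_stable UNIV (- {0}) (risk lossB J) \<beta> \<longleftrightarrow> (\<forall>u. u \<noteq> 0 \<longrightarrow> 0 < Q u)"
  unfolding B.tilt_stable_iff_pos hess_B Q_eq by simp

text \<open>The derivative of the parametrisation is the identity and the Hessian form is
  \<open>Q\<close>, so REG is the reciprocal of the smallest value of \<open>Q\<close> on unit
  vectors; \<open>c\<close> bounds that value from below, \<open>C\<close> from above.\<close>

theorem REG_B_bounds:
  assumes pos: "\<And>u. u \<noteq> 0 \<Longrightarrow> 0 < Q u" and c: "0 < c" "\<And>u. c * (norm u)\<^sup>2 \<le> Q u"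
    and u: "norm u = 1" "Q u \<le> C"
  obtains g where "REG_B \<beta> J = ereal g" "1 / C \<le> g" "g \<le> 1 / c"
proof (rule B.REG_bounds[where \<kappa> = "1 / c" and \<kappa>' = "1 / C" and u = u])
  have C: "0 < C" using pos[of u] u by fastforce
  show "0 < B.hess h h" if "h \<noteq> 0" for h using pos[OF that] by (simp add: hess_B Q_eq)
  show "(norm h)\<^sup>2 \<le> 1 / c * B.hess h h" for h
    using c(2)[of h] c(1) by (simp add: hess_B Q_eq field_simps)
  show "u \<noteq> 0" using u by auto
  show "1 / C * B.hess u u \<le> (norm u)\<^sup>2" using u C by (simp add: hess_B Q_eq)
qed (use that in \<open>auto simp: REG_B_def\<close>)

text \<open>Now the Hessian form is \<open>4 * Q\<close>. In \<open>norm_sym_tensor\<close>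
  Cauchy-Schwarz gives an upper estimate with factor 4, and dropping the squared inner product gives
  a lower one with factor 2, whence 1 and 1/2 in the bounds.\<close>

theorem REG_A_bounds:
  assumes pos: "\<And>u. u \<noteq> 0 \<Longrightarrow> 0 < Q u" and c: "0 < c" "\<And>u. c * (norm u)\<^sup>2 \<le> Q u"
    and u: "norm u = 1" "Q u \<le> C"
  obtains g where "REG_A \<beta> J = ereal g" "1/2 * (norm \<beta>)\<^sup>2 / C \<le> g" "g \<le> (norm \<beta>)\<^sup>2 / c"
proof (rule A.REG_bounds[where \<kappa> = "(norm \<beta>)\<^sup>2 / c" and \<kappa>' = "1/2 * (norm \<beta>)\<^sup>2 / C" and u = u])
  have C: "0 < C" using pos[of u] u by fastforce
  show "0 < A.hess h h" if "h \<noteq> 0" for h using pos[OF that] by (simp add: hess_A Q_eq)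
  show "(norm (tensor \<beta> h + tensor h \<beta>))\<^sup>2 \<le> (norm \<beta>)\<^sup>2 / c * A.hess h h" for h
  proof -
    have "(\<beta> \<bullet> h)\<^sup>2 \<le> (norm \<beta>)\<^sup>2 * (norm h)\<^sup>2"
      using Cauchy_Schwarz_ineq[of \<beta> h] by (simp add: power2_norm_eq_inner)
    then have "(norm (tensor \<beta> h + tensor h \<beta>))\<^sup>2 \<le> 4 * (norm \<beta>)\<^sup>2 * (norm h)\<^sup>2"
      unfolding norm_sym_tensor by simp
    also have "\<dots> \<le> 4 * (norm \<beta>)\<^sup>2 * (Q h / c)"
      using c by (intro mult_left_mono) (auto simp: field_simps)
    finally show ?thesis by (simp add: hess_A Q_eq mult_ac)
  qed
  show "u \<noteq> 0" using u by auto
  have "1/2 * (norm \<beta>)\<^sup>2 / C * A.hess u u = 2 * (norm \<beta>)\<^sup>2 * (Q u / C)" by (simp add: hess_A Q_eq)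
  also have "\<dots> \<le> 2 * (norm \<beta>)\<^sup>2 * 1" using u C by (intro mult_left_mono) auto
  finally show "1/2 * (norm \<beta>)\<^sup>2 / C * A.hess u u \<le> (norm (tensor \<beta> u + tensor u \<beta>))\<^sup>2"
    unfolding norm_sym_tensor using u by (simp add: add_increasing2)
qed (use that in \<open>auto simp: REG_A_def\<close>)

end

section \<open>Distance to the degenerate laws\<close>

lemma sym_mats_inner:
  assumes "A \<in> sym_mats" shows "(A *v x) \<bullet> y = x \<bullet> (A *v y)"
  using assms dot_lmul_matrix[of x A y] unfolding sym_mats_def
  by (metis (mono_tags) mem_Collect_eq transpose_matrix_vector)

lemma psd_mats_cauchy_schwarz:
  assumes "A \<in> psd_mats"
  shows "((A *v x) \<bullet> y)\<^sup>2 \<le> ((A *v x) \<bullet> x) * ((A *v y) \<bullet> y)"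
proof (rule psd_form_cauchy_schwarz)
  have A: "A \<in> sym_mats" "\<And>u. 0 \<le> u \<bullet> (A *v u)" using assms by (auto simp: psd_mats_def)
  show "linear (\<lambda>y. (A *v x) \<bullet> y)" for x
    by (intro bounded_linear.linear bounded_linear_inner_right)
  show "(A *v x) \<bullet> y = (A *v y) \<bullet> x" for x y
    by (simp only: sym_mats_inner[OF A(1), of x y] inner_commute[of x])
  show "0 \<le> (A *v x) \<bullet> x" for x using A(2) by (simp add: inner_commute)
qed

text \<open>\<open>u\<close> minimises the Rayleigh quotient on the unit sphere, with value
  \<open>l\<close>. The form of \<open>A\<close> minus \<open>l\<close> times the identity is then
  semidefinite and vanishes at \<open>u\<close>, so by Cauchy-Schwarz it vanishes for
  \<open>u\<close> against every \<open>w\<close>: \<open>u\<close> is an eigenvector. By the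
  Rayleigh bound no eigenvalue lies below \<open>l\<close>.\<close>

lemma lambda_min_eigenvector:
  fixes A :: "real^'d^'d"
  assumes A: "A \<in> sym_mats"
  obtains u where "norm u = 1" "A *v u = lambda_min A *\<^sub>R u"
    "\<And>w. lambda_min A * (norm w)\<^sup>2 \<le> (A *v w) \<bullet> w"
proof -
  have cont: "continuous_on (sphere 0 1) (\<lambda>w :: real^'d. (A *v w) \<bullet> w)"
    by (intro continuous_intros)
  have "axis undefined 1 \<in> sphere (0 :: real^'d) 1" by simp
  then obtain u :: "real^'d" where u: "u \<in> sphere 0 1"
    "\<And>w. w \<in> sphere 0 1 \<Longrightarrow> (A *v u) \<bullet> u \<le> (A *v w) \<bullet> w"
    using continuous_attains_inf[OF compact_sphere _ cont] by blast
  define l where "l = (A *v u) \<bullet> u"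
  have nu: "norm u = 1" using u(1) by simp
  have rayleigh: "l * (norm w)\<^sup>2 \<le> (A *v w) \<bullet> w" for w
  proof (cases "w = 0")
    case False
    let ?w = "w /\<^sub>R norm w"
    have "l \<le> (A *v ?w) \<bullet> ?w" unfolding l_def using False by (intro u(2)) simp
    then have "(norm w)\<^sup>2 * l \<le> (norm w)\<^sup>2 * ((A *v ?w) \<bullet> ?w)"
      by (rule mult_left_mono) simp
    also have "\<dots> = (A *v w) \<bullet> w"
      using False by (simp add: matrix_vector_mult_scaleR power2_eq_square field_simps)
    finally show ?thesis by (simp add: mult.commute)
  qed simp
  have Au: "A *v u = l *\<^sub>R u"
  proof -
    define B where "B x y = (A *v x) \<bullet> y - l * (x \<bullet> y)" for x y
    have "(B u w)\<^sup>2 \<le> B u u * B w w" for w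
    proof (rule psd_form_cauchy_schwarz)
      show "linear (B x)" for x
        by (rule linearI) (simp_all add: B_def inner_add_right algebra_simps)
      show "B x y = B y x" for x y
        unfolding B_def by (simp only: sym_mats_inner[OF A, of x y] inner_commute[of x])
      show "0 \<le> B x x" for x
        using rayleigh[of x] by (simp add: B_def power2_norm_eq_inner)
    qed
    moreover have "B u u = 0" using nu by (simp add: B_def l_def power2_norm_eq_inner[symmetric])
    ultimately have "B u w = 0" for w by simp
    then have "(A *v u - l *\<^sub>R u) \<bullet> w = 0" for w by (simp add: B_def inner_diff_left)
    then have "A *v u - l *\<^sub>R u = 0" by (metis inner_eq_zero_iff)
    then show ?thesis by simp
  qed
  have "lambda_min A = l"
    unfolding lambda_min_def
  proof (rule Least_equality)
    show "\<exists>u. u \<noteq> 0 \<and> A *v u = l *\<^sub>R u" using Au nu by (intro exI[of _ u]) auto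
    fix y assume "\<exists>w. w \<noteq> 0 \<and> A *v w = y *\<^sub>R w"
    then obtain w where w: "w \<noteq> 0" "A *v w = y *\<^sub>R w" by blast
    then have "l * (norm w)\<^sup>2 \<le> y * (norm w)\<^sup>2"
      using rayleigh[of w] by (simp add: power2_norm_eq_inner)
    then show "l \<le> y" using w(1) by simp
  qed
  then show ?thesis using that nu Au rayleigh by metis
qed

section \<open>Couplings and Wasserstein estimates\<close>

lemma borel_measurable_fst_snd [measurable]:
  "(fst :: 'a::topological_space \<times> 'b::topological_space \<Rightarrow> 'a) \<in> borel \<rightarrow>\<^sub>M borel"
  "(snd :: 'a \<times> 'b \<Rightarrow> 'b) \<in> borel \<rightarrow>\<^sub>M borel"
  by (intro borel_measurable_continuous_onI continuous_intros)+

lemma P4_integrable_norm_square: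
  assumes "\<mu> \<in> P4" shows "integrable \<mu> (\<lambda>x. (norm x)\<^sup>2)"
proof (rule Bochner_Integration.integrable_bound[of \<mu> "\<lambda>x. 1 + norm x ^ 4"])
  interpret prob_space \<mu> using assms by (simp add: P4_def)
  have [measurable_cong]: "sets \<mu> = sets borel" using assms by (simp add: P4_def)
  show "integrable \<mu> (\<lambda>x. 1 + norm x ^ 4)" using assms by (simp add: P4_def)
  show "(\<lambda>x. (norm x)\<^sup>2) \<in> borel_measurable \<mu>" by measurable
  have "(norm x)\<^sup>2 \<le> 1 + norm x ^ 4" for x :: "real^'a"
  proof -
    have "2 * (norm x)\<^sup>2 \<le> 1 + norm x ^ 4" using sum_squares_bound[of 1 "(norm x)\<^sup>2"] by simp
    moreover have "0 \<le> (norm x)\<^sup>2" by simp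
    ultimately show ?thesis by linarith
  qed
  then show "AE x in \<mu>. norm ((norm x)\<^sup>2) \<le> norm (1 + norm x ^ 4)" by simp
qed

lemma P4_distr_nonexpansive:
  assumes \<mu>: "\<mu> \<in> P4" and [measurable]: "p \<in> borel_measurable borel" and p: "\<And>x. norm (p x) \<le> norm x"
  shows "distr \<mu> borel p \<in> P4"
proof -
  interpret prob_space \<mu> using \<mu> by (simp add: P4_def)
  have [measurable_cong]: "sets \<mu> = sets borel" using \<mu> by (simp add: P4_def)
  have "integrable \<mu> (\<lambda>x. norm (p x) ^ 4)"
    by (rule P4_integrable[OF \<mu>, of _ 1]) (auto intro!: power_mono p)
  then show ?thesis
    by (auto simp: P4_def integrable_distr_eq intro!: prob_space_distr)
qed

text \<open>Lower bounds pass to the real infimum defining \<open>W2\<close> only over a nonempty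
  set.\<close>

lemma couplings_nonempty:
  assumes "prob_space \<mu>" "sets \<mu> = sets borel" "prob_space \<nu>" "sets \<nu> = sets borel"
  shows "\<mu> \<Otimes>\<^sub>M \<nu> \<in> couplings \<mu> \<nu>"
proof -
  interpret \<mu>: prob_space \<mu> by fact
  interpret \<nu>: prob_space \<nu> by fact
  interpret P: pair_prob_space \<mu> \<nu> ..
  have sets: "sets (\<mu> \<Otimes>\<^sub>M \<nu>) = sets borel"
    by (simp add: borel_prod[symmetric] assms cong: sets_pair_measure_cong)
  have "distr (\<mu> \<Otimes>\<^sub>M \<nu>) borel fst = distr (\<mu> \<Otimes>\<^sub>M \<nu>) \<mu> fst" by (rule distr_cong) (simp_all add: assms)
  moreover have "distr (\<mu> \<Otimes>\<^sub>M \<nu>) borel snd = distr (\<mu> \<Otimes>\<^sub>M \<nu>) \<nu> snd" by (rule distr_cong) (simp_all add: assms)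
  moreover have "distr (\<mu> \<Otimes>\<^sub>M \<nu>) \<nu> snd = \<nu>"
  proof (rule measure_eqI)
    fix A assume "A \<in> sets (distr (\<mu> \<Otimes>\<^sub>M \<nu>) \<nu> snd)"
    then have A: "A \<in> sets \<nu>" by simp
    then have "snd -` A \<inter> space (\<mu> \<Otimes>\<^sub>M \<nu>) = space \<mu> \<times> A"
      using sets.sets_into_space[OF A] by (auto simp: space_pair_measure)
    then show "emeasure (distr (\<mu> \<Otimes>\<^sub>M \<nu>) \<nu> snd) A = emeasure \<nu> A"
      using A by (simp add: emeasure_distr \<nu>.emeasure_pair_measure_Times \<mu>.emeasure_space_1)
  qed simp
  moreover have "distr (\<mu> \<Otimes>\<^sub>M \<nu>) \<mu> fst = \<mu>" by (rule \<nu>.distr_pair_fst)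
  ultimately show ?thesis using sets P.prob_space_axioms by (simp add: couplings_def)
qed

lemma W2_le:
  assumes "\<pi> \<in> couplings \<mu> \<nu>" shows "W2 \<mu> \<nu> \<le> sqrt (LINT z|\<pi>. (norm (fst z - snd z))\<^sup>2)"
  unfolding W2_def using assms
  by (intro cINF_lower bdd_belowI2[of _ 0]) (auto intro!: Bochner_Integration.integral_nonneg)

text \<open>The coupling \<open>(x, p x)\<close> displaces \<open>x\<close> by
  \<open>(x \<bullet> u) *\<^sub>R u\<close>, of length
  \<open>\<bar>x \<bullet> u\<bar>\<close>.\<close>

lemma W2_projection_le:
  fixes \<mu> :: "(real^'d) measure"
  assumes \<mu>: "\<mu> \<in> P4" and u: "norm u = 1"
  shows "W2 \<mu> (distr \<mu> borel (\<lambda>x. x - (x \<bullet> u) *\<^sub>R u)) \<le> sqrt (LINT x|\<mu>. (x \<bullet> u)\<^sup>2)"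
proof -
  interpret prob_space \<mu> using \<mu> by (simp add: P4_def)
  have sets [measurable_cong]: "sets \<mu> = sets borel" using \<mu> by (simp add: P4_def)
  define p where "p x = x - (x \<bullet> u) *\<^sub>R u" for x
  have [measurable]: "p \<in> borel_measurable borel" unfolding p_def by measurable
  have pm [measurable]: "(\<lambda>x. (x, p x)) \<in> \<mu> \<rightarrow>\<^sub>M borel" unfolding borel_prod[symmetric] by measurable
  define \<pi> where "\<pi> = distr \<mu> borel (\<lambda>x. (x, p x))"
  have "distr \<pi> borel fst = distr \<mu> borel (\<lambda>x. x)"
    unfolding \<pi>_def by (subst distr_distr) (auto simp: comp_def)
  also have "\<dots> = \<mu>" by (rule distr_id2) (simp add: sets)
  finally have "distr \<pi> borel fst = \<mu>" .
  moreover have "distr \<pi> borel snd = distr \<mu> borel p"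
    unfolding \<pi>_def by (subst distr_distr) (auto simp: comp_def)
  moreover have "prob_space \<pi>" unfolding \<pi>_def by (rule prob_space_distr) measurable
  ultimately have "\<pi> \<in> couplings \<mu> (distr \<mu> borel p)" by (simp add: couplings_def \<pi>_def)
  from W2_le[OF this] have "W2 \<mu> (distr \<mu> borel p) \<le> sqrt (LINT z|\<pi>. (norm (fst z - snd z))\<^sup>2)" .
  also have "(LINT z|\<pi>. (norm (fst z - snd z))\<^sup>2) = (LINT x|\<mu>. (x \<bullet> u)\<^sup>2)"
    unfolding \<pi>_def by (subst integral_distr) (auto simp: p_def u)
  finally show ?thesis by (simp add: p_def[abs_def])
qed

text \<open>\<open>\<bar>x \<bullet> a\<bar>\<close> is the distance from \<open>x\<close> to the
  hyperplane with unit normal \<open>a\<close>. Under any coupling the second point almost surely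
  lies on one of the two hyperplanes, so the pointwise cost is at least the smaller squared
  distance.\<close>

lemma W2_ge_min_inner:
  fixes \<mu> \<nu> :: "(real^'d) measure"
  assumes \<mu>: "\<mu> \<in> P4" and \<nu>: "\<nu> \<in> P4" and ab: "norm a = 1" "norm b = 1"
    and AE: "AE y in \<nu>. y \<bullet> a = 0 \<or> y \<bullet> b = 0"
  shows "sqrt (LINT x|\<mu>. min ((x \<bullet> a)\<^sup>2) ((x \<bullet> b)\<^sup>2)) \<le> W2 \<mu> \<nu>"
  unfolding W2_def
proof (rule cINF_greatest)
  show "couplings \<mu> \<nu> \<noteq> {}"
    using couplings_nonempty[of \<mu> \<nu>] \<mu> \<nu> by (auto simp: P4_def)
  fix \<pi> assume \<pi>: "\<pi> \<in> couplings \<mu> \<nu>"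
  then have [measurable_cong]: "sets \<pi> = sets borel" by (simp add: couplings_def)
  have fst: "distr \<pi> borel fst = \<mu>" and snd: "distr \<pi> borel snd = \<nu>" using \<pi> by (auto simp: couplings_def)
  have "integrable \<pi> (\<lambda>z. (norm (fst z))\<^sup>2)"
    using P4_integrable_norm_square[OF \<mu>] unfolding fst[symmetric] by (subst (asm) integrable_distr_eq) auto
  moreover have "integrable \<pi> (\<lambda>z. (norm (snd z))\<^sup>2)"
    using P4_integrable_norm_square[OF \<nu>] unfolding snd[symmetric] by (subst (asm) integrable_distr_eq) auto
  ultimately have "integrable \<pi> (\<lambda>z. 2 * (norm (fst z))\<^sup>2 + 2 * (norm (snd z))\<^sup>2)" by simp
  \<comment> \<open>Without integrability the Bochner integral of the cost would default to 0 and
    could not be bounded below.\<close>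
  then have int: "integrable \<pi> (\<lambda>z. (norm (fst z - snd z))\<^sup>2)"
  proof (rule Bochner_Integration.integrable_bound)
    have "(norm (x - y))\<^sup>2 \<le> 2 * (norm x)\<^sup>2 + 2 * (norm y)\<^sup>2" for x y :: "real^'d"
    proof -
      have "(norm (x - y))\<^sup>2 \<le> (norm x + norm y)\<^sup>2" by (intro power_mono norm_triangle_ineq4) simp
      also have "\<dots> \<le> 2 * (norm x)\<^sup>2 + 2 * (norm y)\<^sup>2"
        using sum_squares_bound[of "norm x" "norm y"] by (simp add: power2_sum)
      finally show ?thesis .
    qed
    then show "AE z in \<pi>. norm ((norm (fst z - snd z))\<^sup>2) \<le> norm (2 * (norm (fst z))\<^sup>2 + 2 * (norm (snd z))\<^sup>2)"
      by simp
  qed measurable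
  have "integrable \<mu> (\<lambda>x. min ((x \<bullet> a)\<^sup>2) ((x \<bullet> b)\<^sup>2))"
  proof (rule Bochner_Integration.integrable_bound[OF P4_integrable_norm_square[OF \<mu>]])
    have [measurable_cong]: "sets \<mu> = sets borel" using \<mu> by (simp add: P4_def)
    show "(\<lambda>x. min ((x \<bullet> a)\<^sup>2) ((x \<bullet> b)\<^sup>2)) \<in> borel_measurable \<mu>" by measurable
    have "(x \<bullet> a)\<^sup>2 \<le> (norm x)\<^sup>2" for x
      using norm_inner_le[of x a] ab by (simp add: abs_le_square_iff[symmetric])
    then show "AE x in \<mu>. norm (min ((x \<bullet> a)\<^sup>2) ((x \<bullet> b)\<^sup>2)) \<le> norm ((norm x)\<^sup>2)"
      by (auto simp: min_le_iff_disj)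
  qed
  then have int_min: "integrable \<pi> (\<lambda>z. min ((fst z \<bullet> a)\<^sup>2) ((fst z \<bullet> b)\<^sup>2))"
    unfolding fst[symmetric] by (subst (asm) integrable_distr_eq) auto
  have "(LINT x|\<mu>. min ((x \<bullet> a)\<^sup>2) ((x \<bullet> b)\<^sup>2)) = (LINT z|\<pi>. min ((fst z \<bullet> a)\<^sup>2) ((fst z \<bullet> b)\<^sup>2))"
    unfolding fst[symmetric] by (subst integral_distr) auto
  also have "\<dots> \<le> (LINT z|\<pi>. (norm (fst z - snd z))\<^sup>2)"
  proof (rule integral_mono_AE[OF int_min int])
    have "AE z in \<pi>. snd z \<bullet> a = 0 \<or> snd z \<bullet> b = 0"
      using AE unfolding snd[symmetric] by (subst (asm) AE_distr_iff) auto
    then show "AE z in \<pi>. min ((fst z \<bullet> a)\<^sup>2) ((fst z \<bullet> b)\<^sup>2) \<le> (norm (fst z - snd z))\<^sup>2"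
    proof eventually_elim
      case (elim z)
      have "(fst z \<bullet> c)\<^sup>2 \<le> (norm (fst z - snd z))\<^sup>2" if "snd z \<bullet> c = 0" "norm c = 1" for c
      proof -
        have "\<bar>fst z \<bullet> c\<bar> = \<bar>(fst z - snd z) \<bullet> c\<bar>" using that by (simp add: inner_diff_left)
        also have "\<dots> \<le> norm (fst z - snd z)" using norm_inner_le[of "fst z - snd z" c] that by simp
        finally show ?thesis by (simp add: abs_le_square_iff[symmetric])
      qed
      with elim ab show ?case by (auto simp: min_le_iff_disj)
    qed
  qed
  finally show "sqrt (LINT x|\<mu>. min ((x \<bullet> a)\<^sup>2) ((x \<bullet> b)\<^sup>2)) \<le> sqrt (LINT z|\<pi>. (norm (fst z - snd z))\<^sup>2)"
    by simp
qed

section \<open>The degenerate laws and their distance from a Gaussian\<close>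

definition degenerate :: "real^'d \<Rightarrow> (real^'d) measure set" where
  "degenerate \<beta> = {\<mu> \<in> P4. \<exists>u. u \<noteq> 0 \<and> (LINT x|\<mu>. (x \<bullet> \<beta>)\<^sup>2 * (x \<bullet> u)\<^sup>2) = 0}"

text \<open>For every \<open>\<mu>\<close> in \<open>P4\<close>, tilt-stability in either problem
  means that \<open>Q\<close> is positive off 0; as \<open>Q\<close> is never negative, it fails
  exactly when \<open>Q u = 0\<close> for some nonzero \<open>u\<close>.\<close>

lemma exceptional_sets_eq_degenerate:
  assumes \<beta>: "\<beta> \<noteq> 0" and \<nu>: "prob_space \<nu>" "sets \<nu> = sets borel"
    "integrable \<nu> (\<lambda>e. e)" "(LINT e|\<nu>. e) = 0" "integrable \<nu> (\<lambda>e. e\<^sup>2)"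
  shows "excA \<beta> (pr_response \<beta> \<nu>) = degenerate \<beta>" "excB \<beta> (pr_response \<beta> \<nu>) = degenerate \<beta>"
proof -
  have iff: "\<not> tilt_stable sym_mats rank_one_psd (risk lossA (joint_law \<mu> (pr_response \<beta> \<nu>))) (outer \<beta>)
        \<longleftrightarrow> \<mu> \<in> degenerate \<beta>"
      "\<not> tilt_stable UNIV (- {0}) (risk lossB (joint_law \<mu> (pr_response \<beta> \<nu>))) \<beta> \<longleftrightarrow> \<mu> \<in> degenerate \<beta>"
    if \<mu>: "\<mu> \<in> P4" for \<mu>
  proof -
    interpret phase_retrieval \<mu> \<beta> \<nu>
      by (rule phase_retrieval.intro[OF \<mu> \<beta> \<nu>])
    have J: "joint_law \<mu> (pr_response \<beta> \<nu>) = J"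
      by (rule joint_law_pr_response[OF \<mu>.prob_space_axioms sets_\<mu> assms(2,3)])
    have deg: "\<mu> \<in> degenerate \<beta> \<longleftrightarrow> \<not> (\<forall>u. u \<noteq> 0 \<longrightarrow> 0 < Q u)"
      using \<mu> Q_nonneg by (auto simp: degenerate_def Q_def[symmetric] not_less order_antisym)
    show "\<not> tilt_stable sym_mats rank_one_psd (risk lossA (joint_law \<mu> (pr_response \<beta> \<nu>))) (outer \<beta>)
        \<longleftrightarrow> \<mu> \<in> degenerate \<beta>"
      unfolding J deg tilt_stable_A_iff ..
    show "\<not> tilt_stable UNIV (- {0}) (risk lossB (joint_law \<mu> (pr_response \<beta> \<nu>))) \<beta> \<longleftrightarrow> \<mu> \<in> degenerate \<beta>"
      unfolding J deg tilt_stable_B_iff ..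
  qed
  have "degenerate \<beta> \<subseteq> P4" by (auto simp: degenerate_def)
  then show "excA \<beta> (pr_response \<beta> \<nu>) = degenerate \<beta>" "excB \<beta> (pr_response \<beta> \<nu>) = degenerate \<beta>"
    using iff unfolding excA_def excB_def exceptional_set_def by blast+
qed

lemma W2_set_degenerate_bounds:
  fixes \<mu> :: "(real^'d) measure"
  assumes S: "S \<in> psd_mats" and g: "centered_gaussian S \<mu>" and \<beta>: "\<beta> \<noteq> 0"
  obtains r where "W2_set \<mu> (degenerate \<beta>) = ereal r"
    "sqrt ((1 - 2 / pi) * lambda_min S) \<le> r" "r \<le> sqrt (lambda_min S)"
proof -
  define l where "l = lambda_min S"
  obtain u where u: "norm u = 1" "S *v u = l *\<^sub>R u" "\<And>w. l * (norm w)\<^sup>2 \<le> (S *v w) \<bullet> w"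
    using lambda_min_eigenvector[of S] S unfolding psd_mats_def l_def by blast
  have l0: "0 \<le> l"
    using S u(1,2) unfolding psd_mats_def by (auto simp: power2_norm_eq_inner[symmetric] dest: spec[of _ u])
  have \<mu>: "\<mu> \<in> P4" by (rule centered_gaussian_P4[OF g])
  \<comment> \<open>Projecting along a lowest eigenvector \<open>u\<close> lands on the hyperplane
    orthogonal to \<open>u\<close>, at mean squared cost
    \<open>(S *v u) \<bullet> u = l\<close>.\<close>
  have up: "W2_set \<mu> (degenerate \<beta>) \<le> ereal (sqrt l)"
  proof -
    define p where "p x = x - (x \<bullet> u) *\<^sub>R u" for x
    have [measurable]: "p \<in> borel_measurable borel" unfolding p_def by measurable
    have [measurable_cong]: "sets \<mu> = sets borel" using \<mu> by (simp add: P4_def)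
    have pu: "p x \<bullet> u = 0" for x
      using u(1) by (simp add: p_def inner_diff_left power2_norm_eq_inner[symmetric] norm_eq_1)
    have "norm (p x) \<le> norm x" for x
    proof -
      have "(norm (p x))\<^sup>2 = p x \<bullet> x - (x \<bullet> u) * (p x \<bullet> u)"
        unfolding power2_norm_eq_inner by (subst (2) p_def) (simp add: inner_diff_right)
      also have "\<dots> = (norm x)\<^sup>2 - (x \<bullet> u)\<^sup>2"
        unfolding pu power2_norm_eq_inner power2_eq_square[of "x \<bullet> u"]
        by (simp add: p_def inner_diff_left inner_commute[of u x])
      finally have "(norm (p x))\<^sup>2 \<le> (norm x)\<^sup>2" by simp
      then show ?thesis by (rule power2_le_imp_le) simp
    qed
    then have "distr \<mu> borel p \<in> P4" by (intro P4_distr_nonexpansive[OF \<mu>]) auto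
    moreover have "(LINT x|distr \<mu> borel p. (x \<bullet> \<beta>)\<^sup>2 * (x \<bullet> u)\<^sup>2) = 0"
      by (subst integral_distr) (auto simp: pu)
    moreover have "u \<noteq> 0" using u(1) by auto
    ultimately have "distr \<mu> borel p \<in> degenerate \<beta>" unfolding degenerate_def by blast
    then have "W2_set \<mu> (degenerate \<beta>) \<le> ereal (W2 \<mu> (distr \<mu> borel p))"
      unfolding W2_set_def by (rule INF_lower)
    also have "W2 \<mu> (distr \<mu> borel p) \<le> sqrt (LINT x|\<mu>. (x \<bullet> u)\<^sup>2)"
      using W2_projection_le[OF \<mu> u(1)] by (simp add: p_def[abs_def])
    also have "(LINT x|\<mu>. (x \<bullet> u)\<^sup>2) = l"
      using centered_gaussian_moments(1)[OF g, of u] u(1,2)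
      by (simp add: has_bochner_integral_iff power2_norm_eq_inner[symmetric])
    finally show ?thesis by simp
  qed
  have lo: "ereal (sqrt ((1 - 2 / pi) * l)) \<le> W2_set \<mu> (degenerate \<beta>)"
    unfolding W2_set_def
  proof (rule INF_greatest)
    fix \<nu> assume "\<nu> \<in> degenerate \<beta>"
    then obtain w where \<nu>: "\<nu> \<in> P4" and w: "w \<noteq> 0" "(LINT x|\<nu>. (x \<bullet> \<beta>)\<^sup>2 * (x \<bullet> w)\<^sup>2) = 0"
      unfolding degenerate_def by blast
    have "integrable \<nu> (\<lambda>x. (x \<bullet> \<beta>)\<^sup>2 * (x \<bullet> w)\<^sup>2)"
      using inner_mom4(2)[OF \<nu>, of \<beta> \<beta> w w] by (simp add: power2_eq_square mult_ac)
    \<comment> \<open>A nonnegative integrable function with integral 0 vanishes almost everywhere: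
      the law lives on two hyperplanes, which are then given unit normals.\<close>
    then have AE: "AE x in \<nu>. x \<bullet> \<beta> = 0 \<or> x \<bullet> w = 0"
      using w(2) by (subst (asm) integral_nonneg_eq_0_iff_AE) auto
    define a b where "a = \<beta> /\<^sub>R norm \<beta>" and "b = w /\<^sub>R norm w"
    have ab: "norm a = 1" "norm b = 1" using \<beta> w by (auto simp: a_def b_def)
    have "AE x in \<nu>. x \<bullet> a = 0 \<or> x \<bullet> b = 0" using AE by eventually_elim (auto simp: a_def b_def)
    from W2_ge_min_inner[OF \<mu> \<nu> ab this]
    have W: "sqrt (LINT x|\<mu>. min ((x \<bullet> a)\<^sup>2) ((x \<bullet> b)\<^sup>2)) \<le> W2 \<mu> \<nu>" .
    \<comment> \<open>\<open>centered_gaussian_min_inner\<close> needs \<open>0 < l\<close>; for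
      \<open>l = 0\<close> the claim is nonnegativity of the integral.\<close>
    have "(1 - 2 / pi) * l \<le> (LINT x|\<mu>. min ((x \<bullet> a)\<^sup>2) ((x \<bullet> b)\<^sup>2))"
    proof (cases "l = 0")
      case True
      then show ?thesis by (auto intro!: Bochner_Integration.integral_nonneg)
    next
      case False
      then show ?thesis
        using l0 u(3)[of a] u(3)[of b] ab by (intro centered_gaussian_min_inner[OF g]) auto
    qed
    then have "sqrt ((1 - 2 / pi) * l) \<le> sqrt (LINT x|\<mu>. min ((x \<bullet> a)\<^sup>2) ((x \<bullet> b)\<^sup>2))"
      by (rule real_sqrt_le_mono)
    also note W
    finally show "ereal (sqrt ((1 - 2 / pi) * l)) \<le> ereal (W2 \<mu> \<nu>)" by simp
  qed
  \<comment> \<open>Bounded on both sides by reals, the extended real infimum is finite.\<close>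
  from up lo obtain r where "W2_set \<mu> (degenerate \<beta>) = ereal r"
    by (cases "W2_set \<mu> (degenerate \<beta>)") auto
  with that up lo show ?thesis by (simp add: l_def)
qed

text \<open>By the Gaussian moment formula the integral is \<open>s * ((S *v w) \<bullet> w) + 2 *
  ((S *v \<beta>) \<bullet> w)\<^sup>2\<close>. Dropping the square and using the Rayleigh bound
  gives the lower estimate; at the lowest eigenvector \<open>u\<close> Cauchy-Schwarz bounds the
  square by \<open>s * l\<close>, which gives the constant 3.\<close>

lemma centered_gaussian_nondegenerate:
  fixes \<mu> :: "(real^'d) measure"
  assumes S: "S \<in> psd_mats" and g: "centered_gaussian S \<mu>" and \<beta>: "\<beta> \<noteq> 0" and n: "\<mu> \<notin> degenerate \<beta>"
  obtains u where "0 < lambda_min S" "0 < (S *v \<beta>) \<bullet> \<beta>" "norm u = 1"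
    "\<And>w. ((S *v \<beta>) \<bullet> \<beta>) * lambda_min S * (norm w)\<^sup>2 \<le> (LINT x|\<mu>. (x \<bullet> \<beta>)\<^sup>2 * (x \<bullet> w)\<^sup>2)"
    "(LINT x|\<mu>. (x \<bullet> \<beta>)\<^sup>2 * (x \<bullet> u)\<^sup>2) \<le> 3 * (((S *v \<beta>) \<bullet> \<beta>) * lambda_min S)"
proof -
  define l s where "l = lambda_min S" and "s = (S *v \<beta>) \<bullet> \<beta>"
  obtain u where u: "norm u = 1" "S *v u = l *\<^sub>R u" "\<And>w. l * (norm w)\<^sup>2 \<le> (S *v w) \<bullet> w"
    using lambda_min_eigenvector[of S] S unfolding psd_mats_def l_def by blast
  have l0: "0 \<le> l"
    using S u(1,2) unfolding psd_mats_def by (auto simp: power2_norm_eq_inner[symmetric] dest: spec[of _ u])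
  have s0: "0 \<le> s" using S by (simp add: psd_mats_def s_def inner_commute)
  have Q: "(LINT x|\<mu>. (x \<bullet> \<beta>)\<^sup>2 * (x \<bullet> w)\<^sup>2) = s * ((S *v w) \<bullet> w) + 2 * ((S *v \<beta>) \<bullet> w)\<^sup>2" for w
    using centered_gaussian_moments(2)[OF g, of \<beta> w] by (simp add: has_bochner_integral_iff s_def)
  have Su: "(S *v u) \<bullet> u = l" using u(1,2) by (simp add: power2_norm_eq_inner[symmetric])
  have ub: "(LINT x|\<mu>. (x \<bullet> \<beta>)\<^sup>2 * (x \<bullet> u)\<^sup>2) \<le> 3 * (s * l)"
    using psd_mats_cauchy_schwarz[OF S, of \<beta> u] unfolding Q Su s_def[symmetric] by (simp add: mult.commute)
  \<comment> \<open>Outside \<open>degenerate\<close> the moment at \<open>u\<close> is positive;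
    its bound \<open>3 * (s * l)\<close> then forces both factors to be positive.\<close>
  have "u \<noteq> 0" using u(1) by auto
  then have "(LINT x|\<mu>. (x \<bullet> \<beta>)\<^sup>2 * (x \<bullet> u)\<^sup>2) \<noteq> 0"
    using n centered_gaussian_P4[OF g] unfolding degenerate_def by blast
  moreover have "0 \<le> (LINT x|\<mu>. (x \<bullet> \<beta>)\<^sup>2 * (x \<bullet> u)\<^sup>2)"
    by (rule Bochner_Integration.integral_nonneg) simp
  ultimately have "0 < (LINT x|\<mu>. (x \<bullet> \<beta>)\<^sup>2 * (x \<bullet> u)\<^sup>2)" by linarith
  with ub have "0 < s * l" by simp
  with l0 s0 have pos: "0 < l" "0 < s" by (auto simp: zero_less_mult_iff)
  have lb: "s * l * (norm w)\<^sup>2 \<le> (LINT x|\<mu>. (x \<bullet> \<beta>)\<^sup>2 * (x \<bullet> w)\<^sup>2)" for w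
    using mult_left_mono[OF u(3)[of w] s0] unfolding Q by (simp add: mult.assoc add_increasing2)
  show ?thesis using that[of u] pos u(1) lb ub by (simp add: l_def s_def)
qed

text \<open>Independence says that the law of \<open>(X, eps)\<close> factors on rectangles, which
  determines the product measure.\<close>

lemma distr_pair_signal_law:
  fixes X :: "'w \<Rightarrow> real^'d" and eps :: "'w \<Rightarrow> real" and b :: "real^'d"
  assumes P: "prob_space P" and [measurable]: "X \<in> borel_measurable P" "eps \<in> borel_measurable P"
    and indep: "prob_space.indep_set P {X -` A \<inter> space P |A. A \<in> sets borel}
                                {eps -` B \<inter> space P |B. B \<in> sets borel}"
  shows "distr P borel (\<lambda>\<omega>. (X \<omega>, (X \<omega> \<bullet> b)\<^sup>2 + eps \<omega>)) = signal_law (distr P borel X) b (distr P borel eps)"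
proof -
  interpret prob_space P by fact
  interpret X: prob_space "distr P borel X" by (rule prob_space_distr) measurable
  interpret eps: prob_space "distr P borel eps" by (rule prob_space_distr) measurable
  have pair: "distr P borel X \<Otimes>\<^sub>M distr P borel eps = distr P (borel \<Otimes>\<^sub>M borel) (\<lambda>\<omega>. (X \<omega>, eps \<omega>))"
  proof (rule pair_measure_eqI)
    show "sigma_finite_measure (distr P borel X)" "sigma_finite_measure (distr P borel eps)"
      by unfold_locales
    show "sets (distr P borel X \<Otimes>\<^sub>M distr P borel eps)
        = sets (distr P (borel \<Otimes>\<^sub>M borel) (\<lambda>\<omega>. (X \<omega>, eps \<omega>)))"
      by (simp cong: sets_pair_measure_cong)
    fix A B assume "A \<in> sets (distr P borel X)" "B \<in> sets (distr P borel eps)"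
    then have A [measurable]: "A \<in> sets borel" and B [measurable]: "B \<in> sets borel" by simp_all
    have "prob (X -` A \<inter> space P \<inter> (eps -` B \<inter> space P)) = prob (X -` A \<inter> space P) * prob (eps -` B \<inter> space P)"
      by (rule indep_setD[OF indep]) (use A B in auto)
    moreover have "(\<lambda>\<omega>. (X \<omega>, eps \<omega>)) -` (A \<times> B) \<inter> space P = X -` A \<inter> space P \<inter> (eps -` B \<inter> space P)" by auto
    ultimately show "emeasure (distr P borel X) A * emeasure (distr P borel eps) B
        = emeasure (distr P (borel \<Otimes>\<^sub>M borel) (\<lambda>\<omega>. (X \<omega>, eps \<omega>))) (A \<times> B)"
      by (simp add: emeasure_distr emeasure_eq_measure ennreal_mult)
  qed
  have [measurable]: "(\<lambda>(x :: real^'d, e :: real). (x, (x \<bullet> b)\<^sup>2 + e)) \<in> borel \<Otimes>\<^sub>M borel \<rightarrow>\<^sub>M borel"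
    unfolding borel_prod[symmetric] by measurable
  show ?thesis
    unfolding signal_law_def pair by (subst distr_distr) (auto simp: comp_def)
qed

section \<open>The bounds on RSE and on the product of its square with REG\<close>

theorem theorem5p4:
  fixes P :: "'w measure"
    and X :: "'w \<Rightarrow> real^'d" and Y eps :: "'w \<Rightarrow> real"
    and \<beta> :: "real^'d" and \<Sigma> :: "real^'d^'d"
    and D :: "((real^'d) \<times> real) measure" and K :: "real^'d \<Rightarrow> real measure"
  assumes "\<beta> \<noteq> 0"
    and "\<Sigma> \<in> psd_mats"
    and "prob_space P"
    and "X \<in> borel_measurable P" and "eps \<in> borel_measurable P"
    and "centered_gaussian \<Sigma> (distr P borel X)"
    and "prob_space.indep_set P {X -` A \<inter> space P |A. A \<in> sets borel}
                                {eps -` B \<inter> space P |B. B \<in> sets borel}"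
    and "integrable P eps" and "(LINT \<omega>|P. eps \<omega>) = 0"
    and "integrable P (\<lambda>\<omega>. (eps \<omega>)\<^sup>2)"
    and "\<And>\<omega>. Y \<omega> = (X \<omega> \<bullet> \<beta>)\<^sup>2 + eps \<omega>"
    and "D = distr P borel (\<lambda>\<omega>. (X \<omega>, Y \<omega>))"
    and "K = pr_response \<beta> (distr P borel eps)"
  shows
    "ereal (sqrt ((1 - 2 / pi) * lambda_min \<Sigma>)) \<le> RSE_A \<beta> K D
     \<and> RSE_A \<beta> K D \<le> ereal (sqrt (lambda_min \<Sigma>))
     \<and> (distr P borel X \<notin> excA \<beta> K \<longrightarrow>
          ereal ((1/2 * (norm \<beta>)\<^sup>2) * ((1 - 2 / pi) / (3 * ((\<Sigma> *v \<beta>) \<bullet> \<beta>))))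
            \<le> (RSE_A \<beta> K D)\<^sup>2 * REG_A \<beta> D
        \<and> (RSE_A \<beta> K D)\<^sup>2 * REG_A \<beta> D
            \<le> ereal ((norm \<beta>)\<^sup>2 * (1 / ((\<Sigma> *v \<beta>) \<bullet> \<beta>))))
     \<and> ereal (sqrt ((1 - 2 / pi) * lambda_min \<Sigma>)) \<le> RSE_B \<beta> K D
     \<and> RSE_B \<beta> K D \<le> ereal (sqrt (lambda_min \<Sigma>))
     \<and> (distr P borel X \<notin> excB \<beta> K \<longrightarrow>
          ereal (1 * ((1 - 2 / pi) / (3 * ((\<Sigma> *v \<beta>) \<bullet> \<beta>))))
            \<le> (RSE_B \<beta> K D)\<^sup>2 * REG_B \<beta> D
        \<and> (RSE_B \<beta> K D)\<^sup>2 * REG_B \<beta> D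
            \<le> ereal (1 * (1 / ((\<Sigma> *v \<beta>) \<bullet> \<beta>))))"
proof -
  interpret P: prob_space P by fact
  note [measurable] = assms(4,5)
  define \<mu> \<nu> l s where "\<mu> = distr P borel X" and "\<nu> = distr P borel eps"
    and "l = lambda_min \<Sigma>" and "s = (\<Sigma> *v \<beta>) \<bullet> \<beta>"
  have \<mu>: "\<mu> \<in> P4" unfolding \<mu>_def by (rule centered_gaussian_P4[OF assms(6)])
  have \<nu>: "prob_space \<nu>" "sets \<nu> = sets borel" "integrable \<nu> (\<lambda>e. e)" "(LINT e|\<nu>. e) = 0"
    "integrable \<nu> (\<lambda>e. e\<^sup>2)"
    using assms(8-10) by (auto simp: \<nu>_def integrable_distr_eq integral_distr intro!: P.prob_space_distr)
  have D: "D = signal_law \<mu> \<beta> \<nu>"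
    unfolding assms(12,11) \<mu>_def \<nu>_def by (rule distr_pair_signal_law[OF assms(3-5,7)])
  have Dx: "distr D borel fst = \<mu>"
  proof -
    have "(\<lambda>\<omega>. (X \<omega>, Y \<omega>)) \<in> P \<rightarrow>\<^sub>M borel"
      unfolding assms(11) borel_prod[symmetric] by measurable
    moreover have "(fst :: (real^'d) \<times> real \<Rightarrow> _) \<in> borel \<rightarrow>\<^sub>M borel"
      unfolding borel_prod[symmetric] by measurable
    ultimately show ?thesis unfolding assms(12) \<mu>_def by (subst distr_distr) (auto simp: comp_def)
  qed
  have exc: "excA \<beta> K = degenerate \<beta>" "excB \<beta> K = degenerate \<beta>"
    unfolding assms(13) \<nu>_def[symmetric] by (rule exceptional_sets_eq_degenerate[OF assms(1) \<nu>])+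
  obtain r where r: "W2_set \<mu> (degenerate \<beta>) = ereal r" "sqrt ((1 - 2 / pi) * l) \<le> r" "r \<le> sqrt l"
    by (rule W2_set_degenerate_bounds[OF assms(2,6,1), folded \<mu>_def l_def]) (rule that)
  \<comment> \<open>Equal exceptional sets give both problems the same RSE \<open>r\<close>.\<close>
  have RSE: "RSE_A \<beta> K D = ereal r" "RSE_B \<beta> K D = ereal r"
    using exc r(1) unfolding RSE_A_def RSE_B_def RSE_def Dx excA_def excB_def by simp_all
  \<comment> \<open>\<open>r\<^sup>2\<close> lies between \<open>(1 - 2 / pi) * l\<close> and
    \<open>l\<close>, while the bounds on \<open>g\<close> are proportional to
    \<open>1 / (s * l)\<close>: in the product \<open>l\<close> cancels and \<open>s\<close>
    remains.\<close>
  have scaled: "ereal (k * ((1 - 2 / pi) / (3 * s))) \<le> (ereal r)\<^sup>2 * ereal g \<and>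
      (ereal r)\<^sup>2 * ereal g \<le> ereal (k' * (1 / s))"
    if l: "0 < l" and s: "0 < s" and k: "0 \<le> k" and g: "k / (3 * (s * l)) \<le> g" "g \<le> k' / (s * l)"
    for k k' g
  proof -
    have pi: "0 \<le> 1 - 2 / pi" using pi_ge_two by simp
    have r0: "0 \<le> r" using r(2) pi l by (meson mult_nonneg_nonneg less_imp_le real_sqrt_ge_zero order_trans)
    have r2: "(1 - 2 / pi) * l \<le> r\<^sup>2" "r\<^sup>2 \<le> l"
      using r(2) r0 power_mono[OF r(3) r0, of 2] l
      by (auto simp: real_le_rsqrt sqrt_le_D)
    have g0: "0 \<le> g" using g(1) k l s by (meson divide_nonneg_pos mult_pos_pos order_trans zero_less_numeral)
    have "k * ((1 - 2 / pi) / (3 * s)) = ((1 - 2 / pi) * l) * (k / (3 * (s * l)))"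
      using l s by (simp add: field_simps)
    also have "\<dots> \<le> r\<^sup>2 * g"
      using r2 g k l s pi by (intro mult_mono) auto
    finally have 1: "k * ((1 - 2 / pi) / (3 * s)) \<le> r\<^sup>2 * g" .
    have "r\<^sup>2 * g \<le> l * (k' / (s * l))" using r2 g g0 l by (intro mult_mono) auto
    also have "\<dots> = k' * (1 / s)" using l s by (simp add: field_simps)
    finally show ?thesis using 1 by simp
  qed
  have main: "(ereal ((1/2 * (norm \<beta>)\<^sup>2) * ((1 - 2 / pi) / (3 * s))) \<le> (ereal r)\<^sup>2 * REG_A \<beta> D
        \<and> (ereal r)\<^sup>2 * REG_A \<beta> D \<le> ereal ((norm \<beta>)\<^sup>2 * (1 / s)))
      \<and> ereal (1 * ((1 - 2 / pi) / (3 * s))) \<le> (ereal r)\<^sup>2 * REG_B \<beta> D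
        \<and> (ereal r)\<^sup>2 * REG_B \<beta> D \<le> ereal (1 * (1 / s))"
    if n: "\<mu> \<notin> degenerate \<beta>"
  proof -
    interpret phase_retrieval \<mu> \<beta> \<nu>
      by (rule phase_retrieval.intro[OF \<mu> assms(1) \<nu>])
    \<comment> \<open>The Gaussian itself is nondegenerate, so \<open>s * l\<close> bounds
      \<open>Q\<close> from below on unit vectors and \<open>3 * (s * l)\<close> bounds it at
      \<open>u\<close>; these serve as \<open>c\<close> and \<open>C\<close> in the bounds on
      REG.\<close>
    obtain u where u: "0 < l" "0 < s" "norm u = 1" "\<And>w. s * l * (norm w)\<^sup>2 \<le> Q w" "Q u \<le> 3 * (s * l)"
      by (rule centered_gaussian_nondegenerate[OF assms(2,6,1) n[unfolded \<mu>_def],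
            folded \<mu>_def l_def s_def, folded Q_def]) (rule that)
    have pos: "0 < Q w" if "w \<noteq> 0" for w
      using u(4)[of w] u(1,2) that by (smt (verit) mult_pos_pos zero_less_norm_iff zero_less_power)
    have sl: "0 < s * l" using u(1,2) by simp
    obtain gA where gA: "REG_A \<beta> J = ereal gA" "1/2 * (norm \<beta>)\<^sup>2 / (3 * (s * l)) \<le> gA"
      "gA \<le> (norm \<beta>)\<^sup>2 / (s * l)"
      by (rule REG_A_bounds[OF _ sl u(4,3,5)]) (erule pos, rule that)
    obtain gB where gB: "REG_B \<beta> J = ereal gB" "1 / (3 * (s * l)) \<le> gB" "gB \<le> 1 / (s * l)"
      by (rule REG_B_bounds[OF _ sl u(4,3,5)]) (erule pos, rule that)
    show ?thesis
      unfolding D gA(1) gB(1)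
      using scaled[OF u(1,2) _ gA(2,3)] scaled[OF u(1,2) _ gB(2,3)] by simp
  qed
  show ?thesis
    unfolding RSE exc \<mu>_def[symmetric] s_def[symmetric] l_def[symmetric]
    using r(2,3) main by simp
qed

end
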